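(* Let $X$ be a complex Banach space, let $\mu\in\mathcal{A}_\infty$, and let $\mathcal{U}=\{U(t,s)\}_{t\ge s}$ be an evolution family on $X$ for which there are constants $\alpha>0$, $K\ge 1$ with $$\|U(s,\tau)\|\le Ke^{\alpha(\mu(s)-\mu(\tau))}\quad\text{for all } s\ge\tau.$$ Let $\{T_t\}_{t\ge 0}$ be the generalized evolution semigroup on $C_0(\mathbb{R},X)$, $$T_tu(s)=U(s,\mu^{-1}(\mu(s)-t))\,u(\mu^{-1}(\mu(s)-t)),\quad t\ge 0,\ s\in\mathbb{R},$$ and let $(G,D(G))$ be its generator. The following statements are equivalent: (a) $\mathcal{U}$ admits a $\mu$-exponential dichotomy; (b) $\{T_t\}_{t\ge 0}$ is hyperbolic; (c) $\sigma(G)\cap i\mathbb{R}=\emptyset$; (d) $G$ is invertible. Moreover, if these statements hold and $\mu$ is continuously differentiable, then the inverse of $G$ is given by $$(G^{-1}f)(t)=-\int_{\mathbb{R}}\mu'(\xi)\,\Gamma(t,\xi)f(\xi)\,d\xi$$ for all $f\in C_0(\mathbb{R},X)$ and $t\in\mathbb{R}$, where $\Gamma$ is the Green function associated to the $\mu$-exponential dichotomy of $\mathcal{U}$.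
   Context: $\mathcal{A}_\infty$ is the set of continuous, strictly increasing functions $\mu:\mathbb{R}\to\mathbb{R}$ with $\lim_{s\to-\infty}\mu(s)=-\infty$ and $\lim_{s\to+\infty}\mu(s)=+\infty$. A (strongly continuous) evolution family on $X$ is a collection of bounded linear operators $U(t,s)$, $t\ge s$ in $\mathbb{R}$, on $X$ such that $U(t,t)=\mathrm{Id}$ for all $t$; $U(t,\tau)U(\tau,t_0)=U(t,t_0)$ for $t\ge\tau\ge t_0$; and for each $x\in X$ the map $(t,s)\mapsto U(t,s)x$ is continuous on $\{(t,s)\in\mathbb{R}^2: t\ge s\}$. $C_0(\mathbb{R},X)$ is the Banach space of continuous functions $u:\mathbb{R}\to X$ with $\lim_{|s|\to\infty}u(s)=0$, with the sup-norm. Under the stated hypotheses $\{T_t\}_{t\ge 0}$ is a $C_0$-semigroup on $C_0(\mathbb{R},X)$. Projections $P(t):X\to X$, $t\in\mathbb{R}$, with $Q(t)=\mathrm{Id}-P(t)$, are compatible with $\mathcal{U}$ if for all $t\ge s$ one has $P(t)U(t,s)=U(t,s)P(s)$ and the restriction $U_Q(t,s):Q(s)X\to Q(t)X$ of $U(t,s)$ is invertible; write $U_Q(s,t)=U_Q(t,s)^{-1}$ for $t\ge s$. $\mathcal{U}$ admits a $\mu$-exponential dichotomy if there exist projections $P(t)$, $t\in\mathbb{R}$, compatible with $\mathcal{U}$ and constants $\nu>0$, $N\ge 1$ such that $$\|U(t,s)P(s)\|\le Ne^{-\nu(\mu(t)-\mu(s))}\quad\text{and}\quad\|U_Q(s,t)Q(t)\|\le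 Ne^{-\nu(\mu(t)-\mu(s))}\quad\text{for all } t\ge s.$$ In that case the associated Green function is $\Gamma(t,s)=U(t,s)P(s)$ for $t>s$ and $\Gamma(t,s)=-U_Q(t,s)Q(s)$ for $t<s$. A $C_0$-semigroup $\{T_t\}_{t\ge 0}$ is hyperbolic if $\sigma(T_t)\cap\mathbb{T}=\emptyset$ for some (equivalently, all) $t>0$, where $\mathbb{T}=\{\lambda\in\mathbb{C}:|\lambda|=1\}$. $\sigma(\cdot)$ denotes the spectrum. $G$ is invertible means $0$ is in the resolvent set of $G$, i.e. $G:D(G)\to C_0(\mathbb{R},X)$ is bijective with bounded inverse. *)

theory Defs
  imports "HOL-Analysis.Analysis"
begin

section \<open>Complex Banach spaces\<close>

text \<open>The distribution only provides real normed spaces as type classes. The classes below add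
  a complex scalar multiplication that extends the real one and is compatible with the norm.\<close>

class complex_normed_vector = real_normed_vector +
  fixes scaleC :: "complex \<Rightarrow> 'a \<Rightarrow> 'a"
  assumes scaleC_add_right: "scaleC c (x + y) = scaleC c x + scaleC c y"
    and scaleC_add_left: "scaleC (c + d) x = scaleC c x + scaleC d x"
    and scaleC_scaleC: "scaleC c (scaleC d x) = scaleC (c * d) x"
    and scaleR_scaleC: "r *\<^sub>R x = scaleC (complex_of_real r) x"
    and norm_scaleC: "norm (scaleC c x) = cmod c * norm x"

class complex_banach = complex_normed_vector + banach

definition bounded_clinear :: "('a::complex_normed_vector \<Rightarrow> 'b::complex_normed_vector) \<Rightarrow> bool"
  where "bounded_clinear f \<longleftrightarrow>
    bounded_linear f \<and> (\<forall>c x. f (scaleC c x) = scaleC c (f x))"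

section \<open>The space of continuous functions vanishing at infinity\<close>

typedef (overloaded) 'a c0fun =
  "{u :: real \<Rightarrow> 'a::real_normed_vector. continuous_on UNIV u \<and> (u \<longlongrightarrow> 0) at_infinity}"
  morphisms apply_c0 Abs_c0
  by (rule exI[of _ "\<lambda>_. 0"]) auto

lemma c0_cont [simp]: "continuous_on A (apply_c0 u)"
  using apply_c0[of u] continuous_on_subset by blast

lemma c0_lim: "(apply_c0 u \<longlongrightarrow> 0) at_infinity"
  using apply_c0[of u] by blast

lemma apply_Abs_c0:
  "continuous_on UNIV u \<Longrightarrow> (u \<longlongrightarrow> 0) at_infinity \<Longrightarrow> apply_c0 (Abs_c0 u) = u"
  by (simp add: Abs_c0_inverse)

lemma c0_eqI: "(\<And>s. apply_c0 u s = apply_c0 v s) \<Longrightarrow> u = v"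
  by (metis apply_c0_inject ext)

lemma c0_bounded: "bounded (range (apply_c0 u))"
proof -
  have "eventually (\<lambda>s. norm (apply_c0 u s) < 1) at_infinity"
    using tendstoD[OF c0_lim[of u], of 1] by (simp add: dist_norm)
  then obtain b where b: "\<And>s. norm s \<ge> b \<Longrightarrow> norm (apply_c0 u s) < 1"
    unfolding eventually_at_infinity by blast
  have "bounded (apply_c0 u ` cball 0 b)"
    by (intro compact_imp_bounded compact_continuous_image) auto
  then obtain B where B: "\<And>s. s \<in> cball 0 b \<Longrightarrow> norm (apply_c0 u s) \<le> B"
    unfolding bounded_iff by blast
  have "norm (apply_c0 u s) \<le> max 1 B" for s
    using b[of s] B[of s] by (cases "norm s \<ge> b") (auto simp: max_def)
  then show ?thesis
    unfolding bounded_iff by blast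
qed

lemma c0_bdd: "bdd_above (range (\<lambda>s. norm (apply_c0 u s)))"
  using c0_bounded[of u] unfolding bounded_iff bdd_above_def by auto

instantiation c0fun :: (real_normed_vector) real_vector
begin

definition zero_c0fun where "0 = Abs_c0 (\<lambda>_. 0)"
definition plus_c0fun where "u + v = Abs_c0 (\<lambda>s. apply_c0 u s + apply_c0 v s)"
definition minus_c0fun where "u - v = Abs_c0 (\<lambda>s. apply_c0 u s - apply_c0 v s)"
definition uminus_c0fun where "- u = Abs_c0 (\<lambda>s. - apply_c0 u s)"
definition scaleR_c0fun where "r *\<^sub>R u = Abs_c0 (\<lambda>s. r *\<^sub>R apply_c0 u s)"

lemma apply_c0_zero [simp]: "apply_c0 0 = (\<lambda>_. 0)"
  unfolding zero_c0fun_def by (rule apply_Abs_c0) auto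

lemma apply_c0_plus [simp]: "apply_c0 (u + v) = (\<lambda>s. apply_c0 u s + apply_c0 v s)"
  unfolding plus_c0fun_def
  using tendsto_add[OF c0_lim[of u] c0_lim[of v]]
  by (intro apply_Abs_c0) (auto intro!: continuous_intros)

lemma apply_c0_minus [simp]: "apply_c0 (u - v) = (\<lambda>s. apply_c0 u s - apply_c0 v s)"
  unfolding minus_c0fun_def
  using tendsto_diff[OF c0_lim[of u] c0_lim[of v]]
  by (intro apply_Abs_c0) (auto intro!: continuous_intros)

lemma apply_c0_uminus [simp]: "apply_c0 (- u) = (\<lambda>s. - apply_c0 u s)"
  unfolding uminus_c0fun_def
  using tendsto_minus[OF c0_lim[of u]]
  by (intro apply_Abs_c0) (auto intro!: continuous_intros)

lemma apply_c0_scaleR [simp]: "apply_c0 (r *\<^sub>R u) = (\<lambda>s. r *\<^sub>R apply_c0 u s)"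
  unfolding scaleR_c0fun_def
  using tendsto_scaleR[OF tendsto_const c0_lim[of u], of r]
  by (intro apply_Abs_c0) (auto intro!: continuous_intros)

instance
  by standard (rule c0_eqI, simp add: algebra_simps)+

end

instantiation c0fun :: (real_normed_vector) real_normed_vector
begin

definition norm_c0fun :: "'a c0fun \<Rightarrow> real"
  where "norm_c0fun u = (SUP s. norm (apply_c0 u s))"
definition dist_c0fun :: "'a c0fun \<Rightarrow> 'a c0fun \<Rightarrow> real"
  where "dist_c0fun u v = norm (u - v)"
definition sgn_c0fun :: "'a c0fun \<Rightarrow> 'a c0fun"
  where "sgn_c0fun u = u /\<^sub>R norm u"
definition uniformity_c0fun :: "('a c0fun \<times> 'a c0fun) filter"
  where "uniformity_c0fun = (INF e\<in>{0 <..}. principal {(x, y). dist x y < e})"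
definition open_c0fun :: "'a c0fun set \<Rightarrow> bool"
  where "open_c0fun S = (\<forall>x\<in>S. \<forall>\<^sub>F (x', y) in uniformity. x' = x \<longrightarrow> y \<in> S)"

lemma c0_norm_ge: "norm (apply_c0 u s) \<le> norm u"
  unfolding norm_c0fun_def by (rule cSUP_upper[OF UNIV_I c0_bdd])

lemma c0_norm_le: "(\<And>s. norm (apply_c0 u s) \<le> b) \<Longrightarrow> norm u \<le> b"
  unfolding norm_c0fun_def by (rule cSUP_least) auto

instance
proof
  fix a :: real and u v :: "'a c0fun"
  show "dist u v = norm (u - v)" "sgn u = u /\<^sub>R norm u"
    by (simp_all add: dist_c0fun_def sgn_c0fun_def)
  show "norm u = 0 \<longleftrightarrow> u = 0"
  proof
    assume "norm u = 0"
    then show "u = 0"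
      using c0_norm_ge[of u] by (auto intro!: c0_eqI)
  next
    assume "u = 0"
    then show "norm u = 0"
      by (simp add: norm_c0fun_def)
  qed
  show "norm (u + v) \<le> norm u + norm v"
    by (rule c0_norm_le) (auto intro!: norm_triangle_le add_mono c0_norm_ge)
  have le: "norm (r *\<^sub>R x) \<le> \<bar>r\<bar> * norm x" for r and x :: "'a c0fun"
    by (rule c0_norm_le) (auto intro!: mult_left_mono c0_norm_ge)
  show "norm (a *\<^sub>R u) = \<bar>a\<bar> * norm u"
  proof (cases "a = 0")
    case True
    then show ?thesis
      by (simp add: norm_c0fun_def)
  next
    case False
    have "u = inverse a *\<^sub>R (a *\<^sub>R u)"
      using False by (auto intro!: c0_eqI)
    then have "norm u \<le> \<bar>inverse a\<bar> * norm (a *\<^sub>R u)"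
      using le by metis
    then have "\<bar>a\<bar> * norm u \<le> norm (a *\<^sub>R u)"
      using False by (simp add: field_simps)
    then show ?thesis
      using le[of a u] by simp
  qed
qed (rule open_c0fun_def uniformity_c0fun_def)+

end

instance c0fun :: (banach) banach
proof
  fix X :: "nat \<Rightarrow> 'a c0fun"
  assume X: "Cauchy X"
  have "uniformly_Cauchy_on UNIV (\<lambda>n. apply_c0 (X n))"
    unfolding uniformly_Cauchy_on_def
  proof safe
    fix e :: real
    assume "e > 0"
    with X obtain M where M: "\<And>m n. m \<ge> M \<Longrightarrow> n \<ge> M \<Longrightarrow> dist (X m) (X n) < e"
      unfolding Cauchy_def by blast
    have "dist (apply_c0 (X m) s) (apply_c0 (X n) s) < e" if "m \<ge> M" "n \<ge> M" for m n s
      using M[OF that] c0_norm_ge[of "X m - X n" s] by (simp add: dist_norm)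
    then show "\<exists>M. \<forall>x\<in>UNIV. \<forall>m\<ge>M. \<forall>n\<ge>M. dist (apply_c0 (X m) x) (apply_c0 (X n) x) < e"
      by blast
  qed
  then obtain g where g: "uniform_limit UNIV (\<lambda>n. apply_c0 (X n)) g sequentially"
    using Cauchy_uniformly_convergent uniformly_convergent_on_def by blast
  have cont: "continuous_on UNIV g"
    by (rule uniform_limit_theorem[OF _ g]) auto
  have lim: "(g \<longlongrightarrow> 0) at_infinity"
  proof (rule tendstoI)
    fix e :: real
    assume e: "e > 0"
    then have "\<forall>\<^sub>F n in sequentially. \<forall>s\<in>UNIV. dist (apply_c0 (X n) s) (g s) < e / 2"
      by (intro uniform_limitD[OF g]) simp
    then obtain n where n: "\<And>s. dist (apply_c0 (X n) s) (g s) < e / 2"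
      by (auto simp: eventually_sequentially)
    have "\<forall>\<^sub>F s in at_infinity. dist (apply_c0 (X n) s) 0 < e / 2"
      using e by (intro tendstoD[OF c0_lim]) simp
    then show "\<forall>\<^sub>F s in at_infinity. dist (g s) 0 < e"
    proof eventually_elim
      case (elim s)
      then show ?case
        using n[of s] dist_triangle2[of "g s" 0 "apply_c0 (X n) s"]
          dist_triangle[of "g s" 0 "apply_c0 (X n) s"]
        by (simp add: dist_commute)
    qed
  qed
  have "X \<longlonglongrightarrow> Abs_c0 g"
  proof (rule tendstoI)
    fix e :: real
    assume e: "e > 0"
    then have "\<forall>\<^sub>F n in sequentially. \<forall>s\<in>UNIV. dist (apply_c0 (X n) s) (g s) < e / 2"
      by (intro uniform_limitD[OF g]) simp
    then show "\<forall>\<^sub>F n in sequentially. dist (X n) (Abs_c0 g) < e"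
    proof eventually_elim
      case (elim n)
      have "norm (X n - Abs_c0 g) \<le> e / 2"
        using elim by (intro c0_norm_le) (auto simp: apply_Abs_c0[OF cont lim] dist_norm less_imp_le)
      then show ?case
        using e by (simp add: dist_norm)
    qed
  qed
  then show "convergent X"
    by (rule convergentI)
qed

instantiation c0fun :: (complex_normed_vector) complex_normed_vector
begin

definition scaleC_c0fun where "scaleC c u = Abs_c0 (\<lambda>s. scaleC c (apply_c0 u s))"

lemma bounded_linear_scaleC: "bounded_linear (scaleC c :: 'a \<Rightarrow> 'a)"
proof (rule bounded_linear_intro[of _ "cmod c"])
  show "scaleC c (r *\<^sub>R x) = r *\<^sub>R scaleC c x" for r and x :: 'a
    by (simp add: scaleR_scaleC scaleC_scaleC mult.commute)
qed (simp_all add: scaleC_add_right norm_scaleC)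

lemma apply_c0_scaleC [simp]: "apply_c0 (scaleC c u) = (\<lambda>s. scaleC c (apply_c0 u s))"
  unfolding scaleC_c0fun_def
proof (rule apply_Abs_c0)
  show "continuous_on UNIV (\<lambda>s. scaleC c (apply_c0 u s))"
    by (rule bounded_linear.continuous_on[OF bounded_linear_scaleC c0_cont])
  show "((\<lambda>s. scaleC c (apply_c0 u s)) \<longlongrightarrow> 0) at_infinity"
    using bounded_linear.tendsto[OF bounded_linear_scaleC c0_lim, of c u]
    by (simp add: bounded_linear.linear[OF bounded_linear_scaleC, THEN linear_0])
qed

instance
proof
  fix c d :: complex and r :: real and u v :: "'a c0fun"
  show "scaleC c (u + v) = scaleC c u + scaleC c v"
    "scaleC (c + d) u = scaleC c u + scaleC d u"
    "scaleC c (scaleC d u) = scaleC (c * d) u"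
    "r *\<^sub>R u = scaleC (complex_of_real r) u"
    by (rule c0_eqI, simp add: scaleC_add_right scaleC_add_left scaleC_scaleC scaleR_scaleC)+
  have eq: "norm (apply_c0 (scaleC c u) s) = norm (apply_c0 (cmod c *\<^sub>R u) s)" for s
    by (simp add: norm_scaleC)
  have "norm (scaleC c u) = norm (cmod c *\<^sub>R u)"
    unfolding norm_c0fun_def eq ..
  then show "norm (scaleC c u) = cmod c * norm u"
    by simp
qed

end

instance c0fun :: (complex_banach) complex_banach ..

section \<open>Spectrum and generator\<close>

text \<open>A possibly unbounded operator is given by its domain \<open>D\<close> and a total function \<open>A\<close>
  of which only the values on \<open>D\<close> matter; bounded operators have domain \<open>UNIV\<close>.\<close>

definition resolvent_set :: "'a set \<Rightarrow> ('a \<Rightarrow> 'a::complex_normed_vector) \<Rightarrow> complex set"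
  where "resolvent_set D A =
    {z. bij_betw (\<lambda>x. scaleC z x - A x) D UNIV \<and>
        bounded_clinear (inv_into D (\<lambda>x. scaleC z x - A x))}"

definition spectrum :: "'a set \<Rightarrow> ('a \<Rightarrow> 'a::complex_normed_vector) \<Rightarrow> complex set"
  where "spectrum D A = - resolvent_set D A"

definition gen_dom :: "(real \<Rightarrow> 'a \<Rightarrow> 'a::real_normed_vector) \<Rightarrow> 'a set"
  where "gen_dom T = {x. \<exists>y. ((\<lambda>t. (T t x - x) /\<^sub>R t) \<longlongrightarrow> y) (at_right 0)}"

definition gen :: "(real \<Rightarrow> 'a \<Rightarrow> 'a::real_normed_vector) \<Rightarrow> 'a \<Rightarrow> 'a"
  where "gen T x = Lim (at_right 0) (\<lambda>t. (T t x - x) /\<^sub>R t)"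

definition hyperbolic :: "(real \<Rightarrow> 'a \<Rightarrow> 'a::complex_normed_vector) \<Rightarrow> bool"
  where "hyperbolic T \<longleftrightarrow> (\<exists>t>0. spectrum UNIV (T t) \<inter> {z. cmod z = 1} = {})"

section \<open>Growth rates, evolution families and dichotomies\<close>

definition growth_rates :: "(real \<Rightarrow> real) set"
  where "growth_rates =
    {\<mu>. continuous_on UNIV \<mu> \<and> strict_mono \<mu> \<and>
        filterlim \<mu> at_bot at_bot \<and> filterlim \<mu> at_top at_top}"

text \<open>In \<open>U t s\<close> only the arguments with \<open>s \<le> t\<close> are meaningful.\<close>

definition evolution_family :: "(real \<Rightarrow> real \<Rightarrow> 'a \<Rightarrow> 'a::complex_normed_vector) \<Rightarrow> bool"
  where "evolution_family U \<longleftrightarrow>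
    (\<forall>t s. s \<le> t \<longrightarrow> bounded_clinear (U t s)) \<and>
    (\<forall>t. U t t = id) \<and>
    (\<forall>t \<tau> r. r \<le> \<tau> \<longrightarrow> \<tau> \<le> t \<longrightarrow> U t \<tau> \<circ> U \<tau> r = U t r) \<and>
    (\<forall>x. continuous_on {(t, s). s \<le> t} (\<lambda>(t, s). U t s x))"

definition compl_proj :: "(real \<Rightarrow> 'a \<Rightarrow> 'a) \<Rightarrow> real \<Rightarrow> 'a \<Rightarrow> 'a::real_normed_vector"
  where "compl_proj P t x = x - P t x"

definition compatible_projections ::
  "(real \<Rightarrow> real \<Rightarrow> 'a \<Rightarrow> 'a::complex_normed_vector) \<Rightarrow> (real \<Rightarrow> 'a \<Rightarrow> 'a) \<Rightarrow> bool"
  where "compatible_projections U P \<longleftrightarrow>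
    (\<forall>t. bounded_clinear (P t) \<and> P t \<circ> P t = P t) \<and>
    (\<forall>t s. s \<le> t \<longrightarrow>
       P t \<circ> U t s = U t s \<circ> P s \<and>
       bij_betw (U t s) (range (compl_proj P s)) (range (compl_proj P t)))"

text \<open>For \<open>s \<le> t\<close>, \<open>U_Q_back U P s t\<close> is the inverse of the restriction of \<open>U t s\<close> to the
  range of \<open>compl_proj P s\<close>; it is meaningful on the range of \<open>compl_proj P t\<close>.\<close>

definition U_Q_back ::
  "(real \<Rightarrow> real \<Rightarrow> 'a \<Rightarrow> 'a::real_normed_vector) \<Rightarrow> (real \<Rightarrow> 'a \<Rightarrow> 'a) \<Rightarrow> real \<Rightarrow> real \<Rightarrow> 'a \<Rightarrow> 'a"
  where "U_Q_back U P s t = inv_into (range (compl_proj P s)) (U t s)"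

text \<open>As \<open>onorm\<close> is only meaningful for bounded operators, boundedness of the second operator,
  which is implicit in its norm estimate, is spelled out.\<close>

definition dichotomy_with ::
  "(real \<Rightarrow> real) \<Rightarrow> (real \<Rightarrow> real \<Rightarrow> 'a \<Rightarrow> 'a::complex_normed_vector) \<Rightarrow>
     (real \<Rightarrow> 'a \<Rightarrow> 'a) \<Rightarrow> bool"
  where "dichotomy_with \<mu> U P \<longleftrightarrow>
    compatible_projections U P \<and>
    (\<exists>\<nu> N. \<nu> > 0 \<and> N \<ge> 1 \<and>
      (\<forall>t s. s \<le> t \<longrightarrow>
        onorm (U t s \<circ> P s) \<le> N * exp (- \<nu> * (\<mu> t - \<mu> s)) \<and>
        bounded_linear (U_Q_back U P s t \<circ> compl_proj P t) \<and>
        onorm (U_Q_back U P s t \<circ> compl_proj P t) \<le> N * exp (- \<nu> * (\<mu> t - \<mu> s))))"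

definition admits_dichotomy ::
  "(real \<Rightarrow> real) \<Rightarrow> (real \<Rightarrow> real \<Rightarrow> 'a \<Rightarrow> 'a::complex_normed_vector) \<Rightarrow> bool"
  where "admits_dichotomy \<mu> U \<longleftrightarrow> (\<exists>P. dichotomy_with \<mu> U P)"

text \<open>The Green function is not defined on the diagonal; the value 0 there is arbitrary.\<close>

definition green ::
  "(real \<Rightarrow> real \<Rightarrow> 'a \<Rightarrow> 'a::real_normed_vector) \<Rightarrow> (real \<Rightarrow> 'a \<Rightarrow> 'a) \<Rightarrow> real \<Rightarrow> real \<Rightarrow> 'a \<Rightarrow> 'a"
  where "green U P t s x =
    (if s < t then U t s (P s x)
     else if t < s then - U_Q_back U P t s (compl_proj P s x)
     else 0)"

section \<open>The generalized evolution semigroup\<close>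

definition evol_semigroup ::
  "(real \<Rightarrow> real) \<Rightarrow> (real \<Rightarrow> real \<Rightarrow> 'a \<Rightarrow> 'a::real_normed_vector) \<Rightarrow> real \<Rightarrow> 'a c0fun \<Rightarrow> 'a c0fun"
  where "evol_semigroup \<mu> U t u =
    Abs_c0 (\<lambda>s. U s (inv \<mu> (\<mu> s - t)) (apply_c0 u (inv \<mu> (\<mu> s - t))))"

lemma growth_rate_surj:
  assumes "\<mu> \<in> growth_rates"
  shows "surj \<mu>"
proof -
  have "\<exists>x. \<mu> x = y" for y
  proof -
    have "\<forall>\<^sub>F x in at_bot. \<mu> x \<le> y" "\<forall>\<^sub>F x in at_top. y \<le> \<mu> x"
      using assms by (auto simp: growth_rates_def filterlim_at_bot filterlim_at_top)
    then obtain a b where a: "\<And>x. x \<le> a \<Longrightarrow> \<mu> x \<le> y" and b: "\<And>x. x \<ge> b \<Longrightarrow> y \<le> \<mu> x"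
      unfolding eventually_at_bot_linorder eventually_at_top_linorder by blast
    have "continuous_on {min a b..b} \<mu>"
      using assms continuous_on_subset unfolding growth_rates_def by blast
    with IVT'[of \<mu> "min a b" y b] a[of "min a b"] b[of b] show ?thesis
      by auto
  qed
  then show ?thesis
    by (metis surjI)
qed

text \<open>\<open>Abs_c0\<close> in the definition of \<open>evol_semigroup\<close> is applied to an element of the space.\<close>

lemma apply_evol_semigroup:
  fixes U :: "real \<Rightarrow> real \<Rightarrow> 'a \<Rightarrow> 'a::complex_normed_vector"
  assumes mu: "\<mu> \<in> growth_rates" and U: "evolution_family U"
    and bnd: "\<And>s \<tau>. \<tau> \<le> s \<Longrightarrow> onorm (U s \<tau>) \<le> K * exp (\<alpha> * (\<mu> s - \<mu> \<tau>))"
    and t: "t \<ge> 0"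
  shows "apply_c0 (evol_semigroup \<mu> U t u) s =
    U s (inv \<mu> (\<mu> s - t)) (apply_c0 u (inv \<mu> (\<mu> s - t)))"
proof -
  define g where "g s = inv \<mu> (\<mu> s - t)" for s
  define C where "C = K * exp (\<alpha> * t)"
  have sm: "strict_mono \<mu>" and cm: "continuous_on UNIV \<mu>"
    and top: "filterlim \<mu> at_top at_top" and bot: "filterlim \<mu> at_bot at_bot"
    using mu by (auto simp: growth_rates_def)
  have sur: "surj \<mu>"
    by (rule growth_rate_surj[OF mu])
  have mi: "\<mu> (inv \<mu> y) = y" for y
    by (rule surj_f_inv_f[OF sur])
  have im: "inv \<mu> (\<mu> x) = x" for x
    using sm by (simp add: strict_mono_imp_inj_on)
  have mle: "\<mu> x \<le> \<mu> y \<longleftrightarrow> x \<le> y" for x y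
    using sm by (rule strict_mono_less_eq)
  have g_mu: "\<mu> (g s) = \<mu> s - t" for s
    by (simp add: g_def mi)
  have g_le: "g s \<le> s" for s
    using t mle[of "g s" s] by (simp add: g_mu)
  have "surj (inv \<mu>)"
    by (rule surjI[of _ \<mu>]) (rule im)
  then have "continuous_on UNIV (inv \<mu>)"
  proof (intro continuous_onI_mono)
    show "inv \<mu> x \<le> inv \<mu> y" if "x \<le> y" for x y
      using that mle[of "inv \<mu> x" "inv \<mu> y"] by (simp only: mi)
  qed simp
  then have g_cont: "continuous_on UNIV g"
    unfolding g_def
    by (rule continuous_on_compose2[OF _ continuous_on_diff[OF cm continuous_on_const] subset_UNIV])
  have bl: "bounded_linear (U s (g s))" for s
    using U g_le by (auto simp: evolution_family_def bounded_clinear_def)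
  have nb: "norm (U s (g s) x) \<le> C * norm x" for s x
  proof -
    have "norm (U s (g s) x) \<le> onorm (U s (g s)) * norm x"
      by (rule onorm[OF bl])
    also have "\<dots> \<le> C * norm x"
      using bnd[OF g_le[of s]] by (intro mult_right_mono) (simp_all add: g_mu C_def)
    finally show ?thesis .
  qed
  have cont: "continuous_on UNIV (\<lambda>s. U s (g s) (apply_c0 u (g s)))"
    unfolding continuous_on_def
  proof
    fix s0 :: real
    let ?y = "apply_c0 u (g s0)"
    have "continuous_on {(t, s). s \<le> t} (\<lambda>(t, s). U t s ?y)"
      using U by (simp add: evolution_family_def)
    moreover have "continuous_on UNIV (\<lambda>s. (s, g s))"
      by (intro continuous_on_Pair continuous_on_id g_cont)
    moreover have "range (\<lambda>s. (s, g s)) \<subseteq> {(t, s). s \<le> t}"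
      using g_le by auto
    ultimately have "continuous_on UNIV (\<lambda>s. (\<lambda>(t, s). U t s ?y) (s, g s))"
      by (rule continuous_on_compose2)
    then have 1: "((\<lambda>s. U s (g s) ?y) \<longlongrightarrow> U s0 (g s0) ?y) (at s0 within UNIV)"
      by (simp add: continuous_on_def)
    have "continuous_on UNIV (\<lambda>s. apply_c0 u (g s))"
      by (rule continuous_on_compose2[OF c0_cont g_cont]) auto
    then have "((\<lambda>s. apply_c0 u (g s)) \<longlongrightarrow> ?y) (at s0 within UNIV)"
      by (simp add: continuous_on_def)
    then have "((\<lambda>s. apply_c0 u (g s) - ?y) \<longlongrightarrow> 0) (at s0 within UNIV)"
      by (simp only: LIM_zero)
    then have C0: "((\<lambda>s. C * norm (apply_c0 u (g s) - ?y)) \<longlongrightarrow> 0) (at s0 within UNIV)"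
      by (intro tendsto_mult_right_zero tendsto_norm_zero)
    have 2: "((\<lambda>s. U s (g s) (apply_c0 u (g s) - ?y)) \<longlongrightarrow> 0) (at s0 within UNIV)"
      by (rule Lim_null_comparison[OF always_eventually C0]) (simp add: nb)
    have "(\<lambda>s. U s (g s) (apply_c0 u (g s))) =
        (\<lambda>s. U s (g s) (apply_c0 u (g s) - ?y) + U s (g s) ?y)"
      by (simp add: linear_diff[OF bounded_linear.linear[OF bl]])
    then show "((\<lambda>s. U s (g s) (apply_c0 u (g s))) \<longlongrightarrow> U s0 (g s0) ?y) (at s0 within UNIV)"
      using tendsto_add[OF 2 1] by simp
  qed
  have gtop: "filterlim g at_top at_top"
    unfolding filterlim_at_top
  proof
    fix Z
    have "\<forall>\<^sub>F s in at_top. \<mu> s \<ge> \<mu> Z + t"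
      using top by (simp add: filterlim_at_top)
    then show "\<forall>\<^sub>F s in at_top. g s \<ge> Z"
    proof eventually_elim
      case (elim s)
      then show ?case
        using mle[of Z "g s"] by (simp add: g_mu)
    qed
  qed
  have gbot: "filterlim g at_bot at_bot"
    unfolding filterlim_at_bot
  proof
    fix Z
    have "\<forall>\<^sub>F s in at_bot. \<mu> s \<le> \<mu> Z + t"
      using bot by (simp add: filterlim_at_bot)
    then show "\<forall>\<^sub>F s in at_bot. g s \<le> Z"
    proof eventually_elim
      case (elim s)
      then show ?case
        using mle[of "g s" Z] by (simp add: g_mu)
    qed
  qed
  have "filterlim g at_infinity (sup at_bot at_top)"
    using filterlim_mono[OF gtop at_top_le_at_infinity order_refl]
      filterlim_mono[OF gbot at_bot_le_at_infinity order_refl]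
    by (intro filterlim_sup)
  then have "filterlim g at_infinity at_infinity"
    by (simp only: at_infinity_eq_at_top_bot sup_commute)
  then have "((\<lambda>s. apply_c0 u (g s)) \<longlongrightarrow> 0) at_infinity"
    by (rule filterlim_compose[OF c0_lim])
  then have C0: "((\<lambda>s. C * norm (apply_c0 u (g s))) \<longlongrightarrow> 0) at_infinity"
    by (intro tendsto_mult_right_zero tendsto_norm_zero)
  have "((\<lambda>s. U s (g s) (apply_c0 u (g s))) \<longlongrightarrow> 0) at_infinity"
    by (rule Lim_null_comparison[OF always_eventually C0]) (simp add: nb)
  with cont show ?thesis
    unfolding evol_semigroup_def by (fold g_def) (simp add: apply_Abs_c0)
qed

end

(*
  Measuring time by \<mu>, T translates along U by one unit of \<mu>-time per unit of t.

  (a) => (b): the dichotomy splits C_0 into a part on which T_t contracts and a part on which it is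
  invertible with a contracting inverse S_t, so z - T_t is inverted by a Neumann series when |z| = 1.
  (b) => (c): J = \<integral>_0^t e^(-ibs) T_s ds satisfies (G - ib) J = e^(-ibt) T_t - 1 = J (G - ib) on D(G),
  so J (e^(-ibt) T_t - 1)^(-1) inverts G - ib.
  (d) => (a): if V is an orbit of U and \<Psi> a smooth scalar function, then G((\<Psi> o \<mu>) V) = -(\<Psi>' o \<mu>) V.
  Boundedness of the inverse of G turns this into a priori bounds for orbits that decay at +\<infinity> and for
  orbits that decay at -\<infinity>; letting \<Psi> grow linearly over a long interval shows that they decay by a
  factor 2 over a fixed length, hence exponentially. Surjectivity of G splits every vector at every
  time into the initial values of two such orbits.
  The formula is the mild form of G u = f, projected on the two subspaces.
*)
theory Submission
  imports Defs
begin

section \<open>Strongly continuous semigroups\<close>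

text \<open>For general semigroups the spectrum of the generator does not control that of
  \<open>T t\<close>, so only the easy half of spectral mapping is proved and the way from (d) back
  to (b) leads through the dichotomy. From (c) to (d) it suffices that 0 is imaginary. Two obstacles
  shape the step from (d) to (a). The growth rate is merely continuous and orbits of
  \<open>U\<close> need not be differentiable, so the generator is computed from difference
  quotients: along an orbit, \<open>T h\<close> only shifts the scalar cutoff in \<mu>-time. These
  quotients must converge in the sup norm, hence a second-order estimate for the cutoff that is
  uniform in the base point. Secondly, decay of the orbits is only qualitative at first, and the
  final constants must depend on the norm of the inverse, on K and on \<alpha>, but not on the
  orbit. The stable and unstable subspaces are not shown to be closed: the splitting of a vector
  carries a norm estimate that bounds the projection directly, and the trivial intersection makes it
  well defined and linear.\<close>

lemma bounded_clinearD:
  assumes "bounded_clinear f"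
  shows "bounded_linear f" "f (scaleC c x) = scaleC c (f x)"
  using assms by (auto simp: bounded_clinear_def)

section \<open>Complex scalars, resolvents and generators\<close>

lemma scaleC_one [simp]: "scaleC 1 x = (x::'a::complex_normed_vector)"
  using scaleR_scaleC[of 1 x] by simp

lemma scaleC_zero_left [simp]: "scaleC 0 x = (0::'a::complex_normed_vector)"
  using scaleR_scaleC[of 0 x] by simp

lemma scaleC_zero_right [simp]: "scaleC c 0 = (0::'a::complex_normed_vector)"
  by (rule linear_0[OF bounded_linear.linear[OF bounded_linear_scaleC]])

lemma scaleC_diff_right:
  "scaleC c (x - y) = scaleC c x - scaleC c (y::'a::complex_normed_vector)"
  by (rule linear_diff[OF bounded_linear.linear[OF bounded_linear_scaleC]])

lemma scaleC_diff_left: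
  "scaleC (c - d) x = scaleC c x - scaleC d (x::'a::complex_normed_vector)"
  by (metis add_diff_cancel_right' diff_add_cancel scaleC_add_left)

lemma scaleC_minus_left [simp]: "scaleC (- c) x = - scaleC c (x::'a::complex_normed_vector)"
  using scaleC_diff_left[of 0 c x] by simp

lemma scaleC_minus_right [simp]:
  "scaleC c (- x) = - scaleC c (x::'a::complex_normed_vector)"
  by (rule linear_neg[OF bounded_linear.linear[OF bounded_linear_scaleC]])

lemma bounded_clinear_scaleC: "bounded_clinear (scaleC c)"
  by (simp add: bounded_clinear_def bounded_linear_scaleC scaleC_scaleC mult.commute)

lemma bounded_clinear_compose:
  "bounded_clinear f \<Longrightarrow> bounded_clinear g \<Longrightarrow> bounded_clinear (\<lambda>x. f (g x))"
  by (auto simp: bounded_clinear_def intro: bounded_linear_compose)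

lemma tendsto_scaleC:
  fixes g :: "'b \<Rightarrow> 'a::complex_normed_vector"
  assumes "(c \<longlongrightarrow> c0) F" and "(g \<longlongrightarrow> x0) F"
  shows "((\<lambda>t. scaleC (c t) (g t)) \<longlongrightarrow> scaleC c0 x0) F"
proof -
  have "bounded_bilinear (scaleC :: complex \<Rightarrow> 'a \<Rightarrow> 'a)"
  proof
    show "\<exists>K. \<forall>a (b::'a). norm (scaleC a b) \<le> norm a * norm b * K"
      by (intro exI[of _ 1]) (simp add: norm_scaleC)
  qed (simp_all add: scaleC_add_left scaleC_add_right scaleR_scaleC scaleC_scaleC mult.commute
        scaleR_conv_of_real)
  then show ?thesis
    using assms by (rule bounded_bilinear.tendsto)
qed

lemma resolvent_setI:
  assumes "bounded_clinear R"
    and left: "\<And>x. x \<in> D \<Longrightarrow> R (scaleC z x - A x) = x"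
    and right: "\<And>y. R y \<in> D" "\<And>y. scaleC z (R y) - A (R y) = y"
  shows "z \<in> resolvent_set D A"
proof -
  have bij: "bij_betw (\<lambda>x. scaleC z x - A x) D UNIV"
    by (rule bij_betw_byWitness[where f' = R]) (use left right in auto)
  have "inv_into D (\<lambda>x. scaleC z x - A x) y = R y" for y
    using inv_into_f_f[OF bij_betw_imp_inj_on[OF bij] right(1)[of y]] right(2)[of y] by simp
  then have "inv_into D (\<lambda>x. scaleC z x - A x) = R"
    by blast
  then show ?thesis
    using assms(1) bij by (simp add: resolvent_set_def)
qed

lemma resolvent_setE:
  assumes "z \<in> resolvent_set D A"
  obtains R where "bounded_clinear R" "\<And>x. x \<in> D \<Longrightarrow> R (scaleC z x - A x) = x"
    "\<And>y. R y \<in> D" "\<And>y. scaleC z (R y) - A (R y) = y"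
proof
  let ?B = "\<lambda>x. scaleC z x - A x" and ?R = "inv_into D (\<lambda>x. scaleC z x - A x)"
  have bij: "bij_betw ?B D UNIV" and bcl: "bounded_clinear ?R"
    using assms by (auto simp: resolvent_set_def)
  show "bounded_clinear ?R"
    by (rule bcl)
  show "?R (?B x) = x" if "x \<in> D" for x
    using inv_into_f_f[OF bij_betw_imp_inj_on[OF bij] that] .
  show "?R y \<in> D" for y
    using bij by (metis UNIV_I bij_betw_imp_surj_on inv_into_into)
  show "scaleC z (?R y) - A (?R y) = y" for y
    using bij_betw_inv_into_right[OF bij, of y] by simp
qed

lemma gen_eqI:
  assumes "((\<lambda>t. (T t x - x) /\<^sub>R t) \<longlongrightarrow> y) (at_right 0)"
  shows "x \<in> gen_dom T" "gen T x = y"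
  using assms tendsto_Lim[OF _ assms] by (auto simp: gen_dom_def gen_def)

lemma gen_tendsto:
  assumes "x \<in> gen_dom T"
  shows "((\<lambda>t. (T t x - x) /\<^sub>R t) \<longlongrightarrow> gen T x) (at_right 0)"
proof -
  obtain y where y: "((\<lambda>t. (T t x - x) /\<^sub>R t) \<longlongrightarrow> y) (at_right 0)"
    using assms by (auto simp: gen_dom_def)
  with gen_eqI(2)[of T x, OF y] show ?thesis
    by simp
qed

text \<open>The exponential bound is an assumption because the evolution semigroup inherits it from
  the growth of \<open>U\<close>; this saves a uniform boundedness argument. The signs of
  \<open>M\<close> and \<open>w\<close> stay open, hence the absolute values in
  \<open>norm_J_le\<close>.\<close>

locale c0_semigroup =
  fixes T :: "real \<Rightarrow> 'b \<Rightarrow> 'b::complex_banach" and M w :: real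
  assumes bclin: "t \<ge> 0 \<Longrightarrow> bounded_clinear (T t)"
    and T_0: "T 0 x = x"
    and T_add: "s \<ge> 0 \<Longrightarrow> t \<ge> 0 \<Longrightarrow> T (s + t) x = T s (T t x)"
    and cont: "continuous_on {0..} (\<lambda>t. T t x)"
    and bound: "t \<ge> 0 \<Longrightarrow> norm (T t x) \<le> M * exp (w * t) * norm x"
begin

section \<open>The integrated semigroup and its generator\<close>

lemmas blin = bounded_clinearD(1)[OF bclin]

definition J :: "real \<Rightarrow> 'b \<Rightarrow> 'b"
  where "J t x = integral {0..t} (\<lambda>s. T s x)"

lemma cont_orbit: "A \<subseteq> {0..} \<Longrightarrow> continuous_on A (\<lambda>t. T t x)"
  using cont continuous_on_subset by blast

lemma orbit_integrable: "0 \<le> a \<Longrightarrow> (\<lambda>s. T s x) integrable_on {a..b}"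
  by (intro integrable_continuous_real cont_orbit) auto


lemma J_diff_quot:
  assumes "t \<ge> 0"
  shows "((\<lambda>h. (J (t + h) x - J t x) /\<^sub>R h) \<longlongrightarrow> T t x) (at_right 0)"
proof -
  have "((\<lambda>u. integral {0..u} (\<lambda>s. T s x)) has_vector_derivative T t x) (at t within {0..t+1})"
    using assms by (intro integral_has_vector_derivative cont_orbit) auto
  then have "((\<lambda>u. J u x) has_vector_derivative T t x) (at t within {t..t+1})"
    unfolding J_def by (rule has_vector_derivative_within_subset) (use assms in auto)
  then have "((\<lambda>u. (1 / norm (u - t)) *\<^sub>R (J u x - (J t x + (u - t) *\<^sub>R T t x))) \<longlongrightarrow> 0) (at_right t)"
    unfolding has_vector_derivative_def has_derivative_within
    by (simp add: at_within_Icc_at_right)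
  then have "((\<lambda>u. (J u x - J t x) /\<^sub>R (u - t) - T t x) \<longlongrightarrow> 0) (at_right t)"
  proof (rule Lim_transform_eventually)
    show "\<forall>\<^sub>F u in at_right t. (1 / norm (u - t)) *\<^sub>R (J u x - (J t x + (u - t) *\<^sub>R T t x))
        = (J u x - J t x) /\<^sub>R (u - t) - T t x"
      using eventually_at_right_less[of t]
    proof eventually_elim
      case (elim u)
      then have "(1 / norm (u - t)) *\<^sub>R (J u x - (J t x + (u - t) *\<^sub>R T t x))
        = inverse (u - t) *\<^sub>R ((J u x - J t x) - (u - t) *\<^sub>R T t x)"
        by (simp add: divide_inverse algebra_simps)
      also have "\<dots> = (J u x - J t x) /\<^sub>R (u - t) - T t x"
        using elim by (simp add: scaleR_diff_right)
      finally show ?case .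
    qed
  qed
  then have "((\<lambda>u. (J u x - J t x) /\<^sub>R (u - t)) \<longlongrightarrow> T t x) (at_right t)"
    by (simp only: LIM_zero_iff)
  then show ?thesis
    by (subst (asm) at_right_to_0) (simp add: filterlim_filtermap add.commute)
qed

lemma T_commute: "s \<ge> 0 \<Longrightarrow> t \<ge> 0 \<Longrightarrow> T s (T t x) = T t (T s x)"
  by (metis T_add add.commute)

lemma J_commute:
  assumes "t \<ge> 0" "h \<ge> 0"
  shows "J t (T h x) = T h (J t x)"
proof -
  have "J t (T h x) = integral {0..t} (T h \<circ> (\<lambda>s. T s x))"
    unfolding J_def by (rule Henstock_Kurzweil_Integration.integral_cong)
      (use assms T_commute in auto)
  also have "\<dots> = T h (J t x)"
    unfolding J_def by (rule integral_linear[OF orbit_integrable blin]) (use assms in auto)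
  finally show ?thesis .
qed

text \<open>Under the integral, \<open>T h\<close> slides the window of integration from
  \<open>[0, t]\<close> to \<open>[h, t + h]\<close>.\<close>

lemma J_shift:
  assumes "t \<ge> 0" "h \<ge> 0"
  shows "T h (J t x) = J (t + h) x - J h x"
proof -
  have "T h (J t x) = integral {0..t} (T h \<circ> (\<lambda>s. T s x))"
    unfolding J_def by (rule integral_linear[OF orbit_integrable blin, symmetric]) (use assms in auto)
  also have "\<dots> = integral {0..t} (\<lambda>s. T (s + h) x)"
    by (rule Henstock_Kurzweil_Integration.integral_cong) (use assms in \<open>auto simp: add.commute[of _ h] T_add\<close>)
  also have "\<dots> = integral {h..t+h} (\<lambda>s. T s x)"
    using integral_shift_real_ivl[of h h "t + h" "\<lambda>s. T s x"] by simp
  also have "\<dots> = J (t + h) x - J h x"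
    unfolding J_def
    using Henstock_Kurzweil_Integration.integral_combine[of 0 h "t + h" "\<lambda>s. T s x"] orbit_integrable[of 0 x "t + h"] assms
    by (simp add: algebra_simps)
  finally show ?thesis .
qed

text \<open>By \<open>J_shift\<close>, \<open>T h (J t x) - J t x\<close> is the increment of
  \<open>J\<close> at \<open>t\<close> minus its increment at 0, so the generator sees only the two
  ends of the window.\<close>

lemma J_in_gen_dom:
  assumes "t \<ge> 0"
  shows "J t x \<in> gen_dom T" "gen T (J t x) = T t x - x"
proof -
  have "((\<lambda>h. (J (t + h) x - J t x) /\<^sub>R h - (J (0 + h) x - J 0 x) /\<^sub>R h) \<longlongrightarrow> T t x - T 0 x) (at_right 0)"
    by (intro tendsto_diff J_diff_quot) (use assms in auto)
  then have "((\<lambda>h. (T h (J t x) - J t x) /\<^sub>R h) \<longlongrightarrow> T t x - x) (at_right 0)"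
  proof (rule Lim_transform_eventually[OF tendsto_eq_rhs])
    show "\<forall>\<^sub>F h in at_right 0. (J (t + h) x - J t x) /\<^sub>R h - (J (0 + h) x - J 0 x) /\<^sub>R h
      = (T h (J t x) - J t x) /\<^sub>R h"
      using eventually_at_right_less[of 0]
    proof eventually_elim
      case (elim h)
      then show ?case
        using assms by (simp add: J_shift J_def[of 0] algebra_simps)
    qed
  qed (simp add: T_0)
  from gen_eqI[of T "J t x", OF this] show "J t x \<in> gen_dom T" "gen T (J t x) = T t x - x"
    by auto
qed

lemma norm_J_le:
  assumes "t \<ge> 0"
  shows "norm (J t x) \<le> t * \<bar>M\<bar> * exp (\<bar>w\<bar> * t) * norm x"
proof -
  have "norm (T s x) \<le> \<bar>M\<bar> * exp (\<bar>w\<bar> * t) * norm x" if "s \<in> {0..t}" for s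
  proof -
    have "w * s \<le> \<bar>w\<bar> * t"
      using that by (intro mult_mono) auto
    then have "M * exp (w * s) \<le> \<bar>M\<bar> * exp (\<bar>w\<bar> * t)"
      by (intro mult_mono) auto
    with bound[of s x] that show ?thesis
      by (meson atLeastAtMost_iff mult_right_mono norm_ge_zero order_trans)
  qed
  then have "norm (J t x) \<le> \<bar>M\<bar> * exp (\<bar>w\<bar> * t) * norm x * (t - 0)"
    unfolding J_def using assms by (intro integral_bound cont_orbit) auto
  then show ?thesis
    by (simp add: mult_ac)
qed

lemma J_bounded_clinear:
  assumes "t \<ge> 0"
  shows "bounded_clinear (J t)"
  unfolding bounded_clinear_def
proof (intro conjI allI)
  have lin: "integral {0..t} (f \<circ> (\<lambda>s. T s x)) = f (J t x)"
    if "bounded_linear f" for f :: "'b \<Rightarrow> 'b" and x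
    unfolding J_def using that orbit_integrable[of 0 x t] by (simp add: integral_linear)
  show scale: "J t (scaleC c x) = scaleC c (J t x)" for c x
    unfolding lin[OF bounded_linear_scaleC, symmetric]
    unfolding J_def by (rule Henstock_Kurzweil_Integration.integral_cong) (simp add: bounded_clinearD(2)[OF bclin])
  show "bounded_linear (J t)"
  proof (rule bounded_linear_intro)
    show "J t (x + y) = J t x + J t y" for x y
    proof -
      have "J t (x + y) = integral {0..t} (\<lambda>s. T s x + T s y)"
        unfolding J_def by (rule Henstock_Kurzweil_Integration.integral_cong)
          (simp add: linear_add[OF bounded_linear.linear[OF blin]])
      then show ?thesis
        unfolding J_def by (simp add: orbit_integrable Henstock_Kurzweil_Integration.integral_add)
    qed
    show "J t (r *\<^sub>R x) = r *\<^sub>R J t x" for r x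
      by (simp add: scaleR_scaleC scale)
    show "norm (J t x) \<le> norm x * (t * \<bar>M\<bar> * exp (\<bar>w\<bar> * t))" for x
      using norm_J_le[OF assms] by (simp add: mult_ac)
  qed
qed

text \<open>Since \<open>J t\<close> commutes with \<open>T h\<close>, it maps the difference
  quotients of \<open>x\<close> to those of \<open>J t x\<close>; uniqueness of the limit then
  applies, and closedness of the generator does not enter.\<close>

lemma J_gen:
  assumes "t \<ge> 0" "x \<in> gen_dom T"
  shows "J t (gen T x) = T t x - x"
proof -
  note bl = bounded_clinearD(1)[OF J_bounded_clinear[OF assms(1)]]
  have "((\<lambda>h. J t ((T h x - x) /\<^sub>R h)) \<longlongrightarrow> J t (gen T x)) (at_right 0)"
    by (rule bounded_linear.tendsto[OF bl gen_tendsto[OF assms(2)]])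
  then have "((\<lambda>h. (T h (J t x) - J t x) /\<^sub>R h) \<longlongrightarrow> J t (gen T x)) (at_right 0)"
  proof (rule Lim_transform_eventually)
    show "\<forall>\<^sub>F h in at_right 0. J t ((T h x - x) /\<^sub>R h) = (T h (J t x) - J t x) /\<^sub>R h"
      using eventually_at_right_less[of 0]
    proof eventually_elim
      case (elim h)
      then show ?case
        using assms J_commute by (simp add: linear_cmul[OF bounded_linear.linear[OF bl]] linear_diff[OF bounded_linear.linear[OF bl]])
    qed
  qed
  from gen_eqI(2)[of T "J t x", OF this] J_in_gen_dom(2)[OF assms(1), of x] show ?thesis
    by simp
qed

lemma zero_in_resolvent_gen:
  assumes t: "t \<ge> 0" and res: "1 \<in> resolvent_set UNIV (T t)"
  shows "0 \<in> resolvent_set (gen_dom T) (gen T)"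
proof -
  from res obtain R where R: "bounded_clinear R" "\<And>x. R (scaleC 1 x - T t x) = x"
      "\<And>y. scaleC 1 (R y) - T t (R y) = y"
    by (rule resolvent_setE) auto
  note blJ = bounded_clinearD(1)[OF J_bounded_clinear[OF t]]
  \<comment> \<open>\<open>J t\<close> commutes with \<open>T t\<close>, hence with the inverse of
    \<open>1 - T t\<close>. This turns the right inverse \<open>J t (R y)\<close> into a left
    inverse as well.\<close>
  have comm: "J t (R y) = R (J t y)" for y
  proof -
    have "J t y = scaleC 1 (J t (R y)) - T t (J t (R y))"
      using J_commute[OF t t] R(3)[of y] linear_diff[OF bounded_linear.linear[OF blJ], of "R y" "T t (R y)"] by simp
    then show ?thesis
      using R(2) by simp
  qed
  show ?thesis
  proof (rule resolvent_setI[of "\<lambda>y. J t (R y)"])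
    show "bounded_clinear (\<lambda>y. J t (R y))"
      by (rule bounded_clinear_compose[OF J_bounded_clinear[OF t] R(1)])
    show "J t (R y) \<in> gen_dom T" for y
      by (rule J_in_gen_dom(1)[OF t])
    show "scaleC 0 (J t (R y)) - gen T (J t (R y)) = y" for y
      using J_in_gen_dom(2)[OF t, of "R y"] R(3)[of y] by simp
    show "J t (R (scaleC 0 x - gen T x)) = x" if "x \<in> gen_dom T" for x
    proof -
      have "J t (R (- gen T x)) = R (- J t (gen T x))"
        using comm[of "- gen T x"] by (simp add: linear_neg[OF bounded_linear.linear[OF blJ]])
      also have "\<dots> = x"
        using J_gen[OF t that] R(2)[of x] by simp
      finally show ?thesis by simp
    qed
  qed
qed

end

section \<open>Rotation of a semigroup along the imaginary axis\<close>

lemma c0_semigroup_rescale: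
  assumes "c0_semigroup T M w"
  shows "c0_semigroup (\<lambda>t x. scaleC (cis (- b * t)) (T t x)) M w"
proof -
  interpret c0_semigroup T M w by fact
  show ?thesis
  proof
    show "bounded_clinear (\<lambda>x. scaleC (cis (- b * t)) (T t x))" if "t \<ge> 0" for t
      by (rule bounded_clinear_compose[OF bounded_clinear_scaleC bclin[OF that]])
    show "scaleC (cis (- b * (s + t))) (T (s + t) x)
        = scaleC (cis (- b * s)) (T s (scaleC (cis (- b * t)) (T t x)))"
      if "0 \<le> s" "0 \<le> t" for s t x
      using that by (simp add: T_add bounded_clinearD(2)[OF bclin] scaleC_scaleC cis_mult algebra_simps)
    show "continuous_on {0..} (\<lambda>t. scaleC (cis (- b * t)) (T t x))" for x
      using cont[of x] unfolding continuous_on_def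
      by (auto intro!: tendsto_scaleC tendsto_intros simp: cis_conv_exp)
  qed (use bound in \<open>auto simp: T_0 norm_scaleC\<close>)
qed

lemma cis_diff_quot: "((\<lambda>t. (cis (- b * t) - 1) /\<^sub>R t) \<longlongrightarrow> - (\<i> * of_real b)) (at_right 0)"
proof -
  have "((\<lambda>z. exp (- (\<i> * of_real b) * z)) has_field_derivative - (\<i> * of_real b)) (at 0)"
    by (auto intro!: derivative_eq_intros)
  then have "((\<lambda>z. (exp (- (\<i> * of_real b) * z) - 1) / z) \<longlongrightarrow> - (\<i> * of_real b)) (at 0)"
    by (simp add: DERIV_def)
  moreover have "filterlim complex_of_real (at 0) (at_right 0)"
    unfolding filterlim_at
    by (auto intro!: tendsto_eq_intros simp: eventually_at_right_less eventually_at_filter)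
  ultimately have "((\<lambda>t. (exp (- (\<i> * of_real b) * of_real t) - 1) / of_real t) \<longlongrightarrow> - (\<i> * of_real b)) (at_right 0)"
    by (rule filterlim_compose)
  then show ?thesis
    by (simp add: cis_conv_exp scaleR_conv_of_real divide_inverse mult_ac)
qed

context c0_semigroup
begin

text \<open>The product rule for a rotation times an orbit; the rotation has derivative
  \<open>- \<i> * of_real b\<close> at 0.\<close>

lemma gen_rescale:
  fixes b :: real
  defines "S \<equiv> \<lambda>t x. scaleC (cis (- b * t)) (T t x)"
  assumes x: "x \<in> gen_dom T"
  shows "x \<in> gen_dom S" "gen S x = gen T x - scaleC (\<i> * of_real b) x"
proof -
  have "((\<lambda>t. cis (- b * t)) \<longlongrightarrow> cis (- b * 0)) (at_right 0)"
    unfolding cis_conv_exp by (intro tendsto_intros)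
  then have "((\<lambda>t. scaleC (cis (- b * t)) ((T t x - x) /\<^sub>R t) + scaleC ((cis (- b * t) - 1) /\<^sub>R t) x)
     \<longlongrightarrow> scaleC (cis (- b * 0)) (gen T x) + scaleC (- (\<i> * of_real b)) x) (at_right 0)"
    by (intro tendsto_add tendsto_scaleC gen_tendsto[OF x] cis_diff_quot tendsto_const)
  moreover have "scaleC (cis (- b * t)) ((T t x - x) /\<^sub>R t) + scaleC ((cis (- b * t) - 1) /\<^sub>R t) x
      = (S t x - x) /\<^sub>R t" for t
    unfolding S_def scaleR_scaleC
    by (simp add: scaleC_diff_right scaleC_scaleC scaleC_diff_left scaleR_conv_of_real algebra_simps)
  ultimately have "((\<lambda>t. (S t x - x) /\<^sub>R t) \<longlongrightarrow> gen T x - scaleC (\<i> * of_real b) x) (at_right 0)"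
    by simp
  from gen_eqI[of S x, OF this] show "x \<in> gen_dom S" "gen S x = gen T x - scaleC (\<i> * of_real b) x"
    by auto
qed

lemma gen_dom_rescale:
  fixes b :: real
  defines "S \<equiv> \<lambda>t x. scaleC (cis (- b * t)) (T t x)"
  shows "gen_dom S = gen_dom T"
proof
  interpret S: c0_semigroup S M w
    unfolding S_def by (rule c0_semigroup_rescale) unfold_locales
  \<comment> \<open>Rotating by \<open>- b\<close> recovers \<open>T\<close>, so the inclusion from
    \<open>gen_rescale\<close> can be used in both directions.\<close>
  have "T = (\<lambda>t x. scaleC (cis (- (- b) * t)) (S t x))"
    by (simp add: S_def scaleC_scaleC cis_mult)
  then show "gen_dom S \<subseteq> gen_dom T"
    using S.gen_rescale(1)[of _ "- b"] by auto
  show "gen_dom T \<subseteq> gen_dom S"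
    unfolding S_def using gen_rescale(1) by auto
qed

text \<open>The half of the spectral mapping theorem that holds for every semigroup; rotating the
  semigroup reduces it to the point \<open>0\<close>.\<close>

lemma imaginary_in_resolvent_gen:
  assumes t: "t \<ge> 0" and res: "cis (b * t) \<in> resolvent_set UNIV (T t)"
  shows "\<i> * of_real b \<in> resolvent_set (gen_dom T) (gen T)"
proof -
  define S where "S = (\<lambda>t x. scaleC (cis (- b * t)) (T t x))"
  interpret S: c0_semigroup S M w
    unfolding S_def by (rule c0_semigroup_rescale) unfold_locales
  from res obtain R where R: "bounded_clinear R" "\<And>x. R (scaleC (cis (b * t)) x - T t x) = x"
      "\<And>y. scaleC (cis (b * t)) (R y) - T t (R y) = y"
    by (rule resolvent_setE) auto
  have S_eq: "scaleC 1 x - S t x = scaleC (cis (- b * t)) (scaleC (cis (b * t)) x - T t x)" for x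
    by (simp add: S_def scaleC_diff_right scaleC_scaleC cis_mult)
  have "1 \<in> resolvent_set UNIV (S t)"
  proof (rule resolvent_setI[of "\<lambda>y. R (scaleC (cis (b * t)) y)"])
    show "bounded_clinear (\<lambda>y. R (scaleC (cis (b * t)) y))"
      by (rule bounded_clinear_compose[OF R(1) bounded_clinear_scaleC])
    show "R (scaleC (cis (b * t)) (scaleC 1 x - S t x)) = x" for x
      unfolding S_eq scaleC_scaleC by (simp add: cis_mult R(2))
    show "scaleC 1 (R (scaleC (cis (b * t)) y)) - S t (R (scaleC (cis (b * t)) y)) = y" for y
      unfolding S_eq R(3) scaleC_scaleC by (simp add: cis_mult)
  qed auto
  then have "0 \<in> resolvent_set (gen_dom S) (gen S)"
    by (rule S.zero_in_resolvent_gen[OF t])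
  then obtain R where R: "bounded_clinear R" "\<And>x. x \<in> gen_dom S \<Longrightarrow> R (scaleC 0 x - gen S x) = x"
      "\<And>y. R y \<in> gen_dom S" "\<And>y. scaleC 0 (R y) - gen S (R y) = y"
    by (rule resolvent_setE) auto
  have dom: "gen_dom S = gen_dom T"
    unfolding S_def by (rule gen_dom_rescale)
  have gen: "scaleC (\<i> * of_real b) x - gen T x = scaleC 0 x - gen S x" if "x \<in> gen_dom T" for x
    unfolding S_def using gen_rescale(2)[OF that, of b] by simp
  show ?thesis
    by (rule resolvent_setI[OF R(1)]) (use R dom gen in auto)
qed

end

section \<open>The generalized evolution semigroup\<close>

locale evolution =
  fixes \<mu> :: "real \<Rightarrow> real"
    and U :: "real \<Rightarrow> real \<Rightarrow> 'a \<Rightarrow> 'a::complex_banach"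
    and \<alpha> K :: real
  assumes mu: "\<mu> \<in> growth_rates"
    and ev: "evolution_family U"
    and alpha_pos: "\<alpha> > 0" and K_ge_1: "K \<ge> 1"
    and growth: "\<And>s \<tau>. \<tau> \<le> s \<Longrightarrow> onorm (U s \<tau>) \<le> K * exp (\<alpha> * (\<mu> s - \<mu> \<tau>))"
begin

text \<open>Translation by \<open>- t\<close> conjugated with \<mu>: an action of the reals on the
  time axis. Negative \<open>t\<close> moves forward, which serves the inverse of the semigroup on
  the unstable part.\<close>

definition sh :: "real \<Rightarrow> real \<Rightarrow> real"
  where "sh s t = inv \<mu> (\<mu> s - t)"

lemma mu_cont: "continuous_on A \<mu>"
  using mu continuous_on_subset by (auto simp: growth_rates_def)

lemma mu_inv [simp]: "\<mu> (inv \<mu> y) = y"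
  by (rule surj_f_inv_f[OF growth_rate_surj[OF mu]])

lemma mu_le [simp]: "\<mu> x \<le> \<mu> y \<longleftrightarrow> x \<le> y"
  using mu by (simp add: growth_rates_def strict_mono_less_eq)

lemma mu_less [simp]: "\<mu> x < \<mu> y \<longleftrightarrow> x < y"
  using mu by (simp add: growth_rates_def strict_mono_less)

lemma mu_eq [simp]: "\<mu> x = \<mu> y \<longleftrightarrow> x = y"
  using mu by (simp add: growth_rates_def strict_mono_eq)

lemma inv_mu [simp]: "inv \<mu> (\<mu> x) = x"
  using mu_eq mu_inv by blast

lemma inv_mu_mono: "x \<le> y \<Longrightarrow> inv \<mu> x \<le> inv \<mu> y"
  using mu_le[of "inv \<mu> x" "inv \<mu> y"] by simp

lemma inv_mu_cont: "continuous_on A (inv \<mu>)"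
proof -
  have "surj (inv \<mu>)"
    by (rule surjI[of _ \<mu>]) simp
  then have "continuous_on UNIV (inv \<mu>)"
    by (intro continuous_onI_mono inv_mu_mono) simp_all
  then show ?thesis
    using continuous_on_subset by blast
qed

lemma mu_at_top: "filterlim \<mu> at_top at_top" and mu_at_bot: "filterlim \<mu> at_bot at_bot"
  using mu by (auto simp: growth_rates_def)

lemma mu_sh [simp]: "\<mu> (sh s t) = \<mu> s - t"
  by (simp add: sh_def)

lemma sh_0 [simp]: "sh s 0 = s"
  by (simp add: sh_def)

lemma sh_sh [simp]: "sh (sh s a) b = sh s (a + b)"
  by (simp add: sh_def algebra_simps)

lemma sh_diff [simp]: "sh t (\<mu> t - \<mu> r) = r"
  by (simp add: sh_def)

lemma le_sh_iff: "r \<le> sh s t \<longleftrightarrow> \<mu> r + t \<le> \<mu> s"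
  using mu_le[of r "sh s t"] by auto

lemma sh_le_iff: "sh s t \<le> r \<longleftrightarrow> \<mu> s \<le> \<mu> r + t"
  using mu_le[of "sh s t" r] by auto

lemma sh_le: "t \<ge> 0 \<Longrightarrow> sh s t \<le> s"
  using mu_le[of "sh s t" s] by simp

lemma sh_ge: "t \<le> 0 \<Longrightarrow> s \<le> sh s t"
  using mu_le[of s "sh s t"] by simp

lemma sh_mono: "a \<le> b \<Longrightarrow> sh s b \<le> sh s a"
  using mu_le[of "sh s b" "sh s a"] by simp

lemma cont_sh [continuous_intros]:
  assumes "continuous_on A f" "continuous_on A g"
  shows "continuous_on A (\<lambda>x. sh (f x) (g x))"
  unfolding sh_def
  by (intro continuous_on_compose2[OF inv_mu_cont[of UNIV]]
      continuous_on_diff continuous_on_compose2[OF mu_cont[of UNIV]] assms) auto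

lemma sh_at_top: "filterlim (\<lambda>s. sh s t) at_top at_top"
  unfolding filterlim_at_top
proof
  fix Z
  have "\<forall>\<^sub>F s in at_top. \<mu> s \<ge> \<mu> Z + t"
    using mu_at_top by (simp add: filterlim_at_top)
  then show "\<forall>\<^sub>F s in at_top. sh s t \<ge> Z"
    by eventually_elim (simp add: le_sh_iff)
qed

lemma sh_at_bot: "filterlim (\<lambda>s. sh s t) at_bot at_bot"
  unfolding filterlim_at_bot
proof
  fix Z
  have "\<forall>\<^sub>F s in at_bot. \<mu> s \<le> \<mu> Z + t"
    using mu_at_bot by (simp add: filterlim_at_bot)
  then show "\<forall>\<^sub>F s in at_bot. sh s t \<le> Z"
    by eventually_elim (simp add: sh_le_iff)
qed

lemma sh_at_infinity: "filterlim (\<lambda>s. sh s t) at_infinity at_infinity"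
proof -
  have "filterlim (\<lambda>s. sh s t) at_infinity (sup at_bot at_top)"
    using filterlim_mono[OF sh_at_top at_top_le_at_infinity order_refl]
      filterlim_mono[OF sh_at_bot at_bot_le_at_infinity order_refl]
    by (intro filterlim_sup)
  then show ?thesis
    by (simp only: at_infinity_eq_at_top_bot sup_commute)
qed

section \<open>Joint continuity and the semigroup on C_0\<close>

lemma U_bclin: "r \<le> t \<Longrightarrow> bounded_clinear (U t r)"
  using ev by (simp add: evolution_family_def)

lemmas U_blin = bounded_clinearD(1)[OF U_bclin]
lemmas U_linear = bounded_linear.linear[OF U_blin]

lemma U_id [simp]: "U t t x = x"
  using ev by (simp add: evolution_family_def)

lemma U_comp: "r \<le> s \<Longrightarrow> s \<le> t \<Longrightarrow> U t s (U s r x) = U t r x"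
  using ev by (auto simp: evolution_family_def fun_eq_iff)

lemma U_bound: "r \<le> t \<Longrightarrow> norm (U t r x) \<le> K * exp (\<alpha> * (\<mu> t - \<mu> r)) * norm x"
  by (rule order_trans[OF onorm[OF U_blin] mult_right_mono[OF growth]]) auto

text \<open>An evolution family is continuous in its times for a fixed vector. The growth bound is
  locally uniform, so the contribution of \<open>h x - h z\<close> tends to 0 and the vector may
  vary too.\<close>

lemma U_cont:
  fixes f g :: "'c::topological_space \<Rightarrow> real"
  assumes f: "continuous_on S f" and g: "continuous_on S g" and h: "continuous_on S h"
    and le: "\<And>x. x \<in> S \<Longrightarrow> g x \<le> f x"
  shows "continuous_on S (\<lambda>x. U (f x) (g x) (h x))"
  unfolding continuous_on_def
proof
  fix z assume z: "z \<in> S"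
  have "continuous_on {(t, s). s \<le> t} (\<lambda>(t, s). U t s (h z))"
    using ev by (simp add: evolution_family_def)
  then have "continuous_on S (\<lambda>x. (\<lambda>(t, s). U t s (h z)) (f x, g x))"
    by (rule continuous_on_compose2) (use le in \<open>auto intro!: continuous_on_Pair f g\<close>)
  then have 1: "((\<lambda>x. U (f x) (g x) (h z)) \<longlongrightarrow> U (f z) (g z) (h z)) (at z within S)"
    using z by (simp add: continuous_on_def)
  have "continuous_on S (\<lambda>x. K * exp (\<alpha> * (\<mu> (f x) - \<mu> (g x))) * norm (h x - h z))"
    by (intro continuous_intros h continuous_on_compose2[OF mu_cont[of UNIV] f]
        continuous_on_compose2[OF mu_cont[of UNIV] g]) auto
  then have lim: "((\<lambda>x. K * exp (\<alpha> * (\<mu> (f x) - \<mu> (g x))) * norm (h x - h z)) \<longlongrightarrow> 0) (at z within S)"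
    using z by (force simp: continuous_on_def)
  have in_S: "\<forall>\<^sub>F x in at z within S. x \<in> S"
    by (simp add: eventually_at_filter)
  have 2: "((\<lambda>x. U (f x) (g x) (h x - h z)) \<longlongrightarrow> 0) (at z within S)"
    by (rule Lim_null_comparison[OF eventually_mono[OF in_S] lim]) (simp add: U_bound le)
  have "((\<lambda>x. U (f x) (g x) (h x - h z) + U (f x) (g x) (h z)) \<longlongrightarrow> 0 + U (f z) (g z) (h z)) (at z within S)"
    by (rule tendsto_add[OF 2 1])
  then show "((\<lambda>x. U (f x) (g x) (h x)) \<longlongrightarrow> U (f z) (g z) (h z)) (at z within S)"
  proof (rule Lim_transform_eventually[OF tendsto_eq_rhs])
    show "\<forall>\<^sub>F x in at z within S. U (f x) (g x) (h x - h z) + U (f x) (g x) (h z) = U (f x) (g x) (h x)"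
      using in_S by eventually_elim (simp add: le linear_diff[OF U_linear])
  qed simp
qed

lemma c0_cont_compose [continuous_intros]:
  "continuous_on A g \<Longrightarrow> continuous_on A (\<lambda>x. apply_c0 u (g x))"
  by (rule continuous_on_compose2[OF c0_cont[of UNIV]]) auto

abbreviation T :: "real \<Rightarrow> 'a c0fun \<Rightarrow> 'a c0fun"
  where "T \<equiv> evol_semigroup \<mu> U"

lemma T_apply: "t \<ge> 0 \<Longrightarrow> apply_c0 (T t u) s = U s (sh s t) (apply_c0 u (sh s t))"
  unfolding sh_def by (rule apply_evol_semigroup[OF mu ev growth])

lemma T_norm: assumes "t \<ge> 0" shows "norm (T t u) \<le> K * exp (\<alpha> * t) * norm u"
proof (rule c0_norm_le)
  fix s
  have "norm (apply_c0 (T t u) s) \<le> K * exp (\<alpha> * t) * norm (apply_c0 u (sh s t))"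
    using U_bound[OF sh_le[OF assms, of s], of "apply_c0 u (sh s t)"] assms by (simp add: T_apply)
  also have "\<dots> \<le> K * exp (\<alpha> * t) * norm u"
    using K_ge_1 by (intro mult_left_mono c0_norm_ge) auto
  finally show "norm (apply_c0 (T t u) s) \<le> K * exp (\<alpha> * t) * norm u" .
qed

lemma T_bounded_clinear:
  assumes "t \<ge> 0"
  shows "bounded_clinear (T t)"
  unfolding bounded_clinear_def
proof (intro conjI allI bounded_linear_intro)
  show "T t (u + v) = T t u + T t v" for u v
    by (rule c0_eqI) (simp add: T_apply assms linear_add[OF U_linear[OF sh_le]])
  show "T t (r *\<^sub>R u) = r *\<^sub>R T t u" for r u
    by (rule c0_eqI) (simp add: T_apply assms linear_cmul[OF U_linear[OF sh_le]])
  show "T t (scaleC c u) = scaleC c (T t u)" for c u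
    by (rule c0_eqI) (simp add: T_apply assms bounded_clinearD(2)[OF U_bclin[OF sh_le]])
  show "norm (T t u) \<le> norm u * (K * exp (\<alpha> * t))" for u
    using T_norm[OF assms, of u] by (simp add: mult_ac)
qed

text \<open>Continuity at each \<open>s\<close> has to become uniform in \<open>s\<close>. Far out,
  all values are small for every \<open>t\<close> in \<open>[0, b]\<close> at once because
  \<open>u\<close> vanishes at infinity; on the remaining compact rectangle joint continuity is
  uniform.\<close>

lemma T_orbit_cont: "continuous_on {0..b} (\<lambda>t. T t u)"
proof (cases "b \<ge> 0")
  case True
  define F where "F = (\<lambda>(s, t). U s (sh s t) (apply_c0 u (sh s t)))"
  define C where "C = K * exp (\<alpha> * b)"
  have C: "C > 0"
    using K_ge_1 by (simp add: C_def)
  have F_bound: "norm (F (s, t)) \<le> C * norm (apply_c0 u (sh s t))" if "t \<in> {0..b}" for s t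
  proof -
    have "norm (F (s, t)) \<le> K * exp (\<alpha> * t) * norm (apply_c0 u (sh s t))"
      using U_bound[OF sh_le, of t s "apply_c0 u (sh s t)"] that by (simp add: F_def)
    also have "\<dots> \<le> C * norm (apply_c0 u (sh s t))"
      unfolding C_def using that K_ge_1 alpha_pos by (intro mult_right_mono mult_left_mono) auto
    finally show ?thesis .
  qed
  show ?thesis
    unfolding continuous_on_iff
  proof safe
    fix t0 e :: real
    assume t0: "t0 \<in> {0..b}" and e: "e > 0"
    have "\<forall>\<^sub>F s in at_infinity. dist (apply_c0 u s) 0 < e / (4 * C)"
      using e C by (intro tendstoD[OF c0_lim]) simp
    then obtain R where R: "\<And>s. norm s \<ge> R \<Longrightarrow> norm (apply_c0 u s) < e / (4 * C)"
      unfolding eventually_at_infinity by auto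
    \<comment> \<open>Beyond \<open>R'\<close> a backward shift by at most \<open>b\<close> still
      ends to the right of the absolute value of \<open>R\<close>. The left end needs no such
      correction, since the shift moves further left.\<close>
    define R' where "R' = inv \<mu> (\<mu> \<bar>R\<bar> + b)"
    have far: "norm (F (s, t)) < e / 4" if t: "t \<in> {0..b}" and s: "s \<notin> {- \<bar>R\<bar>..R'}" for s t
    proof -
      have "norm (sh s t) \<ge> R"
      proof (cases "s < - \<bar>R\<bar>")
        case True
        then show ?thesis
          using sh_le[of t s] t by auto
      next
        case False
        then have "s > R'"
          using s by auto
        then have "\<mu> s > \<mu> \<bar>R\<bar> + b"
          using mu_less[of R' s] by (simp add: R'_def)
        then have "\<mu> \<bar>R\<bar> \<le> \<mu> (sh s t)"
          using t by simp
        then show ?thesis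
          by (simp only: mu_le) auto
      qed
      then have "C * norm (apply_c0 u (sh s t)) < C * (e / (4 * C))"
        using C R by (intro mult_strict_left_mono) auto
      then show ?thesis
        using F_bound[OF t, of s] C by simp
    qed
    have "continuous_on ({- \<bar>R\<bar>..R'} \<times> {0..b}) F"
      unfolding F_def case_prod_unfold
      by (intro U_cont continuous_intros) (auto simp: sh_le)
    then have "uniformly_continuous_on ({- \<bar>R\<bar>..R'} \<times> {0..b}) F"
      by (rule compact_uniformly_continuous) (intro compact_Times compact_Icc)
    then obtain d where d: "d > 0" and near: "\<And>p q. p \<in> {- \<bar>R\<bar>..R'} \<times> {0..b} \<Longrightarrow> q \<in> {- \<bar>R\<bar>..R'} \<times> {0..b} \<Longrightarrow>
        dist q p < d \<Longrightarrow> dist (F q) (F p) < e / 2"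
      unfolding uniformly_continuous_on_def using half_gt_zero[OF e] by (elim allE[of _ "e/2"]) blast
    have "dist (T t u) (T t0 u) < e" if t: "t \<in> {0..b}" "dist t t0 < d" for t
    proof -
      have "norm (apply_c0 (T t u - T t0 u) s) \<le> e / 2" for s
      proof -
        have eq: "apply_c0 (T t u - T t0 u) s = F (s, t) - F (s, t0)"
          using t t0 by (simp add: T_apply F_def)
        show ?thesis
        proof (cases "s \<in> {- \<bar>R\<bar>..R'}")
          case True
          then have "dist (F (s, t)) (F (s, t0)) < e / 2"
            using t t0 by (intro near) (auto simp: dist_Pair_Pair)
          then show ?thesis
            unfolding eq dist_norm by simp
        next
          case False
          then show ?thesis
            unfolding eq using far[OF t(1) False] far[OF t0 False]
              norm_triangle_ineq4[of "F (s, t)" "F (s, t0)"] by simp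
        qed
      qed
      then have "norm (T t u - T t0 u) \<le> e / 2"
        by (rule c0_norm_le)
      then show ?thesis
        using e by (simp add: dist_norm)
    qed
    with d show "\<exists>d>0. \<forall>t\<in>{0..b}. dist t t0 < d \<longrightarrow> dist (T t u) (T t0 u) < e"
      by blast
  qed
qed simp

sublocale c0_semigroup T K \<alpha>
proof
  show "T 0 u = u" for u
    by (rule c0_eqI) (simp add: T_apply)
  show "T (s + t) u = T s (T t u)" if "0 \<le> s" "0 \<le> t" for s t u
    by (rule c0_eqI) (use that in \<open>simp add: T_apply U_comp sh_le sh_mono\<close>)
  show "continuous_on {0..} (\<lambda>t. T t u)" for u
    unfolding continuous_on_eq_continuous_within
  proof
    fix t :: real assume "t \<in> {0..}"
    then have "continuous (at t within {0..t+1}) (\<lambda>t. T t u)"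
      using T_orbit_cont[of "t+1" u] by (simp add: continuous_on_eq_continuous_within)
    moreover have "at t within {0..} = at t within {0..t+1}"
      by (rule at_within_nhd[of _ "{..<t+1}"]) auto
    ultimately show "continuous (at t within {0..}) (\<lambda>t. T t u)"
      by (simp add: continuous_within)
  qed
qed (use T_bounded_clinear T_norm in auto)

text \<open>Evaluation at \<open>s\<close> is a bounded functional, so it passes through the
  integral in \<open>J_gen\<close>. This mild equation feeds both the splitting of the space and the
  Green formula.\<close>

lemma gen_mild:
  assumes u: "u \<in> gen_dom T" and t: "t \<ge> 0"
  shows "((\<lambda>\<tau>. U s (sh s \<tau>) (apply_c0 (gen T u) (sh s \<tau>))) has_integral
    U s (sh s t) (apply_c0 u (sh s t)) - apply_c0 u s) {0..t}"
proof -
  have bl: "bounded_linear (\<lambda>v :: 'a c0fun. apply_c0 v s)"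
    by (rule bounded_linear_intro[of _ 1]) (auto simp: c0_norm_ge)
  have "((\<lambda>\<tau>. T \<tau> (gen T u)) has_integral T t u - u) {0..t}"
    using J_gen[OF t u] orbit_integrable[of 0 "gen T u" t] by (simp add: J_def has_integral_iff)
  then have "((\<lambda>\<tau>. apply_c0 (T \<tau> (gen T u)) s) has_integral apply_c0 (T t u - u) s) {0..t}"
    using has_integral_linear[OF _ bl] by (force simp: o_def)
  then show ?thesis
    using t by (subst has_integral_cong[symmetric]) (auto simp: T_apply)
qed

end

section \<open>A dichotomy makes the semigroup hyperbolic\<close>

text \<open>The series is replaced by its fixed point equation: \<open>R y\<close> is the fixed
  point of the contraction \<open>\<lambda>x. H x + y\<close>, and uniqueness of fixed points makes
  \<open>R\<close> linear.\<close>

lemma neumann_inverse: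
  fixes H :: "'b \<Rightarrow> 'b::complex_banach"
  assumes H: "bounded_clinear H" and c: "c < 1" and le: "\<And>x. norm (H x) \<le> c * norm x"
  obtains R where "bounded_clinear R" "\<And>x. R (x - H x) = x" "\<And>y. R y - H (R y) = y"
proof -
  note lin = bounded_linear.linear[OF bounded_clinearD(1)[OF H]]
  \<comment> \<open>The constant \<open>c\<close> may be negative, whereas the fixed point theorem
    wants a nonnegative one.\<close>
  have c': "norm (H x) \<le> max c 0 * norm x" for x
    by (rule order_trans[OF le mult_right_mono]) auto
  have "\<exists>!x. H x + y = x" for y
  proof (rule banach_fix_type[of "max c 0"])
    show "\<forall>u v. dist (H u + y) (H v + y) \<le> max c 0 * dist u v"
      using c' by (simp add: dist_norm flip: linear_diff[OF lin])
  qed (use c in auto)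
  then have ex1: "\<exists>!x. x - H x = y" for y
    by (metis add.commute diff_add_cancel add_diff_cancel_left')
  define R where "R y = (THE x. x - H x = y)" for y
  have R: "R y - H (R y) = y" for y
    unfolding R_def by (rule theI'[OF ex1])
  have R_eq: "R y = x" if "x - H x = y" for x y
    using ex1[of y] R[of y] that by blast
  have "bounded_clinear R"
    unfolding bounded_clinear_def
  proof (intro conjI allI bounded_linear_intro)
    show "R (x + y) = R x + R y" for x y
      by (rule R_eq) (metis R add_diff_add linear_add[OF lin])
    show scale: "R (scaleC a x) = scaleC a (R x)" for a x
      by (rule R_eq) (metis R H bounded_clinearD(2) scaleC_diff_right)
    show "R (r *\<^sub>R x) = r *\<^sub>R R x" for r x
      by (simp add: scaleR_scaleC scale)
    show "norm (R x) \<le> norm x * (1 / (1 - max c 0))" for x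
    proof -
      have "norm (R x) \<le> norm x + max c 0 * norm (R x)"
        using norm_triangle_sub[of "R x" "H (R x)"] c'[of "R x"] R[of x] by simp
      then have "norm (R x) * (1 - max c 0) \<le> norm x"
        by (simp add: algebra_simps)
      then show ?thesis
        using c by (simp add: pos_le_divide_eq)
    qed
  qed
  then show thesis
    using that R R_eq by blast
qed

text \<open>Here \<open>Q = TS\<close> is a projection, \<open>S\<close> inverts \<open>T\<close> on its range, and \<open>T\<close> is small on its
  kernel; both parts of \<open>z u - T u = f\<close> are solved at once by a Neumann series.\<close>

lemma circle_in_resolvent:
  fixes T S :: "'b \<Rightarrow> 'b::complex_banach"
  assumes T: "bounded_clinear T" and S: "bounded_clinear S"
    and comm: "\<And>x. S (T x) = T (S x)" and STS: "\<And>x. S (T (S x)) = S x"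
    and q: "q < 1 / 2" and S_le: "\<And>x. norm (S x) \<le> q * norm x"
    and T_le: "\<And>x. norm (T (x - T (S x))) \<le> q * norm x"
    and z: "cmod z = 1"
  shows "z \<in> resolvent_set UNIV T"
proof -
  note blT = bounded_clinearD(1)[OF T] and blS = bounded_clinearD(1)[OF S]
  note lT = bounded_linear.linear[OF blT] and lS = bounded_linear.linear[OF blS]
  note ops = linear_add[OF lT] linear_diff[OF lT] linear_add[OF lS] linear_diff[OF lS]
    bounded_clinearD(2)[OF T] bounded_clinearD(2)[OF S]
  have zz: "cnj z * z = 1" "z * cnj z = 1"
    using z complex_norm_square[of z] by (auto simp: mult.commute)
  define H where "H x = scaleC (cnj z) (T (x - T (S x))) + scaleC z (S x)" for x
  \<comment> \<open>An approximate inverse of \<open>z - T\<close>: division by \<open>z\<close>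
    (that is, \<open>cnj z\<close>) on the kernel of the projection, where \<open>T\<close> is
    small, and \<open>- S\<close> on its range. The error is exactly \<open>H\<close>:
    \<open>R0 (z - T) = 1 - H\<close>.\<close>
  define R0 where "R0 f = scaleC (cnj z) (f - T (S f)) - S f" for f
  note bl_comp = bounded_linear_compose[OF bounded_linear_scaleC] bounded_linear_compose[OF blT]
    bounded_linear_compose[OF blS] bounded_linear_add bounded_linear_sub bounded_linear_ident
    bounded_linear_scaleC blS
  have H: "bounded_clinear H"
    unfolding bounded_clinear_def H_def
    by (intro conjI allI bl_comp)
       (simp add: ops scaleC_add_right scaleC_diff_right scaleC_scaleC mult_ac)
  have R0: "bounded_clinear R0"
    unfolding bounded_clinear_def R0_def
    by (intro conjI allI bl_comp)
       (simp add: ops scaleC_add_right scaleC_diff_right scaleC_scaleC mult_ac)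
  have "norm (H x) \<le> (2 * q) * norm x" for x
  proof -
    have "norm (H x) \<le> norm (T (x - T (S x))) + norm (S x)"
      unfolding H_def using norm_triangle_ineq[of "scaleC (cnj z) (T (x - T (S x)))" "scaleC z (S x)"]
      by (simp add: norm_scaleC z)
    also have "\<dots> \<le> q * norm x + q * norm x"
      by (intro add_mono S_le T_le)
    finally show ?thesis by simp
  qed
  then obtain R where R: "bounded_clinear R" "\<And>x. R (x - H x) = x" "\<And>y. R y - H (R y) = y"
    using neumann_inverse[OF H, of "2 * q"] q by auto
  show ?thesis
  proof (rule resolvent_setI[of "\<lambda>f. R (R0 f)"])
    show "bounded_clinear (\<lambda>f. R (R0 f))"
      by (rule bounded_clinear_compose[OF R(1) R0])
    have "R0 (scaleC z x - T x) = x - H x" for x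
      unfolding R0_def H_def
      by (simp add: ops comm scaleC_add_right scaleC_diff_right scaleC_scaleC zz)
    then show "R (R0 (scaleC z x - T x)) = x" for x
      using R(2) by simp
    show "scaleC z (R (R0 f)) - T (R (R0 f)) = f" for f
    proof -
      define u where "u = R (R0 f)"
      have 1: "u - H u = R0 f"
        by (simp add: u_def R(3))
      have SH: "S (u - H u) = S u - scaleC z (S (S u))"
        by (simp add: H_def ops comm STS[unfolded comm] )
      have SR: "S (R0 f) = - S (S f)"
        by (simp add: R0_def ops comm STS[unfolded comm])
      \<comment> \<open>Applying \<open>T\<close> after \<open>S\<close> isolates the part in the
        range of the projection. The outcome says that \<open>S\<close> annihilates the defect
        \<open>z u - T u - f\<close>; the remaining part follows by substituting it into the
        equation multiplied by \<open>z\<close>.\<close>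
      have "T (S u) - scaleC z (S u) = - S f"
        using arg_cong[OF 1, of "\<lambda>x. T (S x)"] unfolding SH SR
        by (simp add: ops STS[unfolded comm] linear_neg[OF lT])
      then have 2: "T (S u) = scaleC z (S u) - S f"
        by (simp add: algebra_simps)
      have "scaleC z (u - H u) = scaleC z (R0 f)"
        using 1 by simp
      then have "scaleC z u - (T u - T (T (S u)) + scaleC (z * z) (S u)) = f - T (S f) - scaleC z (S f)"
        by (simp add: H_def R0_def ops scaleC_add_right scaleC_diff_right scaleC_scaleC zz)
      moreover have "T (T (S u)) = scaleC z (T (S u)) - T (S f)"
        using arg_cong[OF 2, of T] by (simp add: ops)
      moreover have "scaleC z (T (S u)) = scaleC (z * z) (S u) - scaleC z (S f)"
        unfolding 2 by (simp add: scaleC_diff_right scaleC_scaleC)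
      ultimately have "scaleC z u - T u = f"
        by (simp add: algebra_simps)
      then show ?thesis
        by (simp add: u_def)
    qed
  qed auto
qed

locale dichotomy = evolution +
  fixes P :: "real \<Rightarrow> 'a \<Rightarrow> 'a" and \<nu> N :: real
  assumes comp: "compatible_projections U P"
    and nu_pos: "\<nu> > 0" and N_ge_1: "N \<ge> 1"
    and stable_le: "\<And>s t. s \<le> t \<Longrightarrow> onorm (U t s \<circ> P s) \<le> N * exp (- \<nu> * (\<mu> t - \<mu> s))"
    and back_blin: "\<And>s t. s \<le> t \<Longrightarrow> bounded_linear (U_Q_back U P s t \<circ> compl_proj P t)"
    and back_le: "\<And>s t. s \<le> t \<Longrightarrow>
      onorm (U_Q_back U P s t \<circ> compl_proj P t) \<le> N * exp (- \<nu> * (\<mu> t - \<mu> s))"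
begin

section \<open>Backward propagators on the unstable subspaces\<close>

abbreviation Q :: "real \<Rightarrow> 'a \<Rightarrow> 'a" where "Q \<equiv> compl_proj P"

text \<open>Composing with \<open>Q t\<close> extends the partial inverse to a total operator; this
  composite is what the dichotomy bounds.\<close>

definition B :: "real \<Rightarrow> real \<Rightarrow> 'a \<Rightarrow> 'a"
  where "B s t x = U_Q_back U P s t (Q t x)"

lemma P_bclin: "bounded_clinear (P t)" and P_idem [simp]: "P t (P t x) = P t x"
  using comp by (auto simp: compatible_projections_def fun_eq_iff)

lemmas P_linear = bounded_linear.linear[OF bounded_clinearD(1)[OF P_bclin]]

lemma Q_bclin: "bounded_clinear (Q t)"
  using P_bclin[of t] unfolding bounded_clinear_def compl_proj_def
  by (auto intro: bounded_linear_sub bounded_linear_ident simp: scaleC_diff_right)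

lemma Q_idem [simp]: "Q t (Q t x) = Q t x"
  by (simp add: compl_proj_def linear_diff[OF P_linear])

lemma P_U: "s \<le> t \<Longrightarrow> P t (U t s x) = U t s (P s x)"
  using comp by (auto simp: compatible_projections_def fun_eq_iff)

lemma Q_U: "s \<le> t \<Longrightarrow> Q t (U t s x) = U t s (Q s x)"
  by (simp add: compl_proj_def P_U linear_diff[OF U_linear])

lemma U_bij: "s \<le> t \<Longrightarrow> bij_betw (U t s) (range (Q s)) (range (Q t))"
  using comp by (auto simp: compatible_projections_def)

lemma U_B: "s \<le> t \<Longrightarrow> U t s (B s t x) = Q t x"
  using bij_betw_inv_into_right[OF U_bij, of s t "Q t x"] by (simp add: B_def U_Q_back_def)

lemma B_U: "s \<le> t \<Longrightarrow> B s t (U t s x) = Q s x"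
  using bij_betw_inv_into_left[OF U_bij, of s t "Q s x"] by (simp add: B_def U_Q_back_def Q_U)

lemma B_Q [simp]: "B s t (Q t x) = B s t x"
  by (simp add: B_def)

lemma Q_B: assumes "s \<le> t" shows "Q s (B s t x) = B s t x"
proof -
  have "B s t x \<in> range (Q s)"
    unfolding B_def U_Q_back_def
    by (rule inv_into_into) (use bij_betw_imp_surj_on[OF U_bij[OF assms]] in auto)
  then show ?thesis by auto
qed

lemma B_blin: "s \<le> t \<Longrightarrow> bounded_linear (B s t)"
  using back_blin[of s t] by (simp add: B_def[abs_def] o_def)

text \<open>A dichotomy grants only real linearity here. Complex homogeneity follows because
  \<open>B s t\<close> undoes the complex linear \<open>U t s\<close> on the range of
  \<open>Q s\<close>.\<close>

lemma B_bclin: assumes "s \<le> t" shows "bounded_clinear (B s t)"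
proof -
  have "B s t (scaleC c x) = scaleC c (B s t x)" for c x
  proof -
    have "B s t (scaleC c x) = B s t (Q t (scaleC c x))" by simp
    also have "Q t (scaleC c x) = U t s (scaleC c (B s t x))"
      by (simp add: bounded_clinearD(2)[OF Q_bclin] bounded_clinearD(2)[OF U_bclin] U_B assms)
    also have "B s t \<dots> = scaleC c (B s t x)"
      by (simp add: B_U assms bounded_clinearD(2)[OF Q_bclin] Q_B)
    finally show ?thesis .
  qed
  then show ?thesis
    using B_blin[OF assms] by (simp add: bounded_clinear_def)
qed

lemma B_bound: "s \<le> t \<Longrightarrow> norm (B s t x) \<le> N * exp (- \<nu> * (\<mu> t - \<mu> s)) * norm x"
  using order_trans[OF onorm[OF back_blin] mult_right_mono[OF back_le]] by (auto simp: B_def)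

lemma U_P_bound:
  assumes "s \<le> t"
  shows "norm (U t s (P s x)) \<le> N * exp (- \<nu> * (\<mu> t - \<mu> s)) * norm x"
proof -
  have "bounded_linear (U t s \<circ> P s)"
    unfolding o_def by (rule bounded_linear_compose[OF U_blin[OF assms] bounded_clinearD(1)[OF P_bclin]])
  from order_trans[OF onorm[OF this] mult_right_mono[OF stable_le[OF assms]]] show ?thesis
    by auto
qed

text \<open>Allows the far end of the backward operator to be frozen at \<open>b\<close>, so that
  the dependence on \<open>s\<close> moves into \<open>U\<close>; \<open>U_B_forward\<close> does
  the same for the near end.\<close>

lemma B_U_forward:
  assumes "a \<le> s" "s \<le> b"
  shows "B a b (U b s x) = B a s x"
proof -
  have "B a s x = B a b (U b a (B a s x))"
    using assms by (simp add: B_U Q_B)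
  also have "U b a (B a s x) = Q b (U b s x)"
    using assms by (simp add: U_comp[of a s b, symmetric] U_B Q_U)
  finally show ?thesis by simp
qed

lemma U_B_forward:
  assumes "a \<le> s" "s \<le> t"
  shows "U s a (B a t x) = B s t x"
proof -
  have "U s a (B a t x) = Q s (U s a (B a t x))"
    using assms by (simp add: Q_U Q_B)
  also have "\<dots> = B s t (U t s (U s a (B a t x)))"
    using assms by (simp add: B_U)
  also have "\<dots> = B s t x"
    using assms by (simp add: U_comp U_B)
  finally show ?thesis .
qed

text \<open>Locally \<open>B s s'\<close> is a fixed bounded operator between two propagators. This gives the strong
  continuity of the projections, which the definition of a dichotomy does not demand.\<close>

lemma B_cont:
  assumes "t \<ge> 0"
  shows "continuous_on UNIV (\<lambda>s. B s (sh s (- t)) (apply_c0 u (sh s (- t))))"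
proof -
  have "isCont (\<lambda>s. B s (sh s (- t)) (apply_c0 u (sh s (- t)))) s0" for s0
  proof -
    define a where "a = s0 - 1"
    define b where "b = sh (s0 + 1) (- t)"
    have ab: "a \<le> b"
      unfolding a_def b_def using sh_ge[of "- t" "s0 + 1"] assms by linarith
    have mono: "sh s (- t) \<le> b" if "s < s0 + 1" for s
      unfolding b_def using that by (simp add: sh_le_iff less_imp_le)
    have "continuous_on {s0 - 1<..<s0 + 1} (\<lambda>s. U s a (B a b (U b (sh s (- t)) (apply_c0 u (sh s (- t))))))"
      by (intro U_cont continuous_intros bounded_linear.continuous_on[OF B_blin[OF ab]])
         (use mono in \<open>auto simp: a_def\<close>)
    moreover have "U s a (B a b (U b (sh s (- t)) (apply_c0 u (sh s (- t))))) =
        B s (sh s (- t)) (apply_c0 u (sh s (- t)))" if "s \<in> {s0 - 1<..<s0 + 1}" for s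
    proof -
      have "a \<le> s" "s \<le> sh s (- t)" "sh s (- t) \<le> b"
        using that sh_ge[of "- t" s] assms mono by (auto simp: a_def)
      then show ?thesis
        by (simp add: B_U_forward U_B_forward)
    qed
    ultimately have "continuous_on {s0 - 1<..<s0 + 1} (\<lambda>s. B s (sh s (- t)) (apply_c0 u (sh s (- t))))"
      by (rule continuous_on_eq)
    then show ?thesis
      by (simp add: continuous_on_eq_continuous_at)
  qed
  then show ?thesis
    by (simp add: continuous_at_imp_continuous_on)
qed

text \<open>The inverse of \<open>T t\<close> on the unstable part, extended by 0 to the stable
  part.\<close>

definition S :: "real \<Rightarrow> 'a c0fun \<Rightarrow> 'a c0fun"
  where "S t u = Abs_c0 (\<lambda>s. B s (sh s (- t)) (apply_c0 u (sh s (- t))))"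

lemma B_sh_bound:
  assumes "t \<ge> 0"
  shows "norm (B s (sh s (- t)) x) \<le> N * exp (- \<nu> * t) * norm x"
  using B_bound[OF sh_ge[of "- t" s], of x] assms by simp

lemma S_apply:
  assumes "t \<ge> 0"
  shows "apply_c0 (S t u) s = B s (sh s (- t)) (apply_c0 u (sh s (- t)))"
proof -
  have lim: "((\<lambda>s. N * exp (- \<nu> * t) * norm (apply_c0 u (sh s (- t)))) \<longlongrightarrow> 0) at_infinity"
    by (intro tendsto_mult_right_zero tendsto_norm_zero filterlim_compose[OF c0_lim sh_at_infinity])
  have "((\<lambda>s. B s (sh s (- t)) (apply_c0 u (sh s (- t)))) \<longlongrightarrow> 0) at_infinity"
    by (rule Lim_null_comparison[OF always_eventually lim]) (use B_sh_bound[OF assms] in blast)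
  then show ?thesis
    unfolding S_def by (simp add: apply_Abs_c0[OF B_cont[OF assms]])
qed

lemma S_norm: assumes "t \<ge> 0" shows "norm (S t u) \<le> N * exp (- \<nu> * t) * norm u"
proof (rule c0_norm_le)
  fix s
  have "norm (apply_c0 (S t u) s) \<le> N * exp (- \<nu> * t) * norm (apply_c0 u (sh s (- t)))"
    using B_sh_bound[OF assms] by (simp add: S_apply assms)
  also have "\<dots> \<le> N * exp (- \<nu> * t) * norm u"
    using N_ge_1 by (intro mult_left_mono c0_norm_ge) auto
  finally show "norm (apply_c0 (S t u) s) \<le> N * exp (- \<nu> * t) * norm u" .
qed

lemma S_bclin:
  assumes "t \<ge> 0"
  shows "bounded_clinear (S t)"
proof -
  have le: "s \<le> sh s (- t)" for s
    using assms by (simp add: sh_ge)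
  note lin = bounded_linear.linear[OF B_blin[OF le]]
  show ?thesis
    unfolding bounded_clinear_def
  proof (intro conjI allI bounded_linear_intro)
    show "S t (u + v) = S t u + S t v" for u v
      by (rule c0_eqI) (simp add: S_apply assms linear_add[OF lin])
    show "S t (r *\<^sub>R u) = r *\<^sub>R S t u" for r u
      by (rule c0_eqI) (simp add: S_apply assms linear_cmul[OF lin])
    show "S t (scaleC c u) = scaleC c (S t u)" for c u
      by (rule c0_eqI) (simp add: S_apply assms bounded_clinearD(2)[OF B_bclin[OF le]])
    show "norm (S t u) \<le> norm u * (N * exp (- \<nu> * t))" for u
      using S_norm[OF assms, of u] by (simp add: mult_ac)
  qed
qed

lemma hyperbolic_T: "hyperbolic T"
proof -
  \<comment> \<open>Chosen so that both dichotomy estimates take the value 1/4, below the threshold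
    1/2 of \<open>circle_in_resolvent\<close>.\<close>
  define t where "t = ln (4 * N) / \<nu>"
  have "ln (4 * N) > 0"
    using N_ge_1 by simp
  then have t: "t > 0"
    using nu_pos by (simp add: t_def)
  have q: "N * exp (- \<nu> * t) = 1 / 4"
    using nu_pos N_ge_1 by (simp add: t_def exp_minus divide_simps)
  \<comment> \<open>In either order the composite is multiplication by \<open>Q s\<close>. That this
    multiplication preserves C_0 comes for free from its factorization.\<close>
  have TS: "apply_c0 (T t (S t u)) s = Q s (apply_c0 u s)" for u s
    using t U_B[OF sh_le[of t s]] by (simp add: T_apply S_apply)
  have ST: "apply_c0 (S t (T t u)) s = Q s (apply_c0 u s)" for u s
    using t B_U[OF sh_ge[of "-t" s]] by (simp add: T_apply S_apply)
  have "z \<in> resolvent_set UNIV (T t)" if "cmod z = 1" for z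
  proof (rule circle_in_resolvent[OF bclin S_bclin _ _ _ _ _ that])
    show "S t (T t u) = T t (S t u)" for u
      by (rule c0_eqI) (simp only: TS ST)
    show "S t (T t (S t u)) = S t u" for u
      by (rule c0_eqI) (use t in \<open>simp add: S_apply TS\<close>)
    show "norm (S t u) \<le> 1 / 4 * norm u" for u
      using S_norm[of t u] t unfolding q by simp
    show "norm (T t (u - T t (S t u))) \<le> 1 / 4 * norm u" for u
    proof (rule c0_norm_le)
      fix s
      have "apply_c0 (T t (u - T t (S t u))) s = U s (sh s t) (P (sh s t) (apply_c0 u (sh s t)))"
        using t by (simp add: T_apply[of t "u - T t (S t u)"] TS compl_proj_def)
      then have "norm (apply_c0 (T t (u - T t (S t u))) s) \<le> 1 / 4 * norm (apply_c0 u (sh s t))"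
        using U_P_bound[OF sh_le, of t s "apply_c0 u (sh s t)"] t
        by (simp only: mu_sh diff_diff_eq2 add_diff_cancel_left' q less_imp_le)
      with c0_norm_ge[of u "sh s t"] show "norm (apply_c0 (T t (u - T t (S t u))) s) \<le> 1 / 4 * norm u"
        by simp
    qed
  qed (use t in auto)
  then have "spectrum UNIV (T t) \<inter> {z. cmod z = 1} = {}"
    by (auto simp: spectrum_def)
  with t show ?thesis
    by (auto simp: hyperbolic_def)
qed

end

section \<open>An invertible generator yields a dichotomy\<close>

definition clip :: "real \<Rightarrow> real" where "clip x = max 0 (min 1 x)"
text \<open>The smoothstep polynomial \<open>3 p^2 - 2 p^3\<close>: its derivative
  \<open>6 p (1 - p)\<close> vanishes at 0 and 1, so clipping the argument keeps it continuously
  differentiable.\<close>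

definition step :: "real \<Rightarrow> real" where "step x = 3 * (clip x)\<^sup>2 - 2 * (clip x) ^ 3"
definition dstep :: "real \<Rightarrow> real" where "dstep x = 6 * clip x * (1 - clip x)"

lemma clip_bounds: "0 \<le> clip x" "clip x \<le> 1"
  by (auto simp: clip_def)

lemma step_0 [simp]: "x \<le> 0 \<Longrightarrow> step x = 0" and dstep_0 [simp]: "x \<le> 0 \<Longrightarrow> dstep x = 0"
  and step_1 [simp]: "1 \<le> x \<Longrightarrow> step x = 1" and dstep_1 [simp]: "1 \<le> x \<Longrightarrow> dstep x = 0"
  by (auto simp: step_def dstep_def clip_def)

lemma dstep_bounds: "0 \<le> dstep x" "dstep x \<le> 3 / 2"
proof -
  show "0 \<le> dstep x"
    using clip_bounds[of x] by (simp add: dstep_def)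
  have "0 \<le> 6 * (clip x - 1 / 2)\<^sup>2"
    by simp
  then show "dstep x \<le> 3 / 2"
    by (simp add: dstep_def power2_eq_square algebra_simps)
qed

lemma step_bounds: "0 \<le> step x" "step x \<le> 1"
proof -
  have "step x = (clip x)\<^sup>2 * (3 - 2 * clip x)" "1 - step x = (1 - clip x)\<^sup>2 * (1 + 2 * clip x)"
    by (simp_all add: step_def power2_eq_square power3_eq_cube algebra_simps)
  moreover have "0 \<le> (clip x)\<^sup>2 * (3 - 2 * clip x)" "0 \<le> (1 - clip x)\<^sup>2 * (1 + 2 * clip x)"
    using clip_bounds[of x] by simp_all
  ultimately show "0 \<le> step x" "step x \<le> 1"
    by linarith+
qed

text \<open>A Taylor estimate uniform in \<open>x\<close>. The polynomial part expands exactly in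
  powers of \<open>q - p\<close> and contributes 3; the clipping error contributes 6.\<close>

lemma step_quadratic: "\<bar>step (x + h) - step x - h * dstep x\<bar> \<le> 9 * h\<^sup>2"
proof -
  define p q where "p = clip x" and "q = clip (x + h)"
  have pq: "0 \<le> p" "p \<le> 1" "0 \<le> q" "q \<le> 1"
    by (auto simp: p_def q_def clip_bounds)
  have lip: "\<bar>q - p\<bar> \<le> \<bar>h\<bar>"
    by (auto simp: p_def q_def clip_def)
  have eq: "step (x + h) - step x - h * dstep x = (q - p)\<^sup>2 * (3 - 2 * q - 4 * p) + (q - p - h) * dstep x"
    unfolding step_def dstep_def p_def[symmetric] q_def[symmetric]
    by (simp add: power2_eq_square power3_eq_cube algebra_simps)
  have "\<bar>(q - p)\<^sup>2 * (3 - 2 * q - 4 * p)\<bar> \<le> h\<^sup>2 * 3"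
    unfolding abs_mult using pq power_mono[OF lip, of 2] by (intro mult_mono) auto
  \<comment> \<open>This term survives only if \<open>x\<close> lies in \<open>[0, 1]\<close> and
    \<open>x + h\<close> does not; then \<open>x\<close> is within \<bar>h\<bar> of the end that was
    crossed, so the overshoot and \<open>dstep x\<close> are both of order \<open>h\<close>.\<close>
  moreover have "\<bar>(q - p - h) * dstep x\<bar> \<le> 6 * h\<^sup>2"
  proof (cases "0 \<le> x \<and> x \<le> 1")
    case False
    then have "dstep x = 0" by auto
    then show ?thesis by simp
  next
    case True
    then have p: "p = x"
      by (simp add: p_def clip_def)
    have d: "\<bar>dstep x\<bar> = 6 * (x * (1 - x))"
      using True by (simp add: dstep_def p_def[symmetric] p)
    consider "x + h < 0" | "0 \<le> x + h" "x + h \<le> 1" | "1 < x + h"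
      by linarith
    then show ?thesis
    proof cases
      case 1
      then have "q = 0" by (simp add: q_def clip_def)
      then have "\<bar>(q - p - h) * dstep x\<bar> = 6 * ((- x - h) * (x * (1 - x)))"
        using 1 unfolding abs_mult d by (simp add: p)
      also have "\<dots> \<le> 6 * ((- h) * (- h * 1))"
        using 1 True by (intro mult_left_mono mult_mono) auto
      finally show ?thesis by (simp add: power2_eq_square)
    next
      case 2
      then have "q = x + h" by (simp add: q_def clip_def)
      then show ?thesis by (simp add: p)
    next
      case 3
      then have "q = 1" by (simp add: q_def clip_def)
      then have "\<bar>(q - p - h) * dstep x\<bar> = 6 * ((x + h - 1) * (x * (1 - x)))"
        using 3 unfolding abs_mult d by (simp add: p)
      also have "\<dots> \<le> 6 * (h * (1 * h))"
        using 3 True by (intro mult_left_mono mult_mono) auto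
      finally show ?thesis by (simp add: power2_eq_square)
    qed
  qed
  ultimately show ?thesis
    unfolding eq by linarith
qed

text \<open>Dividing the quadratic estimate by \<open>h\<close> covers the corners of
  \<open>clip\<close> without a case distinction.\<close>

lemma step_deriv: "(step has_real_derivative dstep x) (at x)"
proof -
  have "((\<lambda>h. (step (x + h) - step x) / h - dstep x) \<longlongrightarrow> 0) (at 0)"
  proof (rule Lim_null_comparison)
    show "\<forall>\<^sub>F h in at 0. norm ((step (x + h) - step x) / h - dstep x) \<le> 9 * \<bar>h\<bar>"
      unfolding eventually_at_filter
    proof (intro always_eventually allI impI)
      fix h :: real assume "h \<noteq> 0"
      then have "(step (x + h) - step x) / h - dstep x = (step (x + h) - step x - h * dstep x) / h"
        by (simp add: field_simps)
      then show "norm ((step (x + h) - step x) / h - dstep x) \<le> 9 * \<bar>h\<bar>"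
        using step_quadratic[of x h] \<open>h \<noteq> 0\<close> by (simp add: divide_simps power2_eq_square mult_ac)
    qed
    show "((\<lambda>h::real. 9 * \<bar>h\<bar>) \<longlongrightarrow> 0) (at 0)"
      by (auto intro!: tendsto_eq_intros)
  qed
  then show ?thesis
    by (simp add: DERIV_def LIM_zero_iff)
qed

lemma clip_cont: "continuous_on A clip"
  unfolding clip_def[abs_def] by (intro continuous_intros)

lemma step_cont [continuous_intros]: "continuous_on A f \<Longrightarrow> continuous_on A (\<lambda>x. step (f x))"
  and dstep_cont [continuous_intros]: "continuous_on A f \<Longrightarrow> continuous_on A (\<lambda>x. dstep (f x))"
  unfolding step_def dstep_def
  by (intro continuous_intros continuous_on_compose2[OF clip_cont[of UNIV]]; auto)+

section \<open>Boundedness and decay on a half-line\<close>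

lemma bounded_of_lim_at_top:
  fixes V :: "real \<Rightarrow> 'a::real_normed_vector"
  assumes "continuous_on UNIV V" "(V \<longlongrightarrow> 0) at_top"
  obtains B where "\<And>t. t \<ge> s \<Longrightarrow> norm (V t) \<le> B"
proof -
  have "\<forall>\<^sub>F t in at_top. dist (V t) 0 < 1"
    using assms(2) by (rule tendstoD) simp
  then obtain t1 where t1: "\<And>t. t \<ge> t1 \<Longrightarrow> norm (V t) < 1"
    by (auto simp: eventually_at_top_linorder)
  have "bounded (V ` {s..t1})"
    by (intro compact_imp_bounded compact_continuous_image continuous_on_subset[OF assms(1)]) auto
  then obtain B where B: "\<And>t. t \<in> {s..t1} \<Longrightarrow> norm (V t) \<le> B"
    unfolding bounded_iff by blast
  have "norm (V t) \<le> max 1 B" if "t \<ge> s" for t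
    using t1[of t] B[of t] that by (cases "t \<ge> t1") auto
  with that show thesis .
qed

text \<open>Iterates the halving over the \<open>n\<close> full lengths \<open>L\<close> that fit
  between \<open>a\<close> and \<open>z\<close>; \<open>M\<close> pays for the remaining piece and
  the factor 2 for rounding down to \<open>n\<close>.\<close>

lemma exponential_decay:
  fixes g :: "real \<Rightarrow> real"
  assumes L: "L > 0" and g0: "\<And>y. 0 \<le> g y" and M: "M \<ge> 0"
    and le: "\<And>y z. a \<le> y \<Longrightarrow> y \<le> z \<Longrightarrow> g z \<le> M * g y"
    and half: "\<And>y z. a \<le> y \<Longrightarrow> y + L \<le> z \<Longrightarrow> g z \<le> g y / 2"
    and z: "a \<le> z"
  shows "g z \<le> 2 * M * exp (- (ln 2 / L) * (z - a)) * g a"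
proof -
  define n where "n = nat \<lfloor>(z - a) / L\<rfloor>"
  have nn: "real n = of_int \<lfloor>(z - a) / L\<rfloor>"
    using z L by (simp add: n_def)
  then have n1: "real n \<le> (z - a) / L" and n2: "(z - a) / L \<le> real n + 1"
    by linarith+
  have pow: "g (a + real k * L) \<le> g a / 2 ^ k" for k
  proof (induction k)
    case (Suc k)
    have "g (a + real (Suc k) * L) \<le> g (a + real k * L) / 2"
      using L by (intro half) (auto simp: algebra_simps)
    with Suc show ?case by simp
  qed simp
  have "real n * L \<le> z - a"
    using n1 L by (simp add: pos_le_divide_eq)
  then have "g z \<le> M * g (a + real n * L)"
    using L by (intro le) auto
  also have "\<dots> \<le> M * (g a / 2 ^ n)"
    by (intro mult_left_mono pow M)
  also have "\<dots> \<le> M * (g a * (2 * exp (- (ln 2 / L) * (z - a))))"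
  proof -
    have "exp (ln 2 * ((z - a) / L)) \<le> exp (ln 2 * (real n + 1))"
      using n2 by (intro iffD2[OF exp_le_cancel_iff] mult_left_mono) auto
    also have "\<dots> = 2 * 2 ^ n"
      by (simp add: distrib_left exp_add exp_of_nat2_mult mult.commute[of "ln 2"] exp_of_nat_mult)
    finally have "1 / 2 ^ n \<le> 2 * exp (- (ln 2 / L) * (z - a))"
      by (simp add: exp_minus divide_simps mult_ac)
    from mult_left_mono[OF this g0[of a]] show ?thesis
      by (intro mult_left_mono M) simp
  qed
  finally show ?thesis by (simp add: mult_ac)
qed

text \<open>\<open>R\<close> is the resolvent at 0, hence the inverse of \<open>- gen T\<close> and
  not of \<open>gen T\<close>.\<close>

locale invertible_generator = evolution +
  fixes R :: "'a c0fun \<Rightarrow> 'a c0fun" and c :: real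
  assumes R_gen: "\<And>u. u \<in> gen_dom T \<Longrightarrow> R (- gen T u) = u"
    and R_dom: "\<And>f. R f \<in> gen_dom T"
    and gen_R: "\<And>f. gen T (R f) = - f"
    and R_norm: "\<And>f. norm (R f) \<le> c * norm f"
    and c_pos: "c > 0"
begin

text \<open>\<Phi> plays the derivative of \<Psi>. As \<open>V\<close> is an orbit,
  \<open>T h w\<close> at \<open>t\<close> is \<open>\<Psi> (\<mu> t - h) *\<^sub>R V t\<close>, so
  \<open>quad\<close> gives convergence at rate \<open>h\<close> in the sup norm and
  \<open>w = R f\<close>. The orbit property is demanded only where the cutoff is nonzero, which
  permits an arbitrary continuation elsewhere; \<open>quad\<close> contains the norm of
  \<open>V\<close> because \<open>V\<close> may be unbounded where the cutoff vanishes.\<close>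

lemma cutoff_bound:
  assumes w: "\<And>t. apply_c0 w t = \<Psi> (\<mu> t) *\<^sub>R V t"
    and f: "\<And>t. apply_c0 f t = \<Phi> (\<mu> t) *\<^sub>R V t"
    and traj: "\<And>r t. r \<le> t \<Longrightarrow> \<Psi> (\<mu> r) \<noteq> 0 \<Longrightarrow> U t r (V r) = V t"
    and quad: "\<And>h t. 0 < h \<Longrightarrow> h \<le> 1 \<Longrightarrow>
      \<bar>\<Psi> (\<mu> t - h) - \<Psi> (\<mu> t) + h * \<Phi> (\<mu> t)\<bar> * norm (V t) \<le> C * h\<^sup>2"
  shows "norm w \<le> c * norm f"
proof -
  have "((\<lambda>h. (T h w - w) /\<^sub>R h - (- f)) \<longlongrightarrow> 0) (at_right 0)"
  proof (rule Lim_null_comparison)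
    have "\<forall>\<^sub>F h in at_right (0::real). h \<in> {0<..<1}"
      by (rule eventually_at_right_real) simp
    then show "\<forall>\<^sub>F h in at_right 0. norm ((T h w - w) /\<^sub>R h - (- f)) \<le> C * h"
    proof eventually_elim
      case (elim h)
      show ?case
      proof (rule c0_norm_le)
        fix t
        have "U t (sh t h) (apply_c0 w (sh t h)) = \<Psi> (\<mu> t - h) *\<^sub>R V t"
          using traj[of "sh t h" t] elim unfolding w
          by (cases "\<Psi> (\<mu> t - h) = 0")
             (auto simp: sh_le linear_cmul[OF U_linear] linear_0[OF U_linear])
        then have "apply_c0 ((T h w - w) /\<^sub>R h - (- f)) t
            = inverse h *\<^sub>R (\<Psi> (\<mu> t - h) *\<^sub>R V t - \<Psi> (\<mu> t) *\<^sub>R V t) + \<Phi> (\<mu> t) *\<^sub>R V t"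
          using elim by (simp add: T_apply w f)
        also have "\<dots> = inverse h *\<^sub>R ((\<Psi> (\<mu> t - h) - \<Psi> (\<mu> t) + h * \<Phi> (\<mu> t)) *\<^sub>R V t)"
          using elim by (simp add: algebra_simps)
        finally have "norm (apply_c0 ((T h w - w) /\<^sub>R h - (- f)) t)
            = inverse h * (\<bar>\<Psi> (\<mu> t - h) - \<Psi> (\<mu> t) + h * \<Phi> (\<mu> t)\<bar> * norm (V t))"
          using elim by (simp add: abs_mult)
        also have "\<dots> \<le> inverse h * (C * h\<^sup>2)"
          using elim by (intro mult_left_mono quad) auto
        also have "\<dots> = C * h"
          using elim by (simp add: power2_eq_square field_simps)
        finally show "norm (apply_c0 ((T h w - w) /\<^sub>R h - (- f)) t) \<le> C * h" .
      qed
    qed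
    show "((\<lambda>h. C * h) \<longlongrightarrow> 0) (at_right 0)"
      by (auto intro!: tendsto_eq_intros)
  qed
  then have "((\<lambda>h. (T h w - w) /\<^sub>R h) \<longlongrightarrow> - f) (at_right 0)"
    by (simp only: LIM_zero_iff)
  from gen_eqI[of T w, OF this] R_gen[of w] R_norm[of f] show ?thesis
    by simp
qed

text \<open>Mere convergence to 0 is required here and in \<open>traj\<close>: this is what
  membership in C_0 delivers, and the exponential rate is recovered from the a priori
  bounds.\<close>

definition E :: "real \<Rightarrow> 'a \<Rightarrow> bool"
  where "E s x \<longleftrightarrow> ((\<lambda>t. U t s x) \<longlongrightarrow> 0) at_top"

definition traj :: "(real \<Rightarrow> 'a) \<Rightarrow> bool"
  where "traj V \<longleftrightarrow> (\<forall>r t. r \<le> t \<longrightarrow> U t r (V r) = V t) \<and> (V \<longlongrightarrow> 0) at_bot"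

definition F :: "real \<Rightarrow> 'a \<Rightarrow> bool"
  where "F s x \<longleftrightarrow> (\<exists>V. traj V \<and> V s = x)"

text \<open>The factor 3/2 is the maximum of \<open>dstep\<close>.\<close>

definition c1 :: real where "c1 = 3 / 2 * c"

lemma c1_pos: "c1 > 0"
  using c_pos by (simp add: c1_def)

section \<open>A priori bounds from cutoffs\<close>

lemma c0_lim_split:
  fixes w :: "real \<Rightarrow> 'b::real_normed_vector"
  shows "(w \<longlongrightarrow> 0) at_bot \<Longrightarrow> (w \<longlongrightarrow> 0) at_top \<Longrightarrow> (w \<longlongrightarrow> 0) at_infinity"
  unfolding at_infinity_eq_at_top_bot by (rule filterlim_sup)

text \<open>Stretching height and width by the same \<open>L\<close> raises the plateau to
  \<open>L\<close> but keeps the slope below 3/2; this disproportion is the source of decay.\<close>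

lemma scaled_step_quad:
  assumes "L > 0"
  shows "\<bar>L * step (y + h / L) - L * step y - h * dstep y\<bar> \<le> 9 / L * h\<^sup>2"
proof -
  have "\<bar>L * step (y + h / L) - L * step y - h * dstep y\<bar>
      = L * \<bar>step (y + h / L) - step y - h / L * dstep y\<bar>"
    using abs_mult[of L "step (y + h / L) - step y - h / L * dstep y"] assms
    by (simp add: right_diff_distrib)
  also have "\<dots> \<le> L * (9 * (h / L)\<^sup>2)"
    using assms by (intro mult_left_mono step_quadratic) simp
  also have "\<dots> = 9 / L * h\<^sup>2"
    using assms by (simp add: power2_eq_square field_simps)
  finally show ?thesis .
qed

text \<open>The cutoff climbs from 0 to \<open>L\<close> over the \<mu>-times from
  \<open>\<mu> s\<close> to \<open>\<mu> s + L\<close>. Its derivative sees the orbit on this ramp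
  only, while beyond the ramp \<open>w\<close> is \<open>L\<close> times the orbit.\<close>

lemma stable_cut:
  assumes x: "E s x" and L: "L > 0"
    and B: "\<And>t. s \<le> t \<Longrightarrow> \<mu> t \<le> \<mu> s + L \<Longrightarrow> norm (U t s x) \<le> B"
    and t: "\<mu> s + L \<le> \<mu> t"
  shows "L * norm (U t s x) \<le> c1 * B"
proof -
  \<comment> \<open>The orbit cannot be continued before \<open>s\<close>, so it is frozen at
    \<open>x\<close>; the cutoff vanishes there.\<close>
  define V where "V t = U (max s t) s x" for t
  define \<Psi> where "\<Psi> y = L * step ((y - \<mu> s) / L)" for y
  define \<Phi> where "\<Phi> y = dstep ((y - \<mu> s) / L)" for y
  have V_cont: "continuous_on UNIV V"
    unfolding V_def by (intro U_cont continuous_intros) auto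
  have "\<forall>\<^sub>F t in at_top. U t s x = V t"
    using eventually_ge_at_top[of s] by eventually_elim (simp add: V_def max_def)
  then have V_lim: "(V \<longlongrightarrow> 0) at_top"
    using x unfolding E_def by (rule Lim_transform_eventually[rotated])
  obtain B' where B': "\<And>t. t \<ge> s \<Longrightarrow> norm (V t) \<le> B'"
    by (rule bounded_of_lim_at_top[OF V_cont V_lim]) blast
  have V_norm: "norm (V t) \<le> B'" for t
    using B'[of t] B'[of s] by (cases "s \<le> t") (auto simp: V_def max_def)
  have zero: "\<Psi> (\<mu> t) = 0 \<and> \<Phi> (\<mu> t) = 0" if "t \<le> s" for t
    using that L mu_le[of t s] by (auto simp: \<Psi>_def \<Phi>_def divide_nonpos_pos)
  have \<Psi>_cont: "continuous_on UNIV (\<lambda>t. \<Psi> (\<mu> t))" and \<Phi>_cont: "continuous_on UNIV (\<lambda>t. \<Phi> (\<mu> t))"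
    unfolding \<Psi>_def \<Phi>_def using L by (intro continuous_intros mu_cont; simp)+
  have \<Psi>_le: "\<bar>\<Psi> y\<bar> \<le> L" and \<Phi>_le: "\<bar>\<Phi> y\<bar> \<le> 3 / 2" for y
    using step_bounds[of "(y - \<mu> s) / L"] dstep_bounds[of "(y - \<mu> s) / L"] L
    by (auto simp: \<Psi>_def \<Phi>_def abs_mult)
  have lim: "((\<lambda>t. \<theta> (\<mu> t) *\<^sub>R V t) \<longlongrightarrow> 0) at_infinity"
    if "\<And>t. t \<le> s \<Longrightarrow> \<theta> (\<mu> t) = 0" "\<And>y. \<bar>\<theta> y\<bar> \<le> D" for \<theta> :: "real \<Rightarrow> real" and D
  proof (rule c0_lim_split)
    have "\<forall>\<^sub>F t in at_bot. 0 = \<theta> (\<mu> t) *\<^sub>R V t"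
      using eventually_le_at_bot[of s] by eventually_elim (simp add: that)
    then show "((\<lambda>t. \<theta> (\<mu> t) *\<^sub>R V t) \<longlongrightarrow> 0) at_bot"
      by (rule Lim_transform_eventually[OF tendsto_const])
    show "((\<lambda>t. \<theta> (\<mu> t) *\<^sub>R V t) \<longlongrightarrow> 0) at_top"
    proof (rule Lim_null_comparison[OF always_eventually])
      show "((\<lambda>t. D * norm (V t)) \<longlongrightarrow> 0) at_top"
        by (intro tendsto_mult_right_zero tendsto_norm_zero V_lim)
    qed (auto intro!: mult_right_mono that)
  qed
  define w where "w = Abs_c0 (\<lambda>t. \<Psi> (\<mu> t) *\<^sub>R V t)"
  define f where "f = Abs_c0 (\<lambda>t. \<Phi> (\<mu> t) *\<^sub>R V t)"
  have w: "apply_c0 w = (\<lambda>t. \<Psi> (\<mu> t) *\<^sub>R V t)"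
    unfolding w_def by (intro apply_Abs_c0 lim[of _ L] continuous_on_scaleR \<Psi>_cont V_cont) (use zero \<Psi>_le in auto)
  have f: "apply_c0 f = (\<lambda>t. \<Phi> (\<mu> t) *\<^sub>R V t)"
    unfolding f_def by (intro apply_Abs_c0 lim[of _ "3/2"] continuous_on_scaleR \<Phi>_cont V_cont) (use zero \<Phi>_le in auto)
  have "norm w \<le> c * norm f"
  proof (rule cutoff_bound[of w \<Psi> V f \<Phi> "9 / L * B'"])
    show "U t r (V r) = V t" if "r \<le> t" "\<Psi> (\<mu> r) \<noteq> 0" for r t
    proof -
      have "s \<le> r"
        using zero[of r] that by force
      then show ?thesis
        using that by (simp add: V_def max_def U_comp)
    qed
    show "\<bar>\<Psi> (\<mu> t - h) - \<Psi> (\<mu> t) + h * \<Phi> (\<mu> t)\<bar> * norm (V t) \<le> 9 / L * B' * h\<^sup>2" for h t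
    proof -
      have "\<bar>\<Psi> (\<mu> t - h) - \<Psi> (\<mu> t) + h * \<Phi> (\<mu> t)\<bar> \<le> 9 / L * h\<^sup>2"
        using scaled_step_quad[OF L, of "(\<mu> t - \<mu> s) / L" "- h"]
        by (simp add: \<Psi>_def \<Phi>_def diff_divide_distrib add_divide_distrib algebra_simps)
      then have "\<bar>\<Psi> (\<mu> t - h) - \<Psi> (\<mu> t) + h * \<Phi> (\<mu> t)\<bar> * norm (V t) \<le> 9 / L * h\<^sup>2 * B'"
        using V_norm L by (intro mult_mono) auto
      then show ?thesis by (simp add: mult_ac)
    qed
  qed (simp_all add: w f)
  also have "norm f \<le> 3 / 2 * B"
  proof (rule c0_norm_le)
    fix t
    have B0: "0 \<le> B"
      using B[of s] L by (meson norm_ge_zero order_trans order_refl le_add_same_cancel1 less_imp_le)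
    show "norm (apply_c0 f t) \<le> 3 / 2 * B"
    proof (cases "s \<le> t \<and> \<mu> t \<le> \<mu> s + L")
      case True
      then show ?thesis
        using mult_mono[OF \<Phi>_le[of "\<mu> t"] B[of t]] by (simp add: f V_def max_def)
    next
      case False
      then have "\<Phi> (\<mu> t) = 0"
        using zero[of t] L by (cases "t \<le> s") (auto simp: \<Phi>_def pos_le_divide_eq)
      then show ?thesis
        using B0 by (simp add: f)
    qed
  qed
  finally have "norm w \<le> c1 * B"
    using c_pos by (simp add: c1_def)
  moreover have "s \<le> t"
    using t L mu_le[of s t] by linarith
  then have "apply_c0 w t = L *\<^sub>R U t s x"
    using t L by (simp add: w \<Psi>_def V_def max_def pos_le_divide_eq)
  ultimately show ?thesis
    using c0_norm_ge[of w t] L by simp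
qed

lemma traj_U: "traj V \<Longrightarrow> r \<le> t \<Longrightarrow> U t r (V r) = V t"
  by (simp add: traj_def)

lemma traj_cont:
  assumes "traj V"
  shows "continuous_on A V"
proof -
  have "isCont V t" for t
  proof -
    have "continuous_on {t-1<..} (\<lambda>r. U r (t-1) (V (t-1)))"
      by (intro U_cont continuous_intros) auto
    then have "continuous_on {t-1<..} V"
      by (rule continuous_on_eq) (use traj_U[OF assms] in auto)
    then show ?thesis
      by (simp add: continuous_on_eq_continuous_at)
  qed
  then show ?thesis
    by (simp add: continuous_at_imp_continuous_on)
qed

text \<open>The mirror image of \<open>stable_cut\<close>: the cutoff descends from \<open>L\<close>
  to 0 on a ramp ending at \<open>b\<close>, beyond which \<open>V\<close> may grow without
  harm.\<close>

lemma traj_cut: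
  assumes V: "traj V" and L: "L > 0"
    and B: "\<And>t. \<mu> t \<le> b \<Longrightarrow> b - L \<le> \<mu> t \<Longrightarrow> norm (V t) \<le> B"
    and t: "\<mu> t \<le> b - L"
  shows "L * norm (V t) \<le> c1 * B"
proof -
  define \<Psi> where "\<Psi> y = L * step ((b - y) / L)" for y
  define \<Phi> where "\<Phi> y = - dstep ((b - y) / L)" for y
  have "((\<lambda>t. V (- t)) \<longlongrightarrow> 0) at_top"
    using V by (auto simp: traj_def filterlim_at_bot_mirror)
  then obtain B' where B': "\<And>t. t \<ge> - inv \<mu> (b + 1) \<Longrightarrow> norm (V (- t)) \<le> B'"
    by (rule bounded_of_lim_at_top[rotated])
       (auto intro!: continuous_on_compose2[OF traj_cont[OF V, of UNIV]] continuous_intros)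
  \<comment> \<open>One unit of room above \<open>b\<close> is enough: for \<open>h \<le> 1\<close>
    and \<open>\<mu> t > b + 1\<close> the cutoff vanishes at both \<open>\<mu> t\<close> and
    \<open>\<mu> t - h\<close>.\<close>
  have V_norm: "norm (V t) \<le> B'" if "\<mu> t \<le> b + 1" for t
    using B'[of "- t"] that mu_le[of t "inv \<mu> (b + 1)"] by simp
  have zero: "\<Psi> y = 0 \<and> \<Phi> y = 0" if "b \<le> y" for y
    using that L by (auto simp: \<Psi>_def \<Phi>_def divide_nonpos_pos)
  have \<Psi>_cont: "continuous_on UNIV (\<lambda>t. \<Psi> (\<mu> t))" and \<Phi>_cont: "continuous_on UNIV (\<lambda>t. \<Phi> (\<mu> t))"
    unfolding \<Psi>_def \<Phi>_def using L by (intro continuous_intros mu_cont; simp)+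
  have \<Psi>_le: "\<bar>\<Psi> y\<bar> \<le> L" and \<Phi>_le: "\<bar>\<Phi> y\<bar> \<le> 3 / 2" for y
    using step_bounds[of "(b - y) / L"] dstep_bounds[of "(b - y) / L"] L
    by (auto simp: \<Psi>_def \<Phi>_def abs_mult)
  have lim: "((\<lambda>t. \<theta> (\<mu> t) *\<^sub>R V t) \<longlongrightarrow> 0) at_infinity"
    if "\<And>y. b \<le> y \<Longrightarrow> \<theta> y = 0" "\<And>y. \<bar>\<theta> y\<bar> \<le> D" for \<theta> :: "real \<Rightarrow> real" and D
  proof (rule c0_lim_split)
    have "\<forall>\<^sub>F t in at_top. b \<le> \<mu> t"
      using mu_at_top by (simp add: filterlim_at_top)
    then have "\<forall>\<^sub>F t in at_top. 0 = \<theta> (\<mu> t) *\<^sub>R V t"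
      by eventually_elim (simp add: that)
    then show "((\<lambda>t. \<theta> (\<mu> t) *\<^sub>R V t) \<longlongrightarrow> 0) at_top"
      by (rule Lim_transform_eventually[OF tendsto_const])
    show "((\<lambda>t. \<theta> (\<mu> t) *\<^sub>R V t) \<longlongrightarrow> 0) at_bot"
    proof (rule Lim_null_comparison[OF always_eventually])
      show "((\<lambda>t. D * norm (V t)) \<longlongrightarrow> 0) at_bot"
        using V by (intro tendsto_mult_right_zero tendsto_norm_zero) (simp add: traj_def)
    qed (auto intro!: mult_right_mono that)
  qed
  define w where "w = Abs_c0 (\<lambda>t. \<Psi> (\<mu> t) *\<^sub>R V t)"
  define f where "f = Abs_c0 (\<lambda>t. \<Phi> (\<mu> t) *\<^sub>R V t)"
  have w: "apply_c0 w = (\<lambda>t. \<Psi> (\<mu> t) *\<^sub>R V t)"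
    unfolding w_def by (intro apply_Abs_c0 lim[of _ L] continuous_on_scaleR \<Psi>_cont traj_cont V) (use zero \<Psi>_le in auto)
  have f: "apply_c0 f = (\<lambda>t. \<Phi> (\<mu> t) *\<^sub>R V t)"
    unfolding f_def by (intro apply_Abs_c0 lim[of _ "3/2"] continuous_on_scaleR \<Phi>_cont traj_cont V) (use zero \<Phi>_le in auto)
  have "norm w \<le> c * norm f"
  proof (rule cutoff_bound[of w \<Psi> V f \<Phi> "9 / L * B'"])
    show "\<bar>\<Psi> (\<mu> t - h) - \<Psi> (\<mu> t) + h * \<Phi> (\<mu> t)\<bar> * norm (V t) \<le> 9 / L * B' * h\<^sup>2"
      if "0 < h" "h \<le> 1" for h t
    proof (cases "\<mu> t \<le> b + 1")
      case True
      have "\<bar>\<Psi> (\<mu> t - h) - \<Psi> (\<mu> t) + h * \<Phi> (\<mu> t)\<bar> \<le> 9 / L * h\<^sup>2"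
        using scaled_step_quad[OF L, of "(b - \<mu> t) / L" "h"]
        by (simp add: \<Psi>_def \<Phi>_def diff_divide_distrib add_divide_distrib algebra_simps)
      then have "\<bar>\<Psi> (\<mu> t - h) - \<Psi> (\<mu> t) + h * \<Phi> (\<mu> t)\<bar> * norm (V t) \<le> 9 / L * h\<^sup>2 * B'"
        using V_norm[OF True] L by (intro mult_mono) auto
      then show ?thesis by (simp add: mult_ac)
    next
      case False
      have "0 \<le> B'"
        using V_norm[of "inv \<mu> b"] norm_ge_zero by (metis mu_inv le_add_same_cancel1 order_trans zero_le_one)
      then show ?thesis
        using False that zero[of "\<mu> t"] zero[of "\<mu> t - h"] L by simp
    qed
  qed (simp_all add: w f traj_U V)
  also have "norm f \<le> 3 / 2 * B"
  proof (rule c0_norm_le)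
    fix t
    have B0: "0 \<le> B"
      using order_trans[OF norm_ge_zero B[of "inv \<mu> b"]] L by simp
    show "norm (apply_c0 f t) \<le> 3 / 2 * B"
    proof (cases "\<mu> t \<le> b \<and> b - L \<le> \<mu> t")
      case True
      then show ?thesis
        using mult_mono[OF \<Phi>_le[of "\<mu> t"] B[of t]] by (simp add: f)
    next
      case False
      then have "\<Phi> (\<mu> t) = 0"
        using zero[of "\<mu> t"] L by (cases "b \<le> \<mu> t") (auto simp: \<Phi>_def pos_le_divide_eq)
      then show ?thesis
        using B0 by (simp add: f)
    qed
  qed
  finally have "norm w \<le> c1 * B"
    using c_pos by (simp add: c1_def)
  moreover have "apply_c0 w t = L *\<^sub>R V t"
    using t L by (simp add: w \<Psi>_def pos_le_divide_eq)
  ultimately show ?thesis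
    using c0_norm_ge[of w t] L by simp
qed

section \<open>Linearity and invariance of the two families of subspaces\<close>

lemma E_diff: "E s x \<Longrightarrow> E s y \<Longrightarrow> E s (x - y)"
  and E_add: "E s x \<Longrightarrow> E s y \<Longrightarrow> E s (x + y)"
  and E_scaleC: "E s x \<Longrightarrow> E s (scaleC a x)"
proof -
  have ev: "\<forall>\<^sub>F t in at_top. s \<le> t"
    by (rule eventually_ge_at_top)
  show "E s (x - y)" if "E s x" "E s y"
    unfolding E_def
    by (rule Lim_transform_eventually[OF tendsto_diff[OF that[unfolded E_def], simplified]])
       (rule eventually_mono[OF ev], simp add: linear_diff[OF U_linear])
  show "E s (x + y)" if "E s x" "E s y"
    unfolding E_def
    by (rule Lim_transform_eventually[OF tendsto_add[OF that[unfolded E_def], simplified]])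
       (rule eventually_mono[OF ev], simp add: linear_add[OF U_linear])
  show "E s (scaleC a x)" if "E s x"
    unfolding E_def
    by (rule Lim_transform_eventually[OF tendsto_scaleC[OF tendsto_const that[unfolded E_def], simplified]])
       (rule eventually_mono[OF ev], simp add: bounded_clinearD(2)[OF U_bclin])
qed

lemma traj_diff: "traj V \<Longrightarrow> traj W \<Longrightarrow> traj (\<lambda>t. V t - W t)"
  and traj_add: "traj V \<Longrightarrow> traj W \<Longrightarrow> traj (\<lambda>t. V t + W t)"
  and traj_scaleC: "traj V \<Longrightarrow> traj (\<lambda>t. scaleC a (V t))"
  using tendsto_diff[of V 0 at_bot W 0] tendsto_add[of V 0 at_bot W 0]
    tendsto_scaleC[OF tendsto_const, of V 0 at_bot a]
  by (auto simp: traj_def linear_diff[OF U_linear] linear_add[OF U_linear] bounded_clinearD(2)[OF U_bclin])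

lemma F_I: "traj V \<Longrightarrow> V s = x \<Longrightarrow> F s x"
  by (auto simp: F_def)

lemma F_E:
  assumes "F s x"
  obtains V where "traj V" "V s = x"
  using assms by (auto simp: F_def)

lemma F_diff: "F s x \<Longrightarrow> F s y \<Longrightarrow> F s (x - y)"
  and F_add: "F s x \<Longrightarrow> F s y \<Longrightarrow> F s (x + y)"
  and F_scaleC: "F s x \<Longrightarrow> F s (scaleC a x)"
proof -
  show "F s (x - y)" if x: "F s x" and y: "F s y"
  proof -
    from x obtain V where V: "traj V" "V s = x" by (rule F_E)
    from y obtain W where W: "traj W" "W s = y" by (rule F_E)
    show ?thesis by (rule F_I[OF traj_diff[OF V(1) W(1)]]) (simp add: V W)
  qed
  show "F s (x + y)" if x: "F s x" and y: "F s y"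
  proof -
    from x obtain V where V: "traj V" "V s = x" by (rule F_E)
    from y obtain W where W: "traj W" "W s = y" by (rule F_E)
    show ?thesis by (rule F_I[OF traj_add[OF V(1) W(1)]]) (simp add: V W)
  qed
  show "F s (scaleC a x)" if x: "F s x"
  proof -
    from x obtain V where V: "traj V" "V s = x" by (rule F_E)
    show ?thesis by (rule F_I[OF traj_scaleC[OF V(1)]]) (simp add: V)
  qed
qed

lemma E_zero: "E s 0" and F_zero: "F s 0"
proof -
  have "traj (\<lambda>_. 0)"
    by (simp add: traj_def linear_0[OF U_linear])
  then show "F s 0"
    by (rule F_I) simp
  have "\<forall>\<^sub>F t in at_top. 0 = U t s 0"
    using eventually_ge_at_top[of s] by eventually_elim (simp add: linear_0[OF U_linear])
  then show "E s 0"
    unfolding E_def by (rule Lim_transform_eventually[OF tendsto_const])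
qed

lemma E_U:
  assumes "E s x" "s \<le> t"
  shows "E t (U t s x)"
proof -
  have "\<forall>\<^sub>F r in at_top. U r s x = U r t (U t s x)"
    using eventually_ge_at_top[of t] by eventually_elim (simp add: U_comp assms)
  then show ?thesis
    using assms(1) unfolding E_def by (rule Lim_transform_eventually[rotated])
qed

lemma F_traj: "traj V \<Longrightarrow> F t (V t)"
  by (rule F_I) simp_all

lemma F_U: "F s x \<Longrightarrow> s \<le> t \<Longrightarrow> F t (U t s x)"
  by (erule F_E) (auto simp: traj_U intro: F_traj)

text \<open>One constant for three purposes: growth over a unit of \<mu>-time, the uniform orbit
  bounds, and the norm of the projections.\<close>

definition m1 :: real where "m1 = (1 + c1) * (K * exp \<alpha>)"

section \<open>From a priori bounds to exponential decay\<close>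

lemma K_exp: "K * exp \<alpha> \<ge> 1"
  using mult_mono[of 1 K 1 "exp \<alpha>"] K_ge_1 alpha_pos by simp

lemma m1_ge: "K * exp \<alpha> \<le> m1" "c1 * (K * exp \<alpha>) \<le> m1" "1 + c1 * (K * exp \<alpha>) \<le> m1" "m1 \<ge> 1"
proof -
  have "m1 = K * exp \<alpha> + c1 * (K * exp \<alpha>)"
    by (simp add: m1_def algebra_simps)
  moreover have "0 \<le> c1 * (K * exp \<alpha>)"
    using c1_pos K_exp by simp
  ultimately show "K * exp \<alpha> \<le> m1" "c1 * (K * exp \<alpha>) \<le> m1" "1 + c1 * (K * exp \<alpha>) \<le> m1" "m1 \<ge> 1"
    using K_exp by linarith+
qed

lemma U_bound_1:
  assumes "s \<le> t" "\<mu> t \<le> \<mu> s + 1"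
  shows "norm (U t s x) \<le> K * exp \<alpha> * norm x"
proof -
  have "\<alpha> * (\<mu> t - \<mu> s) \<le> \<alpha>"
    using assms(2) alpha_pos by simp
  then have "K * exp (\<alpha> * (\<mu> t - \<mu> s)) * norm x \<le> K * exp \<alpha> * norm x"
    using K_ge_1 by (intro mult_right_mono mult_left_mono) auto
  with U_bound[OF assms(1), of x] show ?thesis
    by linarith
qed

text \<open>Long enough that the gain \<open>len\<close> beats the loss \<open>c1 * m1\<close> by a
  factor 2.\<close>

definition len :: real where "len = 1 + 2 * (c1 * m1)"

lemma len_pos: "len > 0" and len_ge: "2 * (c1 * m1) \<le> len"
proof -
  have "0 \<le> c1 * m1"
    using c1_pos m1_ge(4) by simp
  then show "len > 0" "2 * (c1 * m1) \<le> len"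
    by (simp_all add: len_def)
qed

lemma half_bound:
  assumes "len * a \<le> c1 * (m1 * b)" "0 \<le> b"
  shows "a \<le> b / 2"
proof -
  have "len * a \<le> 2 * (c1 * m1) * (b / 2)"
    using assms(1) by simp
  also have "\<dots> \<le> len * (b / 2)"
    using assms(2) len_ge by (intro mult_right_mono) auto
  finally show ?thesis
    using len_pos by simp
qed

text \<open>A bootstrap in two rounds: the growth bound controls a ramp of length 1, and the cutoff
  then controls all later times. The resulting bound is fed into a ramp of length \<open>len\<close>
  in \<open>stable_half\<close>.\<close>

lemma stable_bound:
  assumes x: "E s x" and t: "s \<le> t"
  shows "norm (U t s x) \<le> m1 * norm x"
proof (cases "\<mu> t \<le> \<mu> s + 1")
  case True
  then show ?thesis
    using U_bound_1[OF t True, of x] m1_ge(1) mult_right_mono[of "K * exp \<alpha>" m1 "norm x"] by simp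
next
  case False
  have "1 * norm (U t s x) \<le> c1 * (K * exp \<alpha> * norm x)"
    by (rule stable_cut[OF x]) (use U_bound_1 False in auto)
  also have "\<dots> \<le> m1 * norm x"
    using m1_ge(2) mult_right_mono[of "c1 * (K * exp \<alpha>)" m1 "norm x"] by (simp add: mult_ac)
  finally show ?thesis by simp
qed

lemma stable_half:
  assumes x: "E s x" and t: "\<mu> s + len \<le> \<mu> t"
  shows "norm (U t s x) \<le> norm x / 2"
  by (rule half_bound[OF stable_cut[OF x len_pos]]) (use stable_bound[OF x] t in auto)

lemma traj_bound:
  assumes V: "traj V" and t: "t \<le> r"
  shows "norm (V t) \<le> m1 * norm (V r)"
proof -
  have "1 * norm (V t) \<le> c1 * (K * exp \<alpha> * norm (V r))"
  \<comment> \<open>The growth bound works forward only, so the ramp is placed after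
    \<open>r\<close>, where \<open>V r\<close> controls the orbit.\<close>
  proof (rule traj_cut[OF V, of _ "\<mu> r + 1"])
    fix t assume t: "\<mu> t \<le> \<mu> r + 1" "\<mu> r + 1 - 1 \<le> \<mu> t"
    then have "r \<le> t" by simp
    then show "norm (V t) \<le> K * exp \<alpha> * norm (V r)"
      using U_bound_1[of r t "V r"] t traj_U[OF V] by simp
  qed (use t in auto)
  also have "\<dots> \<le> m1 * norm (V r)"
    using m1_ge(2) mult_right_mono[of "c1 * (K * exp \<alpha>)" m1 "norm (V r)"] by (simp add: mult_ac)
  finally show ?thesis by simp
qed

lemma traj_half:
  assumes V: "traj V" and t: "\<mu> t \<le> \<mu> r - len"
  shows "norm (V t) \<le> norm (V r) / 2"
  by (rule half_bound[OF traj_cut[OF V len_pos, of "\<mu> r"]]) (use traj_bound[OF V] t in auto)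

definition rate :: real where "rate = ln 2 / len"

lemma stable_decay:
  assumes x: "E s x" and t: "s \<le> t"
  shows "norm (U t s x) \<le> 2 * m1 * exp (- rate * (\<mu> t - \<mu> s)) * norm x"
proof -
  define g where "g y = norm (U (inv \<mu> y) s x)" for y
  have ge: "s \<le> inv \<mu> y" if "\<mu> s \<le> y" for y
    using inv_mu_mono[OF that] by simp
  have "g (\<mu> t) \<le> 2 * m1 * exp (- (ln 2 / len) * (\<mu> t - \<mu> s)) * g (\<mu> s)"
  proof (rule exponential_decay[OF len_pos])
    show "g z \<le> m1 * g y" if "\<mu> s \<le> y" "y \<le> z" for y z
      using stable_bound[OF E_U[OF x ge[OF that(1)]] inv_mu_mono[OF that(2)]] that
      by (simp add: g_def U_comp ge inv_mu_mono)
    show "g z \<le> g y / 2" if "\<mu> s \<le> y" "y + len \<le> z" for y z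
    proof -
      have "y \<le> z"
        using that len_pos by simp
      then show ?thesis
        using stable_half[OF E_U[OF x ge[OF that(1)]], of "inv \<mu> z"] that
        by (simp add: g_def U_comp ge inv_mu_mono)
    qed
  qed (use t m1_ge(4) in \<open>auto simp: g_def\<close>)
  then show ?thesis
    by (simp add: g_def rate_def)
qed

lemma traj_decay:
  assumes V: "traj V" and t: "t \<le> r"
  shows "norm (V t) \<le> 2 * m1 * exp (- rate * (\<mu> r - \<mu> t)) * norm (V r)"
proof -
  \<comment> \<open>Reversed \<mu>-time turns decay towards the past into decay towards the
    future.\<close>
  define g where "g y = norm (V (inv \<mu> (- y)))" for y
  have "g (- \<mu> t) \<le> 2 * m1 * exp (- (ln 2 / len) * (- \<mu> t - (- \<mu> r))) * g (- \<mu> r)"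
  proof (rule exponential_decay[OF len_pos])
    show "g z \<le> m1 * g y" if "y \<le> z" for y z
      using traj_bound[OF V inv_mu_mono[of "- z" "- y"]] that by (simp add: g_def)
    show "g z \<le> g y / 2" if "y + len \<le> z" for y z
      using traj_half[OF V, of "inv \<mu> (- z)" "inv \<mu> (- y)"] that by (simp add: g_def)
  qed (use t m1_ge(4) in \<open>auto simp: g_def\<close>)
  then show ?thesis
    by (simp add: g_def rate_def)
qed

text \<open>A backward orbit is dominated by its own later values, which here form the forward orbit
  of \<open>x\<close> and tend to 0.\<close>

lemma E_F_zero:
  assumes "E s x" "F s x"
  shows "x = 0"
proof -
  obtain V where V: "traj V" "V s = x"
    using assms(2) by (auto simp: F_def)
  have "((\<lambda>t. m1 * norm (U t s x)) \<longlongrightarrow> 0) at_top"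
    using assms(1) unfolding E_def by (intro tendsto_mult_right_zero tendsto_norm_zero)
  moreover have "\<forall>\<^sub>F t in at_top. norm x \<le> m1 * norm (U t s x)"
    using eventually_ge_at_top[of s]
    by eventually_elim (use traj_bound[OF V(1), of s] traj_U[OF V(1), of s] V(2) in simp)
  ultimately have "norm x \<le> 0"
    by (rule tendsto_lowerbound) simp
  then show ?thesis by simp
qed

section \<open>Splitting every vector by solving an inhomogeneous equation\<close>

lemma step_has_integral:
  assumes "h \<ge> 0"
  shows "((\<lambda>\<tau>. - (dstep (a - \<tau>) *\<^sub>R (x::'a))) has_integral (step (a - h) - step a) *\<^sub>R x) {0..h}"
proof -
  have "((\<lambda>\<tau>. - (dstep (a - \<tau>) *\<^sub>R x)) has_integral step (a - h) *\<^sub>R x - step (a - 0) *\<^sub>R x) {0..h}"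
  proof (rule fundamental_theorem_of_calculus[OF assms])
    fix \<tau> assume "\<tau> \<in> {0..h}"
    have "((\<lambda>\<tau>. step (a - \<tau>)) has_real_derivative dstep (a - \<tau>) * (- 1)) (at \<tau> within {0..h})"
      by (rule DERIV_chain2[OF step_deriv]) (auto intro!: derivative_eq_intros)
    then have "((\<lambda>\<tau>. step (a - \<tau>) *\<^sub>R x) has_vector_derivative (dstep (a - \<tau>) * (- 1)) *\<^sub>R x) (at \<tau> within {0..h})"
      by (rule has_vector_derivative_scaleR[OF _ has_vector_derivative_const, THEN has_vector_derivative_eq_rhs]) simp
    then show "((\<lambda>\<tau>. step (a - \<tau>) *\<^sub>R x) has_vector_derivative - (dstep (a - \<tau>) *\<^sub>R x)) (at \<tau> within {0..h})"
      by simp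
  qed
  then show ?thesis
    by (simp add: scaleR_diff_left)
qed

text \<open>Feeding the orbit of \<open>x\<close>, weighted by a bump on \<open>[\<mu> s, \<mu> s + 1]\<close>, into \<open>G\<^sup>-\<^sup>1\<close> gives a
  function that is a backward orbit before \<open>s\<close> and a forward orbit after the bump.\<close>

lemma decomposition:
  obtains y where "E s y" "F s (x - y)" "norm y \<le> m1 * norm x"
proof -
  define V where "V t = U (max s t) s x" for t
  have V_cont: "continuous_on UNIV V"
    unfolding V_def by (intro U_cont continuous_intros) auto
  define f where "f = Abs_c0 (\<lambda>t. dstep (\<mu> t - \<mu> s) *\<^sub>R V t)"
  have out: "dstep (\<mu> t - \<mu> s) = 0" if "t \<le> s \<or> \<mu> s + 1 \<le> \<mu> t" for t
    using that by auto
  have f: "apply_c0 f = (\<lambda>t. dstep (\<mu> t - \<mu> s) *\<^sub>R V t)"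
    unfolding f_def
  proof (rule apply_Abs_c0)
    show "continuous_on UNIV (\<lambda>t. dstep (\<mu> t - \<mu> s) *\<^sub>R V t)"
      by (intro continuous_intros mu_cont V_cont)
    show "((\<lambda>t. dstep (\<mu> t - \<mu> s) *\<^sub>R V t) \<longlongrightarrow> 0) at_infinity"
    proof (rule c0_lim_split)
      have "\<forall>\<^sub>F t in at_bot. 0 = dstep (\<mu> t - \<mu> s) *\<^sub>R V t"
        using eventually_le_at_bot[of s] by eventually_elim (simp add: out)
      then show "((\<lambda>t. dstep (\<mu> t - \<mu> s) *\<^sub>R V t) \<longlongrightarrow> 0) at_bot"
        by (rule Lim_transform_eventually[OF tendsto_const])
      have "\<forall>\<^sub>F t in at_top. \<mu> s + 1 \<le> \<mu> t"
        using mu_at_top by (simp add: filterlim_at_top)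
      then have "\<forall>\<^sub>F t in at_top. 0 = dstep (\<mu> t - \<mu> s) *\<^sub>R V t"
        by eventually_elim (simp add: out)
      then show "((\<lambda>t. dstep (\<mu> t - \<mu> s) *\<^sub>R V t) \<longlongrightarrow> 0) at_top"
        by (rule Lim_transform_eventually[OF tendsto_const])
    qed
  qed
  define u where "u = apply_c0 (R f)"
  \<comment> \<open>Variation of constants. The bump has total mass 1, so past its support
    \<open>u\<close> differs from the orbit of \<open>u s\<close> by exactly the orbit of
    \<open>x\<close>.\<close>
  have u: "U t r (u r) - u t = (step (\<mu> r - \<mu> s) - step (\<mu> t - \<mu> s)) *\<^sub>R V t" if "r \<le> t" for r t
  proof -
    define h where "h = \<mu> t - \<mu> r"
    have h: "h \<ge> 0" "sh t h = r"
      using that by (auto simp: h_def)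
    have "((\<lambda>\<tau>. U t (sh t \<tau>) (apply_c0 (gen T (R f)) (sh t \<tau>))) has_integral U t r (u r) - u t) {0..h}"
      using gen_mild[OF R_dom h(1), of t f] unfolding h(2) u_def .
    moreover have "U t (sh t \<tau>) (apply_c0 (gen T (R f)) (sh t \<tau>)) = - (dstep ((\<mu> t - \<mu> s) - \<tau>) *\<^sub>R V t)"
      if "\<tau> \<in> {0..h}" for \<tau>
    proof (cases "sh t \<tau> \<le> s")
      case True
      then show ?thesis
        using out[of "sh t \<tau>"] that
        by (simp add: gen_R f linear_0[OF U_linear[OF sh_le]] algebra_simps)
    next
      case False
      then have "s \<le> sh t \<tau>" "sh t \<tau> \<le> t"
        using that sh_le[of \<tau> t] by auto
      then show ?thesis
        by (simp add: gen_R f V_def max_def U_comp linear_neg[OF U_linear] linear_cmul[OF U_linear] algebra_simps)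
    qed
    ultimately have "((\<lambda>\<tau>. - (dstep ((\<mu> t - \<mu> s) - \<tau>) *\<^sub>R V t)) has_integral U t r (u r) - u t) {0..h}"
      by (rule has_integral_eq[rotated])
    with step_has_integral[OF h(1), of "\<mu> t - \<mu> s" "V t"]
    have "U t r (u r) - u t = (step (\<mu> t - \<mu> s - h) - step (\<mu> t - \<mu> s)) *\<^sub>R V t"
      by (metis has_integral_unique)
    then show ?thesis
      by (simp add: h_def)
  qed
  have "F s (u s)"
    unfolding F_def
  proof (intro exI conjI)
    \<comment> \<open>After \<open>s\<close> the function \<open>u\<close> feels the forcing and is
      no orbit of \<open>U\<close>, so it is replaced there by the orbit of
      \<open>u s\<close>.\<close>
    let ?W = "\<lambda>t. if t \<le> s then u t else U t s (u s)"
    have hom: "U t r (u r) = u t" if "r \<le> t" "t \<le> s" for r t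
      using u[OF that(1)] that by simp
    show "traj ?W"
      unfolding traj_def
    proof (intro conjI allI impI)
      show "U t r (?W r) = ?W t" if "r \<le> t" for r t
        using that hom[of r t] hom[of r s] U_comp[of r s t "u r"] U_comp[of s r t "u s"] by auto
      have "(u \<longlongrightarrow> 0) at_bot"
        unfolding u_def by (rule filterlim_mono[OF c0_lim order_refl at_bot_le_at_infinity])
      moreover have "\<forall>\<^sub>F t in at_bot. u t = ?W t"
        using eventually_le_at_bot[of s] by eventually_elim simp
      ultimately show "(?W \<longlongrightarrow> 0) at_bot"
        by (rule Lim_transform_eventually)
    qed
  qed simp
  moreover have "E s (u s + x)"
  proof -
    have "(u \<longlongrightarrow> 0) at_top"
      unfolding u_def by (rule filterlim_mono[OF c0_lim order_refl at_top_le_at_infinity])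
    moreover have "\<forall>\<^sub>F t in at_top. \<mu> s + 1 \<le> \<mu> t"
      using mu_at_top by (simp add: filterlim_at_top)
    then have "\<forall>\<^sub>F t in at_top. u t = U t s (u s + x)"
      using eventually_ge_at_top[of s]
    proof eventually_elim
      case (elim t)
      then show ?case
        using u[of s t] by (simp add: linear_add[OF U_linear] V_def max_def algebra_simps)
    qed
    ultimately show ?thesis
      unfolding E_def by (rule Lim_transform_eventually)
  qed
  moreover have "norm (u s + x) \<le> m1 * norm x"
  proof -
    have "norm f \<le> 3 / 2 * (K * exp \<alpha> * norm x)"
    proof (rule c0_norm_le)
      fix t
      show "norm (apply_c0 f t) \<le> 3 / 2 * (K * exp \<alpha> * norm x)"
      proof (cases "t \<le> s \<or> \<mu> s + 1 \<le> \<mu> t")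
        case True
        then show ?thesis
          using K_ge_1 by (simp add: f out)
      next
        case False
        then have "norm (V t) \<le> K * exp \<alpha> * norm x"
          using U_bound_1[of s t x] by (simp add: V_def max_def)
        then show ?thesis
          unfolding f norm_scaleR using dstep_bounds[of "\<mu> t - \<mu> s"] by (intro mult_mono) auto
      qed
    qed
    then have "norm (u s) \<le> c * (3 / 2 * (K * exp \<alpha> * norm x))"
      using c0_norm_ge[of "R f" s] R_norm[of f] c_pos mult_left_mono[of "norm f" _ c]
      unfolding u_def by (meson less_imp_le order_trans)
    then have "norm (u s + x) \<le> (1 + c1 * (K * exp \<alpha>)) * norm x"
      using norm_triangle_ineq[of "u s" x] by (simp add: c1_def algebra_simps)
    also have "\<dots> \<le> m1 * norm x"
      using m1_ge(3) by (intro mult_right_mono) auto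
    finally show ?thesis .
  qed
  ultimately show thesis
    using that[of "u s + x"] F_scaleC[of s "u s" "- 1"] by simp
qed

section \<open>The dichotomy projections\<close>

definition proj :: "real \<Rightarrow> 'a \<Rightarrow> 'a"
  where "proj s x = (THE y. E s y \<and> F s (x - y))"

text \<open>Two splittings of \<open>x\<close> differ by a vector in both subspaces. Linearity,
  idempotence and invariance of \<open>proj\<close> then reduce to membership checks.\<close>

lemma proj_eqI:
  assumes "E s y" "F s (x - y)"
  shows "proj s x = y"
  unfolding proj_def
proof (rule the_equality)
  fix z assume z: "E s z \<and> F s (x - z)"
  have "F s ((x - z) - (x - y))"
    using assms z by (intro F_diff[of s "x - z" "x - y"]) auto
  then have "F s (y - z)"
    by simp
  then show "z = y"
    using E_F_zero[OF E_diff[OF assms(1), of z], of] z by auto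
qed (use assms in auto)

lemma proj: "E s (proj s x)" "F s (x - proj s x)" "norm (proj s x) \<le> m1 * norm x"
  using decomposition[of s x] proj_eqI by metis+

lemma compl_proj_norm: "norm (compl_proj proj s x) \<le> (1 + m1) * norm x"
  unfolding compl_proj_def using norm_triangle_ineq4[of x "proj s x"] proj(3)[of s x]
  by (simp add: algebra_simps)

lemma proj_bclin: "bounded_clinear (proj s)"
  unfolding bounded_clinear_def
proof (intro conjI allI bounded_linear_intro)
  show "proj s (x + y) = proj s x + proj s y" for x y
    using F_add[OF proj(2)[of s x] proj(2)[of s y]]
    by (intro proj_eqI E_add proj) (simp add: algebra_simps)
  show scale: "proj s (scaleC a x) = scaleC a (proj s x)" for a x
    using F_scaleC[OF proj(2)[of s x], of a]
    by (intro proj_eqI E_scaleC proj) (simp add: scaleC_diff_right)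
  show "proj s (r *\<^sub>R x) = r *\<^sub>R proj s x" for r x
    by (simp add: scaleR_scaleC scale)
  show "norm (proj s x) \<le> norm x * m1" for x
    using proj(3)[of s x] by (simp add: mult.commute)
qed

lemma range_compl_proj: "range (compl_proj proj s) = {x. F s x}"
proof safe
  show "F s (compl_proj proj s x)" for x
    using proj(2) by (simp add: compl_proj_def)
  show "x \<in> range (compl_proj proj s)" if "F s x" for x
    using proj_eqI[OF E_zero, of s x] that by (intro range_eqI[of _ _ x]) (simp add: compl_proj_def)
qed

text \<open>The difference lies on a backward orbit that vanishes at \<open>t\<close>, and by
  \<open>traj_bound\<close> such an orbit vanishes at all earlier times.\<close>

lemma U_F_inj:
  assumes "F s x" "F s y" "s \<le> t" "U t s x = U t s y"
  shows "x = y"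
proof -
  have "U t s (x - y) = 0"
    using assms by (simp add: linear_diff[OF U_linear])
  obtain V where V: "traj V" "V s = x - y"
    using F_diff[OF assms(1,2)] by (auto simp: F_def)
  have "V t = 0"
    using traj_U[OF V(1) assms(3)] V(2) \<open>U t s (x - y) = 0\<close> by simp
  then show ?thesis
    using traj_bound[OF V(1) assms(3)] V(2) by simp
qed

lemma compatible: "compatible_projections U proj"
  unfolding compatible_projections_def
proof (intro conjI allI impI)
  show "bounded_clinear (proj t)" for t
    by (rule proj_bclin)
  show "proj t \<circ> proj t = proj t" for t
    using proj_eqI[of t "proj t x" "proj t x" for x] proj(1) F_zero by (auto simp: fun_eq_iff)
  fix t s :: real assume st: "s \<le> t"
  show "proj t \<circ> U t s = U t s \<circ> proj s"
  proof
    fix x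
    have "F t (U t s x - U t s (proj s x))"
      using F_U[OF proj(2)[of s x] st] by (simp add: linear_diff[OF U_linear[OF st]])
    then show "(proj t \<circ> U t s) x = (U t s \<circ> proj s) x"
      using proj_eqI[OF E_U[OF proj(1) st]] by simp
  qed
  show "bij_betw (U t s) (range (compl_proj proj s)) (range (compl_proj proj t))"
    unfolding range_compl_proj bij_betw_def
  proof (intro conjI inj_onI set_eqI iffI)
    show "x = y" if "x \<in> {x. F s x}" "y \<in> {x. F s x}" "U t s x = U t s y" for x y
      using U_F_inj[of s x y t] st that by simp
    show "y \<in> {x. F t x}" if "y \<in> U t s ` {x. F s x}" for y
      using that F_U[OF _ st] by auto
    show "y \<in> U t s ` {x. F s x}" if y: "y \<in> {x. F t x}" for y
    proof -
      obtain V where V: "traj V" "V t = y"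
        using y by (auto simp: F_def)
      then show ?thesis
        using traj_U[OF V(1) st] F_traj[OF V(1), of s] by (intro image_eqI[of _ _ "V s"]) auto
    qed
  qed
qed

lemma U_Q_back_eq:
  assumes "s \<le> t" "F s z" "U t s z = y"
  shows "U_Q_back U proj s t y = z"
  unfolding U_Q_back_def range_compl_proj assms(3)[symmetric]
  by (rule inv_into_f_f) (use assms U_F_inj in \<open>auto intro!: inj_onI\<close>)

text \<open>The inverse selects the value at \<open>s\<close> of the backward orbit ending in
  \<open>compl_proj proj t x\<close>, so \<open>traj_decay\<close> applies to it.\<close>

lemma unstable_back:
  fixes s t x
  assumes st: "s \<le> t"
  defines "z \<equiv> U_Q_back U proj s t (compl_proj proj t x)"
  shows "F s z" "U t s z = compl_proj proj t x"
    "norm z \<le> 2 * m1 * (1 + m1) * exp (- rate * (\<mu> t - \<mu> s)) * norm x"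
proof -
  have "F t (compl_proj proj t x)"
    using proj(2) by (simp add: compl_proj_def)
  then obtain V where V: "traj V" "V t = compl_proj proj t x"
    by (auto simp: F_def)
  have z: "z = V s"
    unfolding z_def using V traj_U[OF V(1) st] by (intro U_Q_back_eq st F_traj) auto
  show "F s z" "U t s z = compl_proj proj t x"
    unfolding z using V traj_U[OF V(1) st] F_traj by auto
  have "norm z \<le> 2 * m1 * exp (- rate * (\<mu> t - \<mu> s)) * norm (compl_proj proj t x)"
    unfolding z using traj_decay[OF V(1) st] V(2) by simp
  also have "\<dots> \<le> 2 * m1 * exp (- rate * (\<mu> t - \<mu> s)) * ((1 + m1) * norm x)"
    using m1_ge(4) by (intro mult_left_mono compl_proj_norm) auto
  finally show "norm z \<le> 2 * m1 * (1 + m1) * exp (- rate * (\<mu> t - \<mu> s)) * norm x"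
    by (simp add: mult_ac)
qed

lemma admits: "admits_dichotomy \<mu> U"
  unfolding admits_dichotomy_def dichotomy_with_def
proof (intro exI conjI allI impI)
  \<comment> \<open>\<open>2 * m1\<close> is the decay constant, and \<open>1 + m1\<close> bounds
    both \<open>proj\<close> and its complement.\<close>
  let ?N = "2 * m1 * (1 + m1)"
  show "compatible_projections U proj"
    by (rule compatible)
  show "rate > 0"
    using len_pos by (simp add: rate_def)
  show "1 \<le> ?N"
    using m1_ge(4) mult_mono[of 1 "2 * m1" 1 "1 + m1"] by simp
  fix t s :: real assume st: "s \<le> t"
  show "onorm (U t s \<circ> proj s) \<le> ?N * exp (- rate * (\<mu> t - \<mu> s))"
  proof (rule onorm_bound)
    show "0 \<le> ?N * exp (- rate * (\<mu> t - \<mu> s))"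
      using m1_ge(4) by simp
    fix x
    have "norm ((U t s \<circ> proj s) x) \<le> 2 * m1 * exp (- rate * (\<mu> t - \<mu> s)) * norm (proj s x)"
      using stable_decay[OF proj(1) st] by simp
    also have "\<dots> \<le> 2 * m1 * exp (- rate * (\<mu> t - \<mu> s)) * ((1 + m1) * norm x)"
      using m1_ge(4) order_trans[OF proj(3)[of s x], of "(1 + m1) * norm x"]
      by (intro mult_left_mono) (auto simp: algebra_simps)
    finally show "norm ((U t s \<circ> proj s) x) \<le> ?N * exp (- rate * (\<mu> t - \<mu> s)) * norm x"
      by (simp add: mult_ac)
  qed
  have le: "norm ((U_Q_back U proj s t \<circ> compl_proj proj t) x) \<le> ?N * exp (- rate * (\<mu> t - \<mu> s)) * norm x" for x
    using unstable_back(3)[OF st] by simp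
  then show "onorm (U_Q_back U proj s t \<circ> compl_proj proj t) \<le> ?N * exp (- rate * (\<mu> t - \<mu> s))"
    using m1_ge(4) by (intro onorm_bound) auto
  note lin = bounded_linear.linear[OF bounded_clinearD(1)[OF proj_bclin]]
  show "bounded_linear (U_Q_back U proj s t \<circ> compl_proj proj t)"
  proof (rule bounded_linear_intro)
    show "(U_Q_back U proj s t \<circ> compl_proj proj t) (x + y) =
        (U_Q_back U proj s t \<circ> compl_proj proj t) x + (U_Q_back U proj s t \<circ> compl_proj proj t) y" for x y
      unfolding o_def
      by (rule U_Q_back_eq[OF st F_add[OF unstable_back(1)[OF st] unstable_back(1)[OF st]]])
         (simp add: linear_add[OF U_linear[OF st]] unstable_back(2)[OF st], simp add: compl_proj_def linear_add[OF lin])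
    show "(U_Q_back U proj s t \<circ> compl_proj proj t) (r *\<^sub>R x) =
        r *\<^sub>R (U_Q_back U proj s t \<circ> compl_proj proj t) x" for r x
      unfolding o_def scaleR_scaleC
      by (rule U_Q_back_eq[OF st F_scaleC[OF unstable_back(1)[OF st]]])
         (simp add: bounded_clinearD(2)[OF U_bclin[OF st]] unstable_back(2)[OF st],
           simp add: compl_proj_def bounded_clinearD(2)[OF proj_bclin] scaleC_diff_right)
    show "norm ((U_Q_back U proj s t \<circ> compl_proj proj t) x) \<le> norm x * (?N * exp (- rate * (\<mu> t - \<mu> s)))" for x
      using le[of x] by (simp add: mult_ac)
  qed
qed

end

section \<open>The Green function represents the inverse\<close>

text \<open>Reduces the integral over the line to exact values on compact intervals around
  \<open>t\<close>, whose errors \<open>A\<close> and \<open>B\<close> vanish separately at the two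
  ends.\<close>

lemma has_integral_UNIV_from_intervals:
  fixes h :: "real \<Rightarrow> 'b::real_normed_vector"
  assumes int: "\<And>a b. a \<le> t \<Longrightarrow> t \<le> b \<Longrightarrow> (h has_integral (A a + B b + I)) {a..b}"
    and A: "(A \<longlongrightarrow> 0) at_bot" and B: "(B \<longlongrightarrow> 0) at_top"
  shows "(h has_integral I) UNIV"
proof -
  have "\<not> (\<exists>a b::real. UNIV = cbox a b)"
    by (metis bounded_cbox not_bounded_UNIV)
  moreover have "\<exists>M>0. \<forall>a b. ball 0 M \<subseteq> cbox a b \<longrightarrow> (\<exists>z. (h has_integral z) (cbox a b) \<and> norm (z - I) < e)"
    if e: "e > 0" for e
  proof -
    obtain a0 where a0: "\<And>a. a \<le> a0 \<Longrightarrow> norm (A a) < e / 2"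
      using tendstoD[OF A, of "e / 2"] e by (auto simp: eventually_at_bot_linorder)
    obtain b0 where b0: "\<And>b. b \<ge> b0 \<Longrightarrow> norm (B b) < e / 2"
      using tendstoD[OF B, of "e / 2"] e by (auto simp: eventually_at_top_linorder)
    define M where "M = 1 + \<bar>t\<bar> + \<bar>a0\<bar> + \<bar>b0\<bar>"
    have "\<exists>z. (h has_integral z) (cbox a b) \<and> norm (z - I) < e" if "ball 0 M \<subseteq> cbox a b" for a b
    proof -
      have "{- M<..<M} \<subseteq> {a..b}"
        using that by (simp add: ball_eq_greaterThanLessThan)
      then have "a \<le> - M" "M \<le> b"
        unfolding greaterThanLessThan_subseteq_atLeastAtMost_iff by (auto simp: M_def)
      then have "a \<le> t" "t \<le> b" "a \<le> a0" "b0 \<le> b"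
        by (auto simp: M_def)
      moreover have "norm (A a + B b + I - I) < e"
        using norm_triangle_ineq[of "A a" "B b"] a0[OF \<open>a \<le> a0\<close>] b0[OF \<open>b0 \<le> b\<close>] by simp
      ultimately show ?thesis
        using int[of a b] by (intro exI[of _ "A a + B b + I"]) simp
    qed
    then show ?thesis
      by (intro exI[of _ M]) (auto simp: M_def)
  qed
  ultimately show ?thesis
    by (subst has_integral_alt) simp
qed

locale smooth_dichotomy = dichotomy +
  assumes C1: "\<mu> C1_differentiable_on UNIV"
begin

section \<open>Substitution and the two halves of the Green integral\<close>

lemma mu_deriv: "(\<mu> has_real_derivative deriv \<mu> x) (at x)"
  and deriv_mu_cont: "continuous_on A (deriv \<mu>)"
proof -
  obtain D where D: "\<And>x. (\<mu> has_vector_derivative D x) (at x)" "continuous_on UNIV D"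
    using C1 by (auto simp: C1_differentiable_on_def)
  then have mu_D: "(\<mu> has_real_derivative D x) (at x)" for x
    by (simp add: has_real_derivative_iff_has_vector_derivative)
  then have "deriv \<mu> = D"
    by (auto intro: DERIV_imp_deriv)
  then show "(\<mu> has_real_derivative deriv \<mu> x) (at x)" "continuous_on A (deriv \<mu>)"
    using mu_D continuous_on_subset[OF D(2), of A] by auto
qed

lemma deriv_mu_nonneg: "deriv \<mu> x \<ge> 0"
  by (rule mono_on_imp_deriv_nonneg[OF _ mu_deriv, of UNIV]) (auto simp: mono_on_def)

text \<open>The substitution \<open>\<tau> = \<mu> t - \<mu> \<xi>\<close> in
  \<open>gen_mild\<close>. It differentiates the primitive \<open>k\<close> along \<xi>, so the
  derivative of \<mu> may vanish and \<open>inv \<mu>\<close> need not be differentiable.\<close>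

lemma mu_mild:
  assumes u: "u \<in> gen_dom T" and at: "a \<le> t"
  shows "((\<lambda>\<xi>. deriv \<mu> \<xi> *\<^sub>R U t \<xi> (apply_c0 (gen T u) \<xi>)) has_integral
    U t a (apply_c0 u a) - apply_c0 u t) {a..t}"
proof -
  define H where "H \<xi> = U t \<xi> (apply_c0 (gen T u) \<xi>)" for \<xi>
  define h where "h = \<mu> t - \<mu> a"
  have h: "h \<ge> 0" "sh t h = a"
    using at by (simp_all add: h_def)
  define k where "k r = integral {0..r} (\<lambda>\<tau>. H (sh t \<tau>))" for r
  have cont: "continuous_on {0..h} (\<lambda>\<tau>. H (sh t \<tau>))"
    unfolding H_def by (intro U_cont continuous_intros) (auto simp: sh_le)
  have kh: "k h = U t a (apply_c0 u a) - apply_c0 u t"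
    using gen_mild[OF u h(1), of t] by (simp add: k_def H_def h(2) integral_unique)
  have "((\<lambda>\<xi>. (- deriv \<mu> \<xi>) *\<^sub>R H \<xi>) has_integral k (\<mu> t - \<mu> t) - k (\<mu> t - \<mu> a)) {a..t}"
  proof (rule fundamental_theorem_of_calculus[OF at])
    fix \<xi> assume \<xi>: "\<xi> \<in> {a..t}"
    have img: "(\<lambda>\<xi>. \<mu> t - \<mu> \<xi>) ` {a..t} \<subseteq> {0..h}"
      by (auto simp: h_def)
    have "(k has_vector_derivative H (sh t (\<mu> t - \<mu> \<xi>))) (at (\<mu> t - \<mu> \<xi>) within {0..h})"
      unfolding k_def by (rule integral_has_vector_derivative[OF cont]) (use \<xi> in \<open>auto simp: h_def\<close>)
    then have 1: "(k has_vector_derivative H \<xi>) (at (\<mu> t - \<mu> \<xi>) within (\<lambda>\<xi>. \<mu> t - \<mu> \<xi>) ` {a..t})"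
      using img by (simp add: has_vector_derivative_within_subset)
    have "((\<lambda>\<xi>. \<mu> t - \<mu> \<xi>) has_real_derivative 0 - deriv \<mu> \<xi>) (at \<xi>)"
      by (intro DERIV_diff DERIV_const mu_deriv)
    then have 2: "((\<lambda>\<xi>. \<mu> t - \<mu> \<xi>) has_vector_derivative - deriv \<mu> \<xi>) (at \<xi> within {a..t})"
      by (simp add: has_real_derivative_iff_has_vector_derivative has_vector_derivative_at_within)
    show "((\<lambda>\<xi>. k (\<mu> t - \<mu> \<xi>)) has_vector_derivative (- deriv \<mu> \<xi>) *\<^sub>R H \<xi>) (at \<xi> within {a..t})"
      using vector_diff_chain_within[OF 2 1] by (simp add: o_def)
  qed
  then have "((\<lambda>\<xi>. - (deriv \<mu> \<xi> *\<^sub>R H \<xi>)) has_integral - k h) {a..t}"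
    by (simp add: k_def h_def)
  then show ?thesis
    unfolding has_integral_neg_iff kh H_def minus_minus .
qed

abbreviation integrand :: "'a c0fun \<Rightarrow> real \<Rightarrow> real \<Rightarrow> 'a"
  where "integrand f t \<xi> \<equiv> deriv \<mu> \<xi> *\<^sub>R green U P t \<xi> (apply_c0 f \<xi>)"

lemma green_left: "\<xi> < t \<Longrightarrow> green U P t \<xi> x = U t \<xi> (P \<xi> x)"
  and green_right: "t < \<xi> \<Longrightarrow> green U P t \<xi> x = - B t \<xi> x"
  by (simp_all add: green_def B_def)

text \<open>\<open>P t\<close> applied to the mild equation and moved inside the propagator. The
  diagonal value of \<open>green\<close> is absorbed as an exception at a single point.\<close>

lemma integrand_left:
  assumes u: "u \<in> gen_dom T" and at: "a \<le> t"
  shows "(integrand (gen T u) t has_integral U t a (P a (apply_c0 u a)) - P t (apply_c0 u t)) {a..t}"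
proof -
  have "((\<lambda>\<xi>. P t (deriv \<mu> \<xi> *\<^sub>R U t \<xi> (apply_c0 (gen T u) \<xi>))) has_integral
      P t (U t a (apply_c0 u a) - apply_c0 u t)) {a..t}"
    using has_integral_linear[OF mu_mild[OF u at] bounded_clinearD(1)[OF P_bclin]] by (simp add: o_def)
  then have "((\<lambda>\<xi>. P t (deriv \<mu> \<xi> *\<^sub>R U t \<xi> (apply_c0 (gen T u) \<xi>))) has_integral
      U t a (P a (apply_c0 u a)) - P t (apply_c0 u t)) {a..t}"
    by (simp add: linear_diff[OF P_linear] P_U at)
  then show ?thesis
    by (rule has_integral_spike_finite[of "{t}", rotated 2])
       (auto simp: green_left linear_cmul[OF P_linear] P_U)
qed

text \<open>The mild equation between \<open>t\<close> and \<open>b\<close> lives at time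
  \<open>b\<close>; \<open>- B t b\<close> projects it and transports it back to
  \<open>t\<close>.\<close>

lemma integrand_right:
  assumes u: "u \<in> gen_dom T" and tb: "t \<le> b"
  shows "(integrand (gen T u) t has_integral B t b (apply_c0 u b) - Q t (apply_c0 u t)) {t..b}"
proof -
  note lin = bounded_linear.linear[OF B_blin[OF tb]]
  have "((\<lambda>\<xi>. - B t b (deriv \<mu> \<xi> *\<^sub>R U b \<xi> (apply_c0 (gen T u) \<xi>))) has_integral
      - B t b (U b t (apply_c0 u t) - apply_c0 u b)) {t..b}"
    using has_integral_neg[OF has_integral_linear[OF mu_mild[OF u tb] B_blin[OF tb]]] by (simp add: o_def)
  then have "((\<lambda>\<xi>. - B t b (deriv \<mu> \<xi> *\<^sub>R U b \<xi> (apply_c0 (gen T u) \<xi>))) has_integral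
      B t b (apply_c0 u b) - Q t (apply_c0 u t)) {t..b}"
    by (simp add: linear_diff[OF lin] B_U tb)
  then show ?thesis
    by (rule has_integral_spike_finite[of "{t}", rotated 2])
       (auto simp: green_right linear_cmul[OF lin] B_U_forward)
qed

text \<open>Off the diagonal the integrand is rewritten with a fixed outer operator,
  \<open>P t\<close> or \<open>B t b\<close>, so that continuity in \<xi> comes from
  \<open>U\<close> alone.\<close>

lemma integrand_norm_left: "a \<le> t \<Longrightarrow> (\<lambda>\<xi>. norm (integrand f t \<xi>)) integrable_on {a..t}"
  and integrand_norm_right: "t \<le> b \<Longrightarrow> (\<lambda>\<xi>. norm (integrand f t \<xi>)) integrable_on {t..b}"
proof -
  show "(\<lambda>\<xi>. norm (integrand f t \<xi>)) integrable_on {a..t}"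
  proof (rule integrable_spike_finite[of "{t}"])
    show "(\<lambda>\<xi>. norm (deriv \<mu> \<xi> *\<^sub>R P t (U t \<xi> (apply_c0 f \<xi>)))) integrable_on {a..t}"
      by (intro integrable_continuous_real continuous_intros deriv_mu_cont U_cont
          bounded_linear.continuous_on[OF bounded_clinearD(1)[OF P_bclin]]) auto
  qed (auto simp: green_left P_U)
  assume tb: "t \<le> b"
  show "(\<lambda>\<xi>. norm (integrand f t \<xi>)) integrable_on {t..b}"
  proof (rule integrable_spike_finite[of "{t}"])
    show "(\<lambda>\<xi>. norm (deriv \<mu> \<xi> *\<^sub>R B t b (U b \<xi> (apply_c0 f \<xi>)))) integrable_on {t..b}"
      by (intro integrable_continuous_real continuous_intros deriv_mu_cont U_cont
          bounded_linear.continuous_on[OF B_blin[OF tb]]) auto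
  qed (auto simp: green_right B_U_forward)
qed

section \<open>Integrability over the whole line\<close>

lemma green_bound: "norm (green U P t \<xi> x) \<le> N * exp (- \<nu> * \<bar>\<mu> t - \<mu> \<xi>\<bar>) * norm x"
proof -
  consider "\<xi> < t" | "\<xi> = t" | "t < \<xi>"
    by linarith
  then show ?thesis
  proof cases
    case 1
    then show ?thesis
      using U_P_bound[of \<xi> t x] by (simp add: green_left abs_of_nonneg)
  next
    case 2
    then show ?thesis
      using N_ge_1 by (simp add: green_def)
  next
    case 3
    then show ?thesis
      using B_bound[of t \<xi> x] by (simp add: green_right abs_of_nonpos)
  qed
qed

text \<open>Explicit primitives on either side of \<open>t\<close>; each side contributes mass
  \<open>1 / \<nu>\<close>.\<close>

lemma weight_integrable: "(\<lambda>\<xi>. deriv \<mu> \<xi> * exp (- \<nu> * \<bar>\<mu> t - \<mu> \<xi>\<bar>)) integrable_on UNIV"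
proof -
  let ?A = "\<lambda>a. - exp (- \<nu> * (\<mu> t - \<mu> a)) / \<nu>" and ?B = "\<lambda>b. - exp (- \<nu> * (\<mu> b - \<mu> t)) / \<nu>"
  have "((\<lambda>\<xi>. deriv \<mu> \<xi> * exp (- \<nu> * \<bar>\<mu> t - \<mu> \<xi>\<bar>)) has_integral 2 / \<nu>) UNIV"
  proof (rule has_integral_UNIV_from_intervals)
    fix a b assume ab: "a \<le> t" "t \<le> b"
    have "((\<lambda>\<xi>. deriv \<mu> \<xi> * exp (- \<nu> * \<bar>\<mu> t - \<mu> \<xi>\<bar>)) has_integral - ?A t - - ?A a) {a..t}"
    proof (rule fundamental_theorem_of_calculus[OF ab(1)])
      fix \<xi> assume "\<xi> \<in> {a..t}"
      moreover have "((\<lambda>\<xi>. - ?A \<xi>) has_real_derivative deriv \<mu> \<xi> * exp (- \<nu> * (\<mu> t - \<mu> \<xi>))) (at \<xi>)"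
        using nu_pos by (auto intro!: derivative_eq_intros mu_deriv)
      ultimately show "((\<lambda>\<xi>. - ?A \<xi>) has_vector_derivative deriv \<mu> \<xi> * exp (- \<nu> * \<bar>\<mu> t - \<mu> \<xi>\<bar>)) (at \<xi> within {a..t})"
        by (simp add: has_real_derivative_iff_has_vector_derivative has_vector_derivative_at_within abs_of_nonneg)
    qed
    moreover have "((\<lambda>\<xi>. deriv \<mu> \<xi> * exp (- \<nu> * \<bar>\<mu> t - \<mu> \<xi>\<bar>)) has_integral ?B b - ?B t) {t..b}"
    proof (rule fundamental_theorem_of_calculus[OF ab(2)])
      fix \<xi> assume "\<xi> \<in> {t..b}"
      moreover have "(?B has_real_derivative deriv \<mu> \<xi> * exp (- \<nu> * (\<mu> \<xi> - \<mu> t))) (at \<xi>)"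
        using nu_pos by (auto intro!: derivative_eq_intros mu_deriv)
      ultimately show "(?B has_vector_derivative deriv \<mu> \<xi> * exp (- \<nu> * \<bar>\<mu> t - \<mu> \<xi>\<bar>)) (at \<xi> within {t..b})"
        by (simp add: has_real_derivative_iff_has_vector_derivative has_vector_derivative_at_within abs_of_nonpos)
    qed
    ultimately have "((\<lambda>\<xi>. deriv \<mu> \<xi> * exp (- \<nu> * \<bar>\<mu> t - \<mu> \<xi>\<bar>)) has_integral (- ?A t - - ?A a) + (?B b - ?B t)) {a..b}"
      by (rule has_integral_combine[OF ab])
    then show "((\<lambda>\<xi>. deriv \<mu> \<xi> * exp (- \<nu> * \<bar>\<mu> t - \<mu> \<xi>\<bar>)) has_integral ?A a + ?B b + 2 / \<nu>) {a..b}"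
      by (simp add: algebra_simps)
  next
    have exp0: "((\<lambda>y. exp (- \<nu> * y) :: real) \<longlongrightarrow> 0) at_top"
      by (rule filterlim_compose[OF exp_at_bot filterlim_tendsto_neg_mult_at_bot[OF tendsto_const _ filterlim_ident]])
         (use nu_pos in simp)
    have "filterlim (\<lambda>a. \<mu> t - \<mu> a) at_top at_bot"
      using filterlim_tendsto_add_at_top[OF tendsto_const[of "\<mu> t"]
          filterlim_compose[OF filterlim_uminus_at_top_at_bot mu_at_bot]] by simp
    from tendsto_divide[OF tendsto_minus[OF filterlim_compose[OF exp0 this]] tendsto_const[of \<nu>]]
    show "(?A \<longlongrightarrow> 0) at_bot"
      using nu_pos by simp
    have "filterlim (\<lambda>b. \<mu> b - \<mu> t) at_top at_top"
      using filterlim_tendsto_add_at_top[OF tendsto_const[of "- \<mu> t"] mu_at_top] by simp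
    from tendsto_divide[OF tendsto_minus[OF filterlim_compose[OF exp0 this]] tendsto_const[of \<nu>]]
    show "(?B \<longlongrightarrow> 0) at_top"
      using nu_pos by simp
  qed
  then show ?thesis
    by blast
qed

text \<open>In the sum of the two halves \<open>P t\<close> and \<open>Q t\<close> add up to the
  identity. The boundary terms are at most \<open>N\<close> times values of \<open>u\<close> far
  out, which tend to 0.\<close>

lemma integrand_has_integral:
  assumes u: "u \<in> gen_dom T"
  shows "(integrand (gen T u) t has_integral - apply_c0 u t) UNIV"
proof (rule has_integral_UNIV_from_intervals)
  fix a b assume ab: "a \<le> t" "t \<le> b"
  have "(integrand (gen T u) t has_integral (U t a (P a (apply_c0 u a)) - P t (apply_c0 u t)) +
      (B t b (apply_c0 u b) - Q t (apply_c0 u t))) {a..b}"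
    by (rule has_integral_combine[OF ab integrand_left[OF u ab(1)] integrand_right[OF u ab(2)]])
  \<comment> \<open>The minimum and maximum do nothing for \<open>a \<le> t \<le> b\<close>; they
    keep the error terms meaningful for all \<open>a\<close> and \<open>b\<close>.\<close>
  then show "(integrand (gen T u) t has_integral
      U t (min a t) (P (min a t) (apply_c0 u (min a t))) + B t (max b t) (apply_c0 u (max b t)) + - apply_c0 u t) {a..b}"
    using ab by (simp add: compl_proj_def min_def max_def algebra_simps)
next
  have le: "N * exp (- \<nu> * (\<mu> y - \<mu> x)) * z \<le> N * z" if "x \<le> y" "0 \<le> z" for x y z
    using that N_ge_1 nu_pos by (intro mult_right_mono) (auto simp: mult_le_cancel_left2)
  have lim: "((\<lambda>s. N * norm (apply_c0 u s)) \<longlongrightarrow> 0) at_infinity"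
    by (intro tendsto_mult_right_zero tendsto_norm_zero c0_lim)
  show "((\<lambda>a. U t (min a t) (P (min a t) (apply_c0 u (min a t)))) \<longlongrightarrow> 0) at_bot"
  proof (rule Lim_null_comparison)
    show "\<forall>\<^sub>F a in at_bot. norm (U t (min a t) (P (min a t) (apply_c0 u (min a t)))) \<le> N * norm (apply_c0 u a)"
      using eventually_le_at_bot[of t]
      by eventually_elim (simp add: min_def, rule order_trans[OF U_P_bound le], auto)
    show "((\<lambda>s. N * norm (apply_c0 u s)) \<longlongrightarrow> 0) at_bot"
      by (rule filterlim_mono[OF lim order_refl at_bot_le_at_infinity])
  qed
  show "((\<lambda>b. B t (max b t) (apply_c0 u (max b t))) \<longlongrightarrow> 0) at_top"
  proof (rule Lim_null_comparison)
    show "\<forall>\<^sub>F b in at_top. norm (B t (max b t) (apply_c0 u (max b t))) \<le> N * norm (apply_c0 u b)"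
      using eventually_ge_at_top[of t]
      by eventually_elim (simp add: max_def, rule order_trans[OF B_bound le], auto)
    show "((\<lambda>s. N * norm (apply_c0 u s)) \<longlongrightarrow> 0) at_top"
      by (rule filterlim_mono[OF lim order_refl at_top_le_at_infinity])
  qed
qed

lemma integrand_abs_integrable: "(\<lambda>\<xi>. norm (integrand f t \<xi>)) integrable_on UNIV"
proof (rule integrable_on_all_intervals_integrable_bound)
  \<comment> \<open>An arbitrary interval may miss \<open>t\<close>, so it is enlarged until it
    contains \<open>t\<close> and then restricted again.\<close>
  show "(\<lambda>\<xi>. if \<xi> \<in> UNIV then norm (integrand f t \<xi>) else 0) integrable_on cbox a b" for a b
  proof -
    have "(\<lambda>\<xi>. norm (integrand f t \<xi>)) integrable_on {min a t..max b t}"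
      using Henstock_Kurzweil_Integration.integrable_combine[OF _ _ integrand_norm_left integrand_norm_right] by simp
    then have "(\<lambda>\<xi>. norm (integrand f t \<xi>)) integrable_on {a..b}"
      by (rule integrable_subinterval_real) auto
    then show ?thesis by simp
  qed
  show "(\<lambda>\<xi>. N * norm f * (deriv \<mu> \<xi> * exp (- \<nu> * \<bar>\<mu> t - \<mu> \<xi>\<bar>))) integrable_on UNIV"
    by (rule integrable_on_mult_right[OF weight_integrable])
  fix \<xi>
  have "norm (integrand f t \<xi>) = deriv \<mu> \<xi> * norm (green U P t \<xi> (apply_c0 f \<xi>))"
    by (simp add: deriv_mu_nonneg)
  also have "\<dots> \<le> deriv \<mu> \<xi> * (N * exp (- \<nu> * \<bar>\<mu> t - \<mu> \<xi>\<bar>) * norm (apply_c0 f \<xi>))"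
    by (intro mult_left_mono green_bound deriv_mu_nonneg)
  also have "\<dots> \<le> deriv \<mu> \<xi> * (N * exp (- \<nu> * \<bar>\<mu> t - \<mu> \<xi>\<bar>) * norm f)"
    using N_ge_1 by (intro mult_left_mono c0_norm_ge deriv_mu_nonneg) auto
  finally show "norm (norm (integrand f t \<xi>)) \<le> N * norm f * (deriv \<mu> \<xi> * exp (- \<nu> * \<bar>\<mu> t - \<mu> \<xi>\<bar>))"
    by (simp add: mult_ac)
qed

end

section \<open>The equivalences\<close>

context evolution
begin

lemma dichotomyI:
  assumes "dichotomy_with \<mu> U P"
  obtains \<nu> N where "dichotomy \<mu> U \<alpha> K P \<nu> N"
proof -
  obtain \<nu> N where "\<nu> > 0" "N \<ge> 1" and est: "\<forall>t s. s \<le> t \<longrightarrow>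
      onorm (U t s \<circ> P s) \<le> N * exp (- \<nu> * (\<mu> t - \<mu> s)) \<and>
      bounded_linear (U_Q_back U P s t \<circ> compl_proj P t) \<and>
      onorm (U_Q_back U P s t \<circ> compl_proj P t) \<le> N * exp (- \<nu> * (\<mu> t - \<mu> s))"
    and "compatible_projections U P"
    using assms unfolding dichotomy_with_def by (elim conjE exE)
  then have "dichotomy \<mu> U \<alpha> K P \<nu> N"
    by (intro dichotomy.intro evolution_axioms dichotomy_axioms.intro) blast+
  then show thesis
    by (rule that)
qed

lemma dichotomy_imp_hyperbolic: "admits_dichotomy \<mu> U \<Longrightarrow> hyperbolic T"
  unfolding admits_dichotomy_def by (elim exE dichotomyI) (rule dichotomy.hyperbolic_T)

lemma hyperbolic_imp_spectrum:
  assumes "hyperbolic T"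
  shows "spectrum (gen_dom T) (gen T) \<inter> {z. Re z = 0} = {}"
proof -
  obtain t where t: "t > 0" and res: "spectrum UNIV (T t) \<inter> {z. cmod z = 1} = {}"
    using assms by (auto simp: hyperbolic_def)
  have "z \<in> resolvent_set (gen_dom T) (gen T)" if "Re z = 0" for z
  proof -
    have "cis (Im z * t) \<in> resolvent_set UNIV (T t)"
      using res by (auto simp: spectrum_def)
    then have "\<i> * of_real (Im z) \<in> resolvent_set (gen_dom T) (gen T)"
      by (rule imaginary_in_resolvent_gen[OF less_imp_le[OF t]])
    also have "\<i> * of_real (Im z) = z"
      using that by (simp add: complex_eq_iff)
    finally show ?thesis .
  qed
  then show ?thesis
    by (auto simp: spectrum_def)
qed

lemma invertible_imp_dichotomy:
  assumes "0 \<in> resolvent_set (gen_dom T) (gen T)"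
  shows "admits_dichotomy \<mu> U"
proof -
  from assms obtain R where R: "bounded_clinear R" "\<And>x. x \<in> gen_dom T \<Longrightarrow> R (scaleC 0 x - gen T x) = x"
    "\<And>y. R y \<in> gen_dom T" "\<And>y. scaleC 0 (R y) - gen T (R y) = y"
    by (rule resolvent_setE) auto
  obtain c where c: "c > 0" "\<And>f. norm (R f) \<le> norm f * c"
    using bounded_linear.pos_bounded[OF bounded_clinearD(1)[OF R(1)]] by blast
  interpret invertible_generator \<mu> U \<alpha> K R c
  proof
    show "gen T (R f) = - f" for f
      using R(4)[of f] by (simp add: minus_equation_iff)
  qed (use R c in \<open>auto simp: mult.commute\<close>)
  show ?thesis
    by (rule admits)
qed

lemma gen_inv_into:
  assumes "0 \<in> resolvent_set (gen_dom T) (gen T)"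
  shows "inv_into (gen_dom T) (gen T) f \<in> gen_dom T" "gen T (inv_into (gen_dom T) (gen T) f) = f"
proof -
  from assms obtain R where R: "\<And>y. R y \<in> gen_dom T" "\<And>y. scaleC 0 (R y) - gen T (R y) = y"
    by (rule resolvent_setE) auto
  have "f = gen T (R (- f))"
    using R(2)[of "- f"] by simp
  then have "f \<in> gen T ` gen_dom T"
    using R(1) by blast
  then show "inv_into (gen_dom T) (gen T) f \<in> gen_dom T" "gen T (inv_into (gen_dom T) (gen T) f) = f"
    by (auto intro: inv_into_into f_inv_into_f)
qed

end

theorem theorem4p4:
  fixes \<mu> :: "real \<Rightarrow> real"
    and U :: "real \<Rightarrow> real \<Rightarrow> 'a \<Rightarrow> 'a::complex_banach"
    and \<alpha> K :: real
  assumes "\<mu> \<in> growth_rates"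
    and "evolution_family U"
    and "\<alpha> > 0" and "K \<ge> 1"
    and "\<And>s \<tau>. \<tau> \<le> s \<Longrightarrow> onorm (U s \<tau>) \<le> K * exp (\<alpha> * (\<mu> s - \<mu> \<tau>))"
  shows "let T = evol_semigroup \<mu> U; D = gen_dom T; G = gen T in
    (admits_dichotomy \<mu> U \<longleftrightarrow> hyperbolic T) \<and>
    (hyperbolic T \<longleftrightarrow> spectrum D G \<inter> {z. Re z = 0} = {}) \<and>
    (spectrum D G \<inter> {z. Re z = 0} = {} \<longleftrightarrow> 0 \<in> resolvent_set D G) \<and>
    (\<mu> C1_differentiable_on UNIV \<longrightarrow>
      (\<forall>P. dichotomy_with \<mu> U P \<longrightarrow>
        (\<forall>f t.
          (\<lambda>\<xi>. deriv \<mu> \<xi> *\<^sub>R green U P t \<xi> (apply_c0 f \<xi>)) integrable_on UNIV \<and>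
          (\<lambda>\<xi>. norm (deriv \<mu> \<xi> *\<^sub>R green U P t \<xi> (apply_c0 f \<xi>))) integrable_on UNIV \<and>
          apply_c0 (inv_into D G f) t =
            - integral UNIV (\<lambda>\<xi>. deriv \<mu> \<xi> *\<^sub>R green U P t \<xi> (apply_c0 f \<xi>)))))"
proof -
  interpret evolution \<mu> U \<alpha> K
    using assms by unfold_locales
  have cd: "0 \<in> resolvent_set (gen_dom T) (gen T)"
    if "spectrum (gen_dom T) (gen T) \<inter> {z. Re z = 0} = {}"
    using that by (auto simp: spectrum_def)
  note cycle = dichotomy_imp_hyperbolic hyperbolic_imp_spectrum cd invertible_imp_dichotomy
  have formula: "(\<lambda>\<xi>. deriv \<mu> \<xi> *\<^sub>R green U P t \<xi> (apply_c0 f \<xi>)) integrable_on UNIV \<and>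
      (\<lambda>\<xi>. norm (deriv \<mu> \<xi> *\<^sub>R green U P t \<xi> (apply_c0 f \<xi>))) integrable_on UNIV \<and>
      apply_c0 (inv_into (gen_dom T) (gen T) f) t =
        - integral UNIV (\<lambda>\<xi>. deriv \<mu> \<xi> *\<^sub>R green U P t \<xi> (apply_c0 f \<xi>))"
    if C1: "\<mu> C1_differentiable_on UNIV" and P: "dichotomy_with \<mu> U P" for P f t
  proof -
    from P obtain \<nu> N where "dichotomy \<mu> U \<alpha> K P \<nu> N"
      by (rule dichotomyI)
    then interpret smooth_dichotomy \<mu> U \<alpha> K P \<nu> N
      using C1 by (simp add: smooth_dichotomy_def smooth_dichotomy_axioms_def)
    have "0 \<in> resolvent_set (gen_dom T) (gen T)"
      using P by (intro cd hyperbolic_imp_spectrum hyperbolic_T)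
    note inv = gen_inv_into[OF this, of f]
    have "(integrand f t has_integral - apply_c0 (inv_into (gen_dom T) (gen T) f) t) UNIV"
      using integrand_has_integral[OF inv(1), of t] unfolding inv(2) .
    then show ?thesis
      using integrand_abs_integrable by (auto simp: has_integral_iff)
  qed
  show ?thesis
    unfolding Let_def
  proof (intro conjI)
    show "admits_dichotomy \<mu> U \<longleftrightarrow> hyperbolic T"
      and "hyperbolic T \<longleftrightarrow> spectrum (gen_dom T) (gen T) \<inter> {z. Re z = 0} = {}"
      and "spectrum (gen_dom T) (gen T) \<inter> {z. Re z = 0} = {} \<longleftrightarrow> 0 \<in> resolvent_set (gen_dom T) (gen T)"
      using cycle by argo+
  qed (intro impI allI formula)
qed

end
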